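(* Let $\phi$ be a local (generalized) contact transformation between two Goursat structures $\mathcal{D}$ and $\tilde{\mathcal{D}}$, defined locally at $p$ and $\tilde p$, respectively, with $\phi(p)=\tilde p$. Let $x$ and $\tilde x$ be local coordinates, centered at $p$ and $\tilde p$, that transform $\mathcal{D}$ and $\tilde{\mathcal{D}}$ into Kumpera-Ruiz normal forms $\kappa^n$ and $\tilde\kappa^n$, respectively (with first prolongations $\kappa^4=R_0(\kappa^3)$, $\tilde\kappa^4=R_0(\tilde\kappa^3)$), and let $\delta_{\mathcal{D}}(p)=w_0\cdots w_{n-4}$ be the singularity type of $\mathcal{D}$ at $p$, which equals $\delta_{\tilde{\mathcal{D}}}(\tilde p)$. The constants $c_i$ and $\tilde c_i$ that appear in the regular prolongations of $\kappa^n$ and $\tilde\kappa^n$, and the contact transformation $\Phi=\tilde x\circ\phi\circ x^{-1}$, fulfill the following relations (for all indices not exceeding $n$): (i) The diffeomorphism $\Phi^{(3)}$ is a first order contact transformation (it maps the distribution spanned by $\kappa^3$ onto that spanned by $\tilde\kappa^3$) and the functions $\nu_3,\eta_3,\mu_3,\lambda_3$ are uniquely determined by $\Phi^{(3)}$. (ii) The diffeomorphism $\Phi^{(4)}$ is uniquely defined by $$\Phi_4(x)=\frac{\eta_3+x_4\nu_3}{\mu_3+x_4\lambda_3},\quad \mu_4=\mu_3+x_4\lambda_3,\quad \nu_4=\mathrm{L}_{\kappa_1^4}\Phi_4=\frac{\mu_3\nu_3-\lambda_3\eta_3}{(\mu_3+x_4\lambda_3)^2},\quad \eta_4=\mathrm{L}_{\kappa_2^4}\Phi_4.$$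 (iii) If $i\ge5$ and $w_{i-4}\ne a_1$ then $\Phi^{(i)}$ is uniquely defined by $$\tilde c_i=c_i\frac{\nu_{i-1}(0)}{\mu_{i-1}(0)}+\frac{\eta_{i-1}(0)}{\mu_{i-1}(0)},\qquad \Phi_i(x)=\frac{1}{\mu_{i-1}}\big((x_i+c_i)\nu_{i-1}+\eta_{i-1}\big)-\tilde c_i,$$ $$\mu_i=\mu_{i-1},\qquad \nu_i=\mathrm{L}_{\kappa_1^i}\Phi_i=\frac{\nu_{i-1}}{\mu_{i-1}},\qquad \eta_i=\mathrm{L}_{\kappa_2^i}\Phi_i.$$ (iv) If $i\ge5$ and $w_{i-4}=a_1$ then $\Phi^{(i)}$ is uniquely defined by $$\Phi_i(x)=\frac{x_i\mu_{i-1}}{\nu_{i-1}+x_i\eta_{i-1}},\quad \mu_i=\nu_{i-1}+x_i\eta_{i-1},\quad \nu_i=\mathrm{L}_{\kappa_1^i}\Phi_i=\frac{\mu_{i-1}\nu_{i-1}}{(\nu_{i-1}+x_i\eta_{i-1})^2},\quad \eta_i=\mathrm{L}_{\kappa_2^i}\Phi_i.$$ Therefore, the (generalized) contact transformation $\Phi$ is uniquely determined by the first order contact transformation $\Phi^{(3)}$.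
   Context: All objects are smooth; $\mathrm{L}_f$ is the Lie derivative along $f$. The derived flag of a distribution is $\mathcal{D}^{(0)}=\mathcal{D}$, $\mathcal{D}^{(i+1)}=\mathcal{D}^{(i)}+[\mathcal{D}^{(i)},\mathcal{D}^{(i)}]$. A Goursat structure on a manifold of dimension $n\geq 3$ is a rank two distribution with $\dim\mathcal{D}^{(i)}(p)=i+2$ for $0\le i\le n-2$ and every $p$. Singularity type. For $n\ge 4$, $0\le i\le n-4$, $\mathcal{C}_i\subset\mathcal{D}^{(i)}$ is the unique involutive subdistribution of constant corank one in $\mathcal{D}^{(i)}$ with $[\mathcal{C}_i,\mathcal{D}^{(i+1)}]\subset\mathcal{D}^{(i+1)}$. For $0\le i\le n-5$, $S_0^{(i)}=\{q:\mathcal{D}^{(i)}(q)=\mathcal{C}_{i+1}(q)\}$; $S_0^{(i)}=\emptyset$ for $i\ge n-4$. For $1\le j\le i$, $S_j^{(i)}=\{q\in S_{j-1}^{(i)}:\mathcal{D}^{(i-j)}(q)\cap T_qS_{j-1}^{(i)}\neq\mathcal{C}_{i-j}(q)\}$; $S_j^{(i)}=\emptyset$ for $j\ge i+1$. These are empty or smooth submanifolds. The singularity type of $\mathcal{D}$ at $p$ is the word of length $n-3$ whose $(m+1)$-st letter counted from the right, $0\le m\le n-4$, is $a_{j+1}$ if there is a (necessarily unique) $j\ge0$ with $p\in S_j^{(m+j)}$, and $a_0$ otherwise. In this statement its letters, read from left to right, are denoted $w_0,w_1,\dots,w_{n-4}$. Kumpera-Ruiz normal forms. On $\mathbb{R}^3$: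 $\kappa_1^3=\frac{\partial}{\partial x_3}$, $\kappa_2^3=x_3\frac{\partial}{\partial x_2}+\frac{\partial}{\partial x_1}$. Given $\kappa^{m-1}=(\kappa_1^{m-1},\kappa_2^{m-1})$ on $\mathbb{R}^{m-1}$ (lifted to $\mathbb{R}^m$ with zero $x_m$-component and coefficients independent of $x_m$), the regular prolongation $R_c(\kappa^{m-1})$, $c\in\mathbb{R}$, is $\kappa_1^m=\frac{\partial}{\partial x_m}$, $\kappa_2^m=(x_m+c)\kappa_1^{m-1}+\kappa_2^{m-1}$; the singular prolongation $S(\kappa^{m-1})$ is $\kappa_1^m=\frac{\partial}{\partial x_m}$, $\kappa_2^m=\kappa_1^{m-1}+x_m\kappa_2^{m-1}$. A Kumpera-Ruiz normal form $\kappa^n$ is obtained from $\kappa^3$ by $n-3$ prolongations, each $S$ or some $R_c$; $\kappa^3,\dots,\kappa^n$ denote the intermediate pairs, and $c_i$ the constant used if $\kappa^i=R_{c_i}(\kappa^{i-1})$. Similarly for $\tilde\kappa^3,\dots,\tilde\kappa^n$, $\tilde c_i$, in coordinates $\tilde x$. Contact transformations. A (generalized) contact transformation between Goursat structures $\mathcal{D}$ on $M$ and $\tilde{\mathcal{D}}$ on $\tilde M$ (both of dimension $n$) is a diffeomorphism $\phi$ with $\phi_*\mathcal{D}=\tilde{\mathcal{D}}$; here it is local, between small neighborhoods $U$ of $p$ and $\tilde U=\phi(U)$ of $\tilde p$. The charts satisfy $x(p)=0$, $\tilde x(\tilde p)=0$, and in them $\mathcal{D}$, $\tilde{\mathcal{D}}$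 are spanned by $\kappa^n$, $\tilde\kappa^n$. Thus $\Phi(0)=0$; $\Phi_i$ denotes the $i$-th component of $\Phi$. One has $\Phi_i=\Phi_i(x_1,x_2,x_3)$ for $1\le i\le3$ and $\Phi_i=\Phi_i(x_1,\dots,x_i)$ for $4\le i\le n$, so for $3\le i\le n$ the map $\Phi^{(i)}=(\Phi_1,\dots,\Phi_i)$ is a local diffeomorphism of $\mathbb{R}^i$; let $\Psi^{(i)}$ be its inverse. The functions $\nu_i,\eta_i,\mu_i$ (and $\lambda_3$), depending only on $x_1,\dots,x_i$, are the unique ones such that $\Phi_*^{(3)}(\kappa_1^3)=(\nu_3\circ\Psi^{(3)})\tilde\kappa_1^3+(\lambda_3\circ\Psi^{(3)})\tilde\kappa_2^3$, $\Phi_*^{(3)}(\kappa_2^3)=(\eta_3\circ\Psi^{(3)})\tilde\kappa_1^3+(\mu_3\circ\Psi^{(3)})\tilde\kappa_2^3$, and, for $i\ge4$, $\Phi_*^{(i)}(\kappa_1^i)=(\nu_i\circ\Psi^{(i)})\tilde\kappa_1^i$, $\Phi_*^{(i)}(\kappa_2^i)=(\eta_i\circ\Psi^{(i)})\tilde\kappa_1^i+(\mu_i\circ\Psi^{(i)})\tilde\kappa_2^i$. *)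

theory Defs
  imports "HOL-Analysis.Analysis" "HOL-Library.Function_Algebras"
begin

section \<open>Smooth maps and smooth manifolds\<close>

text \<open>Used on open sets only, where it is the usual notion of class \<open>C\<^sup>k\<close>.\<close>

primrec Ck_on :: "nat \<Rightarrow> 'v::euclidean_space set \<Rightarrow> ('v \<Rightarrow> 'w::real_normed_vector) \<Rightarrow> bool" where
  "Ck_on 0 S f \<longleftrightarrow> continuous_on S f"
| "Ck_on (Suc k) S f \<longleftrightarrow> (\<forall>x\<in>S. f differentiable (at x)) \<and>
     (\<forall>v. Ck_on k S (\<lambda>x. frechet_derivative f (at x) v))"

definition smooth_on :: "'v::euclidean_space set \<Rightarrow> ('v \<Rightarrow> 'w::real_normed_vector) \<Rightarrow> bool" where
  "smooth_on S f \<longleftrightarrow> (\<forall>k. Ck_on k S f)"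

text \<open>A manifold is a type \<open>'a\<close> (Hausdorff, second countable) with an atlas of charts
  \<open>(U, x)\<close>; only the values of \<open>x\<close> on \<open>U\<close> matter. Its dimension is that of the model
  space \<open>'e\<close>.\<close>

type_synonym ('a, 'e) atlas = "('a set \<times> ('a \<Rightarrow> 'e)) set"

definition smooth_atlas :: "('a::topological_space, 'e::euclidean_space) atlas \<Rightarrow> bool" where
  "smooth_atlas A \<longleftrightarrow> (\<Union>(U, x)\<in>A. U) = UNIV \<and>
     (\<forall>(U, x)\<in>A. open U \<and> open (x ` U) \<and> homeomorphism U (x ` U) x (inv_into U x)) \<and>
     (\<forall>(U, x)\<in>A. \<forall>(V, y)\<in>A. smooth_on (x ` (U \<inter> V)) (y \<circ> inv_into U x))"

definition euclid :: "('e, 'e::euclidean_space) atlas" where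
  "euclid = {(UNIV, id)}"

definition smooth_map :: "('a::topological_space, 'e::euclidean_space) atlas \<Rightarrow>
    ('b::topological_space, 'f::euclidean_space) atlas \<Rightarrow> 'a set \<Rightarrow> ('a \<Rightarrow> 'b) \<Rightarrow> bool" where
  "smooth_map A B W f \<longleftrightarrow> open W \<and> continuous_on W f \<and>
     (\<forall>(U, x)\<in>A. \<forall>(V, y)\<in>B. smooth_on (x ` (U \<inter> W \<inter> f -` V)) (y \<circ> f \<circ> inv_into U x))"

definition diffeo_on :: "('a::topological_space, 'e::euclidean_space) atlas \<Rightarrow>
    ('b::topological_space, 'f::euclidean_space) atlas \<Rightarrow> 'a set \<Rightarrow> ('a \<Rightarrow> 'b) \<Rightarrow> bool" where
  "diffeo_on A B U f \<longleftrightarrow> smooth_map A B U f \<and> inj_on f U \<and> smooth_map B A (f ` U) (inv_into U f)"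

definition smooth_near :: "('a::topological_space, 'e::euclidean_space) atlas \<Rightarrow> 'a \<Rightarrow>
    ('a \<Rightarrow> real) \<Rightarrow> bool" where
  "smooth_near A p f \<longleftrightarrow> (\<exists>W. p \<in> W \<and> smooth_map A euclid W f)"


section \<open>Tangent vectors, vector fields and distributions\<close>

text \<open>Tangent vectors are velocities of curves, viewed as directional derivatives acting on the
  functions that are smooth near the base point (and, by convention, vanishing on all others).\<close>

type_synonym 'a tvec = "('a \<Rightarrow> real) \<Rightarrow> real"

definition tv_scale :: "real \<Rightarrow> 'a tvec \<Rightarrow> 'a tvec" where
  "tv_scale c v = (\<lambda>f. c * v f)"

global_interpretation tv: vector_space "tv_scale :: real \<Rightarrow> 'a tvec \<Rightarrow> 'a tvec"
  by unfold_locales (auto simp: tv_scale_def fun_eq_iff algebra_simps)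

definition velocity :: "('a::topological_space, 'e::euclidean_space) atlas \<Rightarrow> (real \<Rightarrow> 'a) \<Rightarrow> 'a tvec" where
  "velocity A c = (\<lambda>f. if smooth_near A (c 0) f then deriv (f \<circ> c) 0 else 0)"

text \<open>\<open>T\<^sub>q S\<close> for a submanifold \<open>S\<close>; \<open>S = UNIV\<close> gives the tangent space of the whole manifold.\<close>

definition tangent_space :: "('a::topological_space, 'e::euclidean_space) atlas \<Rightarrow> 'a set \<Rightarrow> 'a \<Rightarrow>
    'a tvec set" where
  "tangent_space A S q =
     {velocity A c |c J. 0 \<in> J \<and> smooth_map euclid A J c \<and> c 0 = q \<and> c ` J \<subseteq> S}"

definition smooth_vf :: "('a::topological_space, 'e::euclidean_space) atlas \<Rightarrow> 'a set \<Rightarrow>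
    ('a \<Rightarrow> 'a tvec) \<Rightarrow> bool" where
  "smooth_vf A W X \<longleftrightarrow> open W \<and> (\<forall>q\<in>W. X q \<in> tangent_space A UNIV q) \<and>
     (\<forall>V f. V \<subseteq> W \<and> smooth_map A euclid V f \<longrightarrow> smooth_map A euclid V (\<lambda>q. X q f))"

definition lie_bracket :: "('a::topological_space, 'e::euclidean_space) atlas \<Rightarrow>
    ('a \<Rightarrow> 'a tvec) \<Rightarrow> ('a \<Rightarrow> 'a tvec) \<Rightarrow> 'a \<Rightarrow> 'a tvec" where
  "lie_bracket A X Y q =
     (\<lambda>f. if smooth_near A q f then X q (\<lambda>r. Y r f) - Y q (\<lambda>r. X r f) else 0)"

definition section_on :: "('a::topological_space, 'e::euclidean_space) atlas \<Rightarrow>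
    ('a \<Rightarrow> 'a tvec set) \<Rightarrow> 'a set \<Rightarrow> ('a \<Rightarrow> 'a tvec) \<Rightarrow> bool" where
  "section_on A D W X \<longleftrightarrow> smooth_vf A W X \<and> (\<forall>q\<in>W. X q \<in> D q)"

definition distribution_on :: "('a::topological_space, 'e::euclidean_space) atlas \<Rightarrow> nat \<Rightarrow> 'a set \<Rightarrow>
    ('a \<Rightarrow> 'a tvec set) \<Rightarrow> bool" where
  "distribution_on A k W D \<longleftrightarrow> open W \<and>
     (\<forall>q\<in>W. \<exists>V X. q \<in> V \<and> V \<subseteq> W \<and> (\<forall>j<k. smooth_vf A V (X j)) \<and> open V \<and>
        (\<forall>r\<in>V. D r = tv.span ((\<lambda>j. X j r) ` {..<k}) \<and> tv.dim (D r) = k))"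

definition derived :: "('a::topological_space, 'e::euclidean_space) atlas \<Rightarrow>
    ('a \<Rightarrow> 'a tvec set) \<Rightarrow> 'a \<Rightarrow> 'a tvec set" where
  "derived A D q = tv.span (D q \<union>
     {lie_bracket A X Y q |X Y W. q \<in> W \<and> section_on A D W X \<and> section_on A D W Y})"

definition flag :: "('a::topological_space, 'e::euclidean_space) atlas \<Rightarrow>
    ('a \<Rightarrow> 'a tvec set) \<Rightarrow> nat \<Rightarrow> 'a \<Rightarrow> 'a tvec set" where
  "flag A D i = (derived A ^^ i) D"

definition goursat :: "('a::topological_space, 'e::euclidean_space) atlas \<Rightarrow>
    ('a \<Rightarrow> 'a tvec set) \<Rightarrow> bool" where
  "goursat A D \<longleftrightarrow> DIM('e) \<ge> 3 \<and> distribution_on A 2 UNIV D \<and>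
     (\<forall>i \<le> DIM('e) - 2. \<forall>p. tv.dim (flag A D i p) = i + 2)"


section \<open>Singularity type\<close>

definition char_subdistribution_on :: "('a::topological_space, 'e::euclidean_space) atlas \<Rightarrow>
    ('a \<Rightarrow> 'a tvec set) \<Rightarrow> nat \<Rightarrow> 'a set \<Rightarrow> ('a \<Rightarrow> 'a tvec set) \<Rightarrow> bool" where
  "char_subdistribution_on A D i W C \<longleftrightarrow>
     (\<exists>k. distribution_on A k W C \<and>
        (\<forall>q\<in>W. C q \<subseteq> flag A D i q \<and> tv.dim (flag A D i q) = k + 1)) \<and>
     (\<forall>V X Y. V \<subseteq> W \<and> section_on A C V X \<and> section_on A C V Y \<longrightarrow>
        (\<forall>q\<in>V. lie_bracket A X Y q \<in> C q)) \<and>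
     (\<forall>V X Y. V \<subseteq> W \<and> section_on A C V X \<and> section_on A (flag A D (i + 1)) V Y \<longrightarrow>
        (\<forall>q\<in>V. lie_bracket A X Y q \<in> flag A D (i + 1) q))"

text \<open>\<open>C\<^sub>i(q)\<close>. For \<open>0 \<le> i \<le> n - 4\<close> the conditions above determine \<open>C\<close> on every open set,
  so the value at \<open>q\<close> may be read off on any neighbourhood of \<open>q\<close>.\<close>

definition char_space :: "('a::topological_space, 'e::euclidean_space) atlas \<Rightarrow>
    ('a \<Rightarrow> 'a tvec set) \<Rightarrow> nat \<Rightarrow> 'a \<Rightarrow> 'a tvec set" where
  "char_space A D i q = (THE V. \<exists>W C. q \<in> W \<and> char_subdistribution_on A D i W C \<and> C q = V)"

text \<open>\<open>sing_set A D j i\<close> is \<open>S\<^sub>j\<^sup>(\<^sup>i\<^sup>)\<close>.\<close>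

primrec sing_set :: "('a::topological_space, 'e::euclidean_space) atlas \<Rightarrow>
    ('a \<Rightarrow> 'a tvec set) \<Rightarrow> nat \<Rightarrow> nat \<Rightarrow> 'a set" where
  "sing_set A D 0 i = {q. i + 5 \<le> DIM('e) \<and> flag A D i q = char_space A D (i + 1) q}"
| "sing_set A D (Suc j) i = {q \<in> sing_set A D j i. Suc j \<le> i \<and>
     flag A D (i - Suc j) q \<inter> tangent_space A (sing_set A D j i) q \<noteq> char_space A D (i - Suc j) q}"

text \<open>The letter \<open>a\<^sub>k\<close> is encoded by the number \<open>k\<close>. There is at most one \<open>j\<close> as below,
  so \<open>LEAST\<close> makes no choice.\<close>

definition sing_letter :: "('a::topological_space, 'e::euclidean_space) atlas \<Rightarrow>
    ('a \<Rightarrow> 'a tvec set) \<Rightarrow> 'a \<Rightarrow> nat \<Rightarrow> nat" where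
  "sing_letter A D p m =
     (if \<exists>j. p \<in> sing_set A D j (m + j) then (LEAST j. p \<in> sing_set A D j (m + j)) + 1 else 0)"

definition sing_type :: "('a::topological_space, 'e::euclidean_space) atlas \<Rightarrow>
    ('a \<Rightarrow> 'a tvec set) \<Rightarrow> 'a \<Rightarrow> nat list" where
  "sing_type A D p = rev (map (sing_letter A D p) [0..<DIM('e) - 3])"


section \<open>Contact transformations\<close>

definition push_tvec :: "('a \<Rightarrow> 'b) \<Rightarrow> 'a tvec \<Rightarrow> 'b tvec" where
  "push_tvec \<phi> v = (\<lambda>g. v (g \<circ> \<phi>))"

definition contact_transformation :: "('a::topological_space, 'e::euclidean_space) atlas \<Rightarrow>
    ('a \<Rightarrow> 'a tvec set) \<Rightarrow> ('b::topological_space, 'e) atlas \<Rightarrow> ('b \<Rightarrow> 'b tvec set) \<Rightarrow>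
    'a set \<Rightarrow> ('a \<Rightarrow> 'b) \<Rightarrow> bool" where
  "contact_transformation A D B E U \<phi> \<longleftrightarrow> diffeo_on A B U \<phi> \<and>
     (\<forall>q\<in>U. push_tvec \<phi> ` D q = E (\<phi> q))"


section \<open>Kumpera-Ruiz normal forms\<close>

text \<open>Coordinates are numbered \<open>1, \<dots>, n\<close> along the linear order of the index type. For
  \<open>i \<le> n\<close>, the space \<open>\<real>\<^sup>i\<close> is the subspace of vectors with \<open>x\<^sub>j = 0\<close> for all \<open>j > i\<close>, and
  \<open>low i\<close> is the projection \<open>(x\<^sub>1, \<dots>, x\<^sub>n) \<mapsto> (x\<^sub>1, \<dots>, x\<^sub>i)\<close>. A vector field on \<open>\<real>\<^sup>i\<close> is
  identified with its lift.\<close>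

definition ix :: "nat \<Rightarrow> 'n::{finite,linorder}" where
  "ix k = sorted_list_of_set UNIV ! (k - 1)"

definition crd :: "nat \<Rightarrow> real ^ 'n::{finite,linorder} \<Rightarrow> real" where
  "crd k x = x $ ix k"

definition pd :: "nat \<Rightarrow> real ^ 'n::{finite,linorder}" where
  "pd k = axis (ix k) 1"

definition low :: "nat \<Rightarrow> real ^ 'n::{finite,linorder} \<Rightarrow> (real, 'n) vec" where
  "low i x = (\<Sum>k=1..i. crd k x *\<^sub>R pd k)"

definition Rsub :: "nat \<Rightarrow> (real ^ 'n::{finite,linorder}) set" where
  "Rsub i = {x. \<forall>k\<in>{i<..CARD('n)}. crd k x = 0}"

definition cube :: "real \<Rightarrow> (real ^ 'n) set" where
  "cube r = {x. \<forall>k. \<bar>x $ k\<bar> < r}"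

datatype prolongation = Reg real | Sing

type_synonym 'v vf_pair = "('v \<Rightarrow> 'v) \<times> ('v \<Rightarrow> 'v)"

fun prolong :: "nat \<Rightarrow> prolongation \<Rightarrow> (real ^ 'n::{finite,linorder}) vf_pair \<Rightarrow> (real, 'n) vec vf_pair" where
  "prolong m (Reg c) (k1, k2) = (\<lambda>x. pd m, \<lambda>x. (crd m x + c) *\<^sub>R k1 x + k2 x)"
| "prolong m Sing (k1, k2) = (\<lambda>x. pd m, \<lambda>x. k1 x + crd m x *\<^sub>R k2 x)"

text \<open>\<open>kr_pair ps j\<close> is the pair on \<open>\<real>\<^sup>j\<^sup>+\<^sup>3\<close> obtained from the first \<open>j\<close> prolongations in the
  list \<open>ps\<close>; the pair on \<open>\<real>\<^sup>m\<close> is a prolongation by \<open>ps ! (m - 4)\<close>.\<close>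

primrec kr_pair :: "prolongation list \<Rightarrow> nat \<Rightarrow> (real ^ 'n::{finite,linorder}) vf_pair" where
  "kr_pair ps 0 = (\<lambda>x. pd 3, \<lambda>x. crd 3 x *\<^sub>R pd 2 + pd 1)"
| "kr_pair ps (Suc j) = prolong (j + 4) (ps ! j) (kr_pair ps j)"

definition kappa1 :: "prolongation list \<Rightarrow> nat \<Rightarrow> real ^ 'n::{finite,linorder} \<Rightarrow> (real, 'n) vec" where
  "kappa1 ps m = fst (kr_pair ps (m - 3))"

definition kappa2 :: "prolongation list \<Rightarrow> nat \<Rightarrow> real ^ 'n::{finite,linorder} \<Rightarrow> (real, 'n) vec" where
  "kappa2 ps m = snd (kr_pair ps (m - 3))"

definition coord_tvec :: "('a::topological_space, 'e::euclidean_space) atlas \<Rightarrow> 'a set \<Rightarrow>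
    ('a \<Rightarrow> 'e) \<Rightarrow> 'a \<Rightarrow> 'e \<Rightarrow> 'a tvec" where
  "coord_tvec A U x q a = velocity A (\<lambda>t. inv_into U x (x q + t *\<^sub>R a))"

definition kr_coordinates :: "('a::topological_space, real ^ 'n::{finite,linorder}) atlas \<Rightarrow>
    ('a \<Rightarrow> 'a tvec set) \<Rightarrow> 'a \<Rightarrow> 'a set \<Rightarrow> ('a \<Rightarrow> (real, 'n) vec) \<Rightarrow> prolongation list \<Rightarrow> bool" where
  "kr_coordinates A D p U x ps \<longleftrightarrow>
     diffeo_on A euclid U x \<and> p \<in> U \<and> x p = 0 \<and>
     length ps = CARD('n) - 3 \<and> (CARD('n) \<ge> 4 \<longrightarrow> ps ! 0 = Reg 0) \<and>
     (\<forall>q\<in>U. D q = tv.span {coord_tvec A U x q (kappa1 ps CARD('n) (x q)),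
                           coord_tvec A U x q (kappa2 ps CARD('n) (x q))})"


section \<open>The truncations of a triangular map\<close>

text \<open>\<open>trunc \<Phi> i\<close> is \<open>\<Phi>\<^sup>(\<^sup>i\<^sup>) = (\<Phi>\<^sub>1, \<dots>, \<Phi>\<^sub>i)\<close> on \<open>\<real>\<^sup>i\<close>, precomposed with the projection.\<close>

definition trunc :: "(real ^ 'n::{finite,linorder} \<Rightarrow> (real, 'n) vec) \<Rightarrow> nat \<Rightarrow> (real, 'n) vec \<Rightarrow> (real, 'n) vec" where
  "trunc \<Phi> i x = low i (\<Phi> (low i x))"

text \<open>\<open>F\<close> is a diffeomorphism from the open subset \<open>W\<close> of \<open>\<real>\<^sup>i\<close> onto an open subset of \<open>\<real>\<^sup>i\<close>.\<close>

definition diffeo_sub :: "nat \<Rightarrow> (real ^ 'n::{finite,linorder}) set \<Rightarrow> ((real, 'n) vec \<Rightarrow> (real, 'n) vec) \<Rightarrow> bool" where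
  "diffeo_sub i W F \<longleftrightarrow>
     openin (top_of_set (Rsub i)) W \<and> openin (top_of_set (Rsub i)) (F ` W) \<and> inj_on F W \<and>
     smooth_on (low i -` W) (F \<circ> low i) \<and> smooth_on (low i -` (F ` W)) (inv_into W F \<circ> low i)"

definition push_vf :: "('v::real_normed_vector \<Rightarrow> 'v) \<Rightarrow> 'v set \<Rightarrow> ('v \<Rightarrow> 'v) \<Rightarrow> 'v \<Rightarrow> 'v" where
  "push_vf F W X y = frechet_derivative F (at (inv_into W F y)) (X (inv_into W F y))"

definition lie_deriv :: "('v::real_normed_vector \<Rightarrow> 'v) \<Rightarrow> ('v \<Rightarrow> real) \<Rightarrow> 'v \<Rightarrow> real" where
  "lie_deriv X f x = frechet_derivative f (at x) (X x)"

definition depends_on_first :: "nat \<Rightarrow> real \<Rightarrow> (real ^ 'n::{finite,linorder} \<Rightarrow> real) \<Rightarrow> bool" where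
  "depends_on_first i r f \<longleftrightarrow> (\<forall>x\<in>cube r. f x = f (low i x))"

text \<open>The defining relations of \<open>\<nu>\<^sub>3, \<eta>\<^sub>3, \<mu>\<^sub>3, \<lambda>\<^sub>3\<close> and of \<open>\<nu>\<^sub>i, \<eta>\<^sub>i, \<mu>\<^sub>i\<close> (\<open>i \<ge> 4\<close>) over the cube of
  radius \<open>r\<close>; \<open>\<psi>\<close> is the inverse \<open>\<Psi>\<^sup>(\<^sup>i\<^sup>)\<close>.\<close>

definition push_coeffs3 :: "prolongation list \<Rightarrow> prolongation list \<Rightarrow>
    (real ^ 'n::{finite,linorder} \<Rightarrow> (real, 'n) vec) \<Rightarrow> real \<Rightarrow> ((real, 'n) vec \<Rightarrow> real) \<Rightarrow>
    ((real, 'n) vec \<Rightarrow> real) \<Rightarrow> ((real, 'n) vec \<Rightarrow> real) \<Rightarrow> ((real, 'n) vec \<Rightarrow> real) \<Rightarrow> bool" where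
  "push_coeffs3 ps qs \<Phi> r \<nu> \<eta> \<mu> l \<longleftrightarrow>
     (\<forall>f\<in>{\<nu>, \<eta>, \<mu>, l}. depends_on_first 3 r f) \<and>
     (let W = cube r \<inter> Rsub 3; F = trunc \<Phi> 3; \<psi> = inv_into W F in
      \<forall>y \<in> F ` W.
        push_vf F W (kappa1 ps 3) y = \<nu> (\<psi> y) *\<^sub>R kappa1 qs 3 y + l (\<psi> y) *\<^sub>R kappa2 qs 3 y \<and>
        push_vf F W (kappa2 ps 3) y = \<eta> (\<psi> y) *\<^sub>R kappa1 qs 3 y + \<mu> (\<psi> y) *\<^sub>R kappa2 qs 3 y)"

definition push_coeffs :: "prolongation list \<Rightarrow> prolongation list \<Rightarrow>
    (real ^ 'n::{finite,linorder} \<Rightarrow> (real, 'n) vec) \<Rightarrow> real \<Rightarrow> nat \<Rightarrow> ((real, 'n) vec \<Rightarrow> real) \<Rightarrow>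
    ((real, 'n) vec \<Rightarrow> real) \<Rightarrow> ((real, 'n) vec \<Rightarrow> real) \<Rightarrow> bool" where
  "push_coeffs ps qs \<Phi> r i \<nu> \<eta> \<mu> \<longleftrightarrow>
     (\<forall>f\<in>{\<nu>, \<eta>, \<mu>}. depends_on_first i r f) \<and>
     (let W = cube r \<inter> Rsub i; F = trunc \<Phi> i; \<psi> = inv_into W F in
      \<forall>y \<in> F ` W.
        push_vf F W (kappa1 ps i) y = \<nu> (\<psi> y) *\<^sub>R kappa1 qs i y \<and>
        push_vf F W (kappa2 ps i) y = \<eta> (\<psi> y) *\<^sub>R kappa1 qs i y + \<mu> (\<psi> y) *\<^sub>R kappa2 qs i y)"

end

theory Submission
  imports Defs
begin

text \<open>
  The relations of the theorem are a comparison of frames. Put \<open>m = n - i\<close>. In Kumpera-Ruiz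
  coordinates \<open>D\<^sup>(\<^sup>i\<^sup>)\<close> is spanned by \<open>\<partial>\<^sub>m, \<dots>, \<partial>\<^sub>n\<close> and the single further field \<open>\<kappa>\<^sub>2\<^sup>m\<close>, because
  \<open>\<kappa>\<^sub>2\<^sup>m\<close> is a combination of \<open>\<kappa>\<^sub>1\<^sup>m\<^sup>-\<^sup>1\<close> and \<open>\<kappa>\<^sub>2\<^sup>m\<^sup>-\<^sup>1\<close> and the bracket \<open>[\<partial>\<^sub>m, \<kappa>\<^sub>2\<^sup>m]\<close> supplies the direction
  that is missing to have both of them (\<open>kr_bracket\<close>, \<open>flag_kr\<close>). The same bracket formula shows that
  \<open>\<partial>\<^sub>m, \<dots>, \<partial>\<^sub>n\<close> span the characteristic subdistribution \<open>C\<^sub>i\<close>, for \<open>m \<ge> 4\<close> (\<open>char_value_kr\<close>).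

  Derived flag, characteristic subdistributions and tangent spaces are defined from the smooth
  structure alone, so that local diffeomorphisms carry them along (locale \<open>diffeo_pair\<close>). This has two
  consequences.

  First, the singularity type is invariant (\<open>sing_type_push\<close>) and can be computed at the origin of a
  normal form. The letter for the index \<open>i \<ge> 5\<close> is \<open>a\<^sub>1\<close> iff \<open>D\<^sup>(\<^sup>n\<^sup>-\<^sup>i\<^sup>) = C\<^sub>n\<^sub>-\<^sub>i\<^sub>+\<^sub>1\<close> there, that is, iff
  \<open>\<kappa>\<^sub>2\<^sup>i\<close> is a combination of \<open>\<partial>\<^sub>i\<^sub>-\<^sub>1, \<dots>, \<partial>\<^sub>n\<close> at \<open>0\<close>. Since \<open>\<kappa>\<^sub>2\<^sup>i = (x\<^sub>i + c) \<kappa>\<^sub>1\<^sup>i\<^sup>-\<^sup>1 + \<kappa>\<^sub>2\<^sup>i\<^sup>-\<^sup>1\<close> or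
  \<open>\<kappa>\<^sub>2\<^sup>i = \<kappa>\<^sub>1\<^sup>i\<^sup>-\<^sup>1 + x\<^sub>i \<kappa>\<^sub>2\<^sup>i\<^sup>-\<^sup>1\<close>, this singles out the singular prolongations (\<open>sing_type_kr\<close>). Hence both normal
  forms are prolonged in the same way at every index.

  Second, the derivative of \<open>\<Phi>\<close> maps the span of \<open>\<partial>\<^sub>m, \<dots>, \<partial>\<^sub>n\<close> to itself for \<open>m \<ge> 4\<close>, which makes
  \<open>\<Phi>\<close> triangular (\<open>depends_component\<close>), and it maps the flag to the flag, which yields the coefficients
  \<open>\<nu>, \<eta>, \<mu>, \<lambda>\<close> (\<open>frame\<close>). Write \<open>\<kappa>\<^sub>2\<^sup>i = a \<kappa>\<^sub>1\<^sup>i\<^sup>-\<^sup>1 + b \<kappa>\<^sub>2\<^sup>i\<^sup>-\<^sup>1\<close>, and with \<open>a', b'\<close> on the other side. The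
  image of \<open>\<kappa>\<^sub>2\<^sup>i\<close> can be expanded through the images of \<open>\<kappa>\<^sub>1\<^sup>i\<^sup>-\<^sup>1, \<kappa>\<^sub>2\<^sup>i\<^sup>-\<^sup>1\<close>, and it is \<open>\<mu>\<^sub>i\<close> times the field
  on the other side modulo \<open>\<partial>\<^sub>i, \<dots>, \<partial>\<^sub>n\<close>. Comparing coefficients gives
  \<open>a \<nu>\<^sub>i\<^sub>-\<^sub>1 + b \<eta>\<^sub>i\<^sub>-\<^sub>1 = \<mu>\<^sub>i a'\<close> and \<open>a \<lambda>\<^sub>i\<^sub>-\<^sub>1 + b \<mu>\<^sub>i\<^sub>-\<^sub>1 = \<mu>\<^sub>i b'\<close> with \<open>\<lambda>\<^sub>i\<^sub>-\<^sub>1 = 0\<close> for \<open>i \<ge> 5\<close>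
  (\<open>prolonged_relations\<close>). All formulas for \<open>\<Phi>\<^sub>i\<close> and \<open>\<mu>\<^sub>i\<close> are these two equations, solved in the two
  cases; the value at \<open>0\<close> relates the constants; the formulas for \<open>\<nu>\<^sub>i\<close> follow by differentiating along
  \<open>x\<^sub>i\<close>.

  The truncations of \<open>\<Phi>\<close> are diffeomorphisms because the inverse of \<open>\<Phi>\<close> is again a contact
  transformation, hence triangular, so that its truncations are inverse to those of \<open>\<Phi>\<close>
  (\<open>diffeo_sub_trunc\<close>). Uniqueness is an induction on \<open>i\<close>: the relations express \<open>\<Phi>\<^sub>i\<close> by coefficients
  with index \<open>i - 1\<close>, which are derivatives of \<open>\<Phi>\<^sub>1, \<dots>, \<Phi>\<^sub>i\<^sub>-\<^sub>1\<close> (\<open>kr_contact_unique\<close>).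
\<close>

section \<open>Calculus of smooth functions\<close>

lemma Ck_on_subset: "Ck_on k S f \<Longrightarrow> T \<subseteq> S \<Longrightarrow> Ck_on k T f"
  by (induction k arbitrary: f) (auto intro: continuous_on_subset)

lemma Ck_on_SucD: "Ck_on (Suc k) S f \<Longrightarrow> Ck_on k S f"
proof (induction k arbitrary: f)
  case 0
  then show ?case
    by (simp add: differentiable_imp_continuous_within continuous_at_imp_continuous_on)
next
  case (Suc k)
  from Suc.prems show ?case
    using Suc.IH by (metis Ck_on.simps(2))
qed

lemma Ck_on_cong:
  assumes "open S" "\<And>x. x \<in> S \<Longrightarrow> f x = g x" "Ck_on k S f"
  shows "Ck_on k S g"
  using assms(2,3)
proof (induction k arbitrary: f g)
  case 0
  then show ?case by (metis Ck_on.simps(1) continuous_on_cong)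
next
  case (Suc k)
  have D: "frechet_derivative f (at x) = frechet_derivative g (at x)" if "x \<in> S" for x
    using Suc.prems that assms(1) by (intro frechet_derivative_transform_within_open[of _ _ S]) auto
  have "g differentiable (at x)" if "x \<in> S" for x
  proof -
    have "(f has_derivative frechet_derivative f (at x)) (at x)"
      using Suc.prems that frechet_derivative_works by auto
    then have "(g has_derivative frechet_derivative f (at x)) (at x)"
      using has_derivative_transform_within_open[OF _ assms(1) that, of f _ UNIV g] Suc.prems(1) by auto
    then show ?thesis by (auto simp: differentiable_def)
  qed
  moreover have "Ck_on k S (\<lambda>x. frechet_derivative g (at x) v)" for v
    by (rule Suc.IH[of "\<lambda>x. frechet_derivative f (at x) v"]) (use Suc.prems D in auto)
  ultimately show ?case by simp
qed

lemma Ck_on_local: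
  assumes "\<And>x. x \<in> S \<Longrightarrow> \<exists>T. open T \<and> x \<in> T \<and> Ck_on k T f"
  shows "Ck_on k S f"
  using assms
proof (induction k arbitrary: f)
  case 0
  show ?case unfolding Ck_on.simps
  proof (rule continuous_at_imp_continuous_on, rule ballI)
    fix x assume "x \<in> S"
    then obtain T where "open T" "x \<in> T" "continuous_on T f" using 0 by auto
    then show "isCont f x" by (simp add: continuous_on_eq_continuous_at)
  qed
next
  case (Suc k)
  show ?case unfolding Ck_on.simps(2)
  proof (intro conjI ballI allI)
    fix x assume "x \<in> S" then show "f differentiable at x" using Suc.prems by auto
  next
    fix v show "Ck_on k S (\<lambda>x. frechet_derivative f (at x) v)"
      by (rule Suc.IH) (use Suc.prems in \<open>metis Ck_on.simps(2)\<close>)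
  qed
qed

lemma Ck_on_const: "Ck_on k S (\<lambda>x. c)"
  by (induction k arbitrary: c) auto

lemma Ck_on_linear:
  assumes "bounded_linear f" shows "Ck_on k S f"
proof (cases k)
  case 0 then show ?thesis by (simp add: assms linear_continuous_on)
next
  case (Suc m)
  have "frechet_derivative f (at x) = f" for x
    using assms bounded_linear_imp_has_derivative frechet_derivative_at by metis
  then show ?thesis
    using Suc assms by (auto simp: Ck_on_const bounded_linear_imp_differentiable)
qed

lemma Ck_on_add:
  assumes "open S" "Ck_on k S f" "Ck_on k S g"
  shows "Ck_on k S (\<lambda>x. f x + g x)"
  using assms(2,3)
proof (induction k arbitrary: f g)
  case 0 then show ?case by (simp add: continuous_on_add)
next
  case (Suc k)
  have "frechet_derivative (\<lambda>x. f x + g x) (at x) v = frechet_derivative f (at x) v + frechet_derivative g (at x) v"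
    if "x \<in> S" for x v
  proof -
    have "((\<lambda>x. f x + g x) has_derivative (\<lambda>v. frechet_derivative f (at x) v + frechet_derivative g (at x) v)) (at x)"
      using Suc.prems that by (auto intro!: has_derivative_add simp: frechet_derivative_works[symmetric])
    from frechet_derivative_at[OF this] show ?thesis by (metis)
  qed
  then show ?case
    using Suc by (auto intro: differentiable_add
      Ck_on_cong[OF assms(1), where f = "\<lambda>x. frechet_derivative f (at x) v + frechet_derivative g (at x) v" for v])
qed

lemma Ck_on_bilinear:
  assumes b: "bounded_bilinear B" and "open S" "Ck_on k S f" "Ck_on k S g"
  shows "Ck_on k S (\<lambda>x. B (f x) (g x))"
  using assms(3,4)
proof (induction k arbitrary: f g)
  case 0 then show ?case by (simp add: bounded_bilinear.continuous_on[OF b])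
next
  case (Suc k)
  have D: "((\<lambda>x. B (f x) (g x)) has_derivative
     (\<lambda>v. B (f x) (frechet_derivative g (at x) v) + B (frechet_derivative f (at x) v) (g x))) (at x)"
    if "x \<in> S" for x
      using Suc.prems that by (auto intro!: bounded_bilinear.FDERIV[OF b] simp: frechet_derivative_works[symmetric])
  have E: "frechet_derivative (\<lambda>x. B (f x) (g x)) (at x) v =
    B (f x) (frechet_derivative g (at x) v) + B (frechet_derivative f (at x) v) (g x)" if "x \<in> S" for x v
    using frechet_derivative_at[OF D[OF that]] by metis
  have "Ck_on k S (\<lambda>x. B (f x) (frechet_derivative g (at x) v) + B (frechet_derivative f (at x) v) (g x))" for v
    using Suc.prems Ck_on_SucD[OF Suc.prems(1)] Ck_on_SucD[OF Suc.prems(2)]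
    by (intro Ck_on_add assms(2) Suc.IH) auto
  then have "Ck_on k S (\<lambda>x. frechet_derivative (\<lambda>x. B (f x) (g x)) (at x) v)" for v
    by (rule Ck_on_cong[OF assms(2), rotated]) (simp add: E)
  then show ?case using D by (auto simp: differentiable_def)
qed

lemma Ck_on_sum:
  assumes "open S" "\<And>i. i \<in> I \<Longrightarrow> Ck_on k S (f i)"
  shows "Ck_on k S (\<lambda>x. \<Sum>i\<in>I. f i x)"
  using assms(2) by (induction I rule: infinite_finite_induct) (auto intro: Ck_on_const Ck_on_add assms(1))

lemma Ck_on_linear_compose:
  assumes "bounded_linear h" "open S" "Ck_on k S f"
  shows "Ck_on k S (\<lambda>x. h (f x))"
  using assms(3)
proof (induction k arbitrary: f)
  case 0 then show ?case using bounded_linear.continuous_on[OF assms(1)] by simp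
next
  case (Suc k)
  have D: "((\<lambda>x. h (f x)) has_derivative (\<lambda>v. h (frechet_derivative f (at x) v))) (at x)" if "x \<in> S" for x
    using Suc.prems that by (auto intro!: bounded_linear.has_derivative[OF assms(1)] simp: frechet_derivative_works[symmetric])
  have "Ck_on k S (\<lambda>x. h (frechet_derivative f (at x) v))" for v
    using Suc by auto
  then have "Ck_on k S (\<lambda>x. frechet_derivative (\<lambda>x. h (f x)) (at x) v)" for v
    by (rule Ck_on_cong[OF assms(2), rotated]) (simp add: frechet_derivative_at[OF D, symmetric])
  then show ?case using D by (auto simp: differentiable_def)
qed

text \<open>The chain rule produces \<open>Dg (f x) (Df x v)\<close>, whose direction depends on \<open>x\<close>. Expanding
  \<open>Df x v\<close> in the standard basis turns it into a sum of products of functions with a fixed direction,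
  to which the induction hypothesis applies.\<close>
lemma Ck_on_compose:
  fixes f :: "'v::euclidean_space \<Rightarrow> 'w::euclidean_space" and g :: "'w \<Rightarrow> 'z::real_normed_vector"
  assumes "open S" "f ` S \<subseteq> T" "Ck_on k S f" "Ck_on k T g"
  shows "Ck_on k S (\<lambda>x. g (f x))"
  using assms(3,4)
proof (induction k arbitrary: g)
  case 0 then show ?case using assms(2) by (auto intro: continuous_on_compose2)
next
  case (Suc k)
  have D: "((\<lambda>x. g (f x)) has_derivative (\<lambda>v. frechet_derivative g (at (f x)) (frechet_derivative f (at x) v))) (at x)"
    if "x \<in> S" for x
    using Suc.prems that assms(2)
    by (intro has_derivative_compose[of f _ x UNIV g]) (auto simp: frechet_derivative_works[symmetric])
  have E: "frechet_derivative (\<lambda>x. g (f x)) (at x) v =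
     (\<Sum>b\<in>Basis. (frechet_derivative f (at x) v \<bullet> b) *\<^sub>R frechet_derivative g (at (f x)) b)" if "x \<in> S" for x v
  proof -
    have lin: "linear (frechet_derivative g (at (f x)))"
      using Suc.prems that assms(2) by (auto intro!: linear_frechet_derivative)
    have "frechet_derivative (\<lambda>x. g (f x)) (at x) v = frechet_derivative g (at (f x)) (frechet_derivative f (at x) v)"
      using frechet_derivative_at[OF D[OF that]] by metis
    also have "\<dots> = frechet_derivative g (at (f x)) (\<Sum>b\<in>Basis. (frechet_derivative f (at x) v \<bullet> b) *\<^sub>R b)"
      by (simp add: euclidean_representation)
    also have "\<dots> = (\<Sum>b\<in>Basis. (frechet_derivative f (at x) v \<bullet> b) *\<^sub>R frechet_derivative g (at (f x)) b)"
      by (simp add: linear_sum[OF lin] linear_scale[OF lin])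
    finally show ?thesis .
  qed
  have "Ck_on k S (\<lambda>x. \<Sum>b\<in>Basis. (frechet_derivative f (at x) v \<bullet> b) *\<^sub>R frechet_derivative g (at (f x)) b)" for v
  proof (intro Ck_on_sum Ck_on_bilinear[OF bounded_bilinear_scaleR] assms(1))
    fix b :: 'w
    show "Ck_on k S (\<lambda>x. frechet_derivative f (at x) v \<bullet> b)"
      using Suc.prems by (intro Ck_on_linear_compose[OF bounded_linear_inner_left] assms(1)) auto
    show "Ck_on k S (\<lambda>x. frechet_derivative g (at (f x)) b)"
      by (rule Suc.IH) (use Suc.prems Ck_on_SucD in auto)
  qed
  then have "Ck_on k S (\<lambda>x. frechet_derivative (\<lambda>x. g (f x)) (at x) v)" for v
    by (rule Ck_on_cong[OF assms(1), rotated]) (simp add: E)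
  then show ?case using D by (auto simp: differentiable_def)
qed

lemma smooth_on_subset: "smooth_on S f \<Longrightarrow> T \<subseteq> S \<Longrightarrow> smooth_on T f"
  by (auto simp: smooth_on_def intro: Ck_on_subset)

lemma smooth_on_cong:
  "open S \<Longrightarrow> (\<And>x. x \<in> S \<Longrightarrow> f x = g x) \<Longrightarrow> smooth_on S f \<Longrightarrow> smooth_on S g"
  unfolding smooth_on_def using Ck_on_cong by metis

lemma smooth_on_local:
  "(\<And>x. x \<in> S \<Longrightarrow> \<exists>T. open T \<and> x \<in> T \<and> smooth_on T f) \<Longrightarrow> smooth_on S f"
  unfolding smooth_on_def by (meson Ck_on_local)

lemma smooth_on_const: "smooth_on S (\<lambda>x. c)"
  by (simp add: smooth_on_def Ck_on_const)

lemma smooth_on_linear: "bounded_linear f \<Longrightarrow> smooth_on S f"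
  by (simp add: smooth_on_def Ck_on_linear)

lemma smooth_on_add: "open S \<Longrightarrow> smooth_on S f \<Longrightarrow> smooth_on S g \<Longrightarrow> smooth_on S (\<lambda>x. f x + g x)"
  by (simp add: smooth_on_def Ck_on_add)

lemma smooth_on_bilinear: "bounded_bilinear B \<Longrightarrow> open S \<Longrightarrow> smooth_on S f \<Longrightarrow> smooth_on S g
   \<Longrightarrow> smooth_on S (\<lambda>x. B (f x) (g x))"
  by (simp add: smooth_on_def Ck_on_bilinear)

lemmas smooth_on_scaleR = smooth_on_bilinear[OF bounded_bilinear_scaleR]
lemmas smooth_on_mult = smooth_on_bilinear[OF bounded_bilinear_mult]

lemma smooth_on_sum: "open S \<Longrightarrow> (\<And>i. i \<in> I \<Longrightarrow> smooth_on S (f i)) \<Longrightarrow> smooth_on S (\<lambda>x. \<Sum>i\<in>I. f i x)"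
  by (simp add: smooth_on_def Ck_on_sum)

lemma smooth_on_linear_compose:
  "bounded_linear h \<Longrightarrow> open S \<Longrightarrow> smooth_on S f \<Longrightarrow> smooth_on S (\<lambda>x. h (f x))"
  by (simp add: smooth_on_def Ck_on_linear_compose)

lemma smooth_on_compose:
  fixes f :: "'v::euclidean_space \<Rightarrow> 'w::euclidean_space"
  shows "open S \<Longrightarrow> f ` S \<subseteq> T \<Longrightarrow> smooth_on S f \<Longrightarrow> smooth_on T g \<Longrightarrow> smooth_on S (\<lambda>x. g (f x))"
  by (simp add: smooth_on_def Ck_on_compose)

lemma smooth_on_derivative: "smooth_on S f \<Longrightarrow> smooth_on S (\<lambda>x. frechet_derivative f (at x) v)"
  unfolding smooth_on_def by (metis Ck_on.simps(2))

lemma smooth_on_differentiable: "smooth_on S f \<Longrightarrow> x \<in> S \<Longrightarrow> f differentiable (at x)"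
  unfolding smooth_on_def by (metis Ck_on.simps(2))

lemma smooth_on_has_derivative:
  "smooth_on S f \<Longrightarrow> x \<in> S \<Longrightarrow> (f has_derivative frechet_derivative f (at x)) (at x)"
  using smooth_on_differentiable frechet_derivative_works by blast

lemma smooth_on_continuous: "smooth_on S f \<Longrightarrow> continuous_on S f"
  unfolding smooth_on_def by (metis Ck_on.simps(1))

text \<open>This is what makes Lie derivatives along smooth vector fields smooth.\<close>
lemma smooth_on_derivative_along:
  fixes X :: "'v::euclidean_space \<Rightarrow> 'v"
  assumes "open S" "smooth_on S f" "smooth_on S X"
  shows "smooth_on S (\<lambda>x. frechet_derivative f (at x) (X x))"
proof -
  have "smooth_on S (\<lambda>x. \<Sum>b\<in>Basis. (X x \<bullet> b) *\<^sub>R frechet_derivative f (at x) b)"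
    using assms
    by (intro smooth_on_sum smooth_on_scaleR smooth_on_linear_compose[OF bounded_linear_inner_left] smooth_on_derivative)
  moreover have "(\<Sum>b\<in>Basis. (X x \<bullet> b) *\<^sub>R frechet_derivative f (at x) b) = frechet_derivative f (at x) (X x)" if "x \<in> S" for x
  proof -
    have lin: "linear (frechet_derivative f (at x))"
      using smooth_on_differentiable[OF assms(2) that] by (rule linear_frechet_derivative)
    have "frechet_derivative f (at x) (X x) = frechet_derivative f (at x) (\<Sum>b\<in>Basis. (X x \<bullet> b) *\<^sub>R b)"
      by (simp add: euclidean_representation)
    then show ?thesis by (simp add: linear_sum[OF lin] linear_scale[OF lin])
  qed
  ultimately show ?thesis by (rule smooth_on_cong[OF assms(1), rotated])
qed

text \<open>The second difference quotient is a mixed second derivative at an intermediate point, by the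
  mean value theorem in one direction and then in the other.\<close>
lemma second_difference:
  fixes f :: "'v::euclidean_space \<Rightarrow> real"
  assumes h: "h > 0" and S: "\<And>s t. 0 \<le> s \<Longrightarrow> s \<le> h \<Longrightarrow> 0 \<le> t \<Longrightarrow> t \<le> h \<Longrightarrow> z + s *\<^sub>R u + t *\<^sub>R v \<in> S"
    and f: "smooth_on S f"
  shows "\<exists>s t. 0 < s \<and> s < h \<and> 0 < t \<and> t < h \<and>
     f (z + h *\<^sub>R u + h *\<^sub>R v) - f (z + h *\<^sub>R u) - f (z + h *\<^sub>R v) + f z =
     h * h * frechet_derivative (\<lambda>x. frechet_derivative f (at x) u) (at (z + s *\<^sub>R u + t *\<^sub>R v)) v"
proof -
  define g where "g = (\<lambda>x. frechet_derivative f (at x) u)"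
  have g: "smooth_on S g" unfolding g_def using f by (rule smooth_on_derivative)
  have line: "((\<lambda>s. F (a + s *\<^sub>R w)) has_real_derivative frechet_derivative F (at (a + s *\<^sub>R w)) w) (at s)"
    if F: "smooth_on S F" and m: "a + s *\<^sub>R w \<in> S" for F :: "'v \<Rightarrow> real" and a w s
  proof -
    have "((\<lambda>s. F (a + s *\<^sub>R w)) has_derivative (\<lambda>r. frechet_derivative F (at (a + s *\<^sub>R w)) (r *\<^sub>R w))) (at s)"
      by (rule has_derivative_compose[of "\<lambda>s. a + s *\<^sub>R w"  "\<lambda>r. r *\<^sub>R w" s UNIV F])
         (use smooth_on_has_derivative[OF F m] in \<open>auto intro!: derivative_eq_intros\<close>)
    moreover have "(\<lambda>r. frechet_derivative F (at (a + s *\<^sub>R w)) (r *\<^sub>R w)) = (*) (frechet_derivative F (at (a + s *\<^sub>R w)) w)"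
      using linear_scale[OF linear_frechet_derivative[OF smooth_on_differentiable[OF F m]]] by auto
    ultimately show ?thesis
      by (simp only: has_field_derivative_def)
  qed
  let ?a = "\<lambda>s. f (z + h *\<^sub>R v + s *\<^sub>R u) - f (z + s *\<^sub>R u)"
  have "\<exists>s. 0 < s \<and> s < h \<and> ?a h - ?a 0 = (h - 0) * (g (z + h *\<^sub>R v + s *\<^sub>R u) - g (z + s *\<^sub>R u))"
  proof (rule MVT2[OF h])
    fix s assume s: "0 \<le> s" "s \<le> h"
    show "(?a has_real_derivative g (z + h *\<^sub>R v + s *\<^sub>R u) - g (z + s *\<^sub>R u)) (at s)"
      unfolding g_def using S[of s h] S[of s 0] s h
      by (intro DERIV_diff line f) (auto simp: algebra_simps)
  qed
  then obtain s where s: "0 < s" "s < h" "?a h - ?a 0 = h * (g (z + h *\<^sub>R v + s *\<^sub>R u) - g (z + s *\<^sub>R u))" by auto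
  let ?b = "\<lambda>t. g (z + s *\<^sub>R u + t *\<^sub>R v)"
  have "\<exists>t. 0 < t \<and> t < h \<and> ?b h - ?b 0 = (h - 0) * frechet_derivative g (at (z + s *\<^sub>R u + t *\<^sub>R v)) v"
    by (rule MVT2[OF h], intro line g S) (use s in auto)
  then obtain t where t: "0 < t" "t < h" "?b h - ?b 0 = h * frechet_derivative g (at (z + s *\<^sub>R u + t *\<^sub>R v)) v" by auto
  have "f (z + h *\<^sub>R u + h *\<^sub>R v) - f (z + h *\<^sub>R u) - f (z + h *\<^sub>R v) + f z = ?a h - ?a 0"
    by (simp add: add_ac)
  also have "\<dots> = h * (?b h - ?b 0)" using s by (simp add: add_ac)
  also have "\<dots> = h * h * frechet_derivative g (at (z + s *\<^sub>R u + t *\<^sub>R v)) v" using t by simp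
  finally show ?thesis using s t unfolding g_def by blast
qed

text \<open>Schwarz's theorem: the second difference is symmetric in \<open>u\<close> and \<open>v\<close>, so both mixed
  derivatives agree at points that are arbitrarily close to \<open>z\<close>, hence at \<open>z\<close> by continuity.\<close>
lemma second_derivative_symmetric:
  fixes f :: "'v::euclidean_space \<Rightarrow> real"
  assumes S: "open S" "z \<in> S" and f: "smooth_on S f"
  shows "frechet_derivative (\<lambda>x. frechet_derivative f (at x) u) (at z) v =
         frechet_derivative (\<lambda>x. frechet_derivative f (at x) v) (at z) u"
proof (rule ccontr)
  let ?P = "\<lambda>x. frechet_derivative (\<lambda>x. frechet_derivative f (at x) u) (at x) v"
  let ?Q = "\<lambda>x. frechet_derivative (\<lambda>x. frechet_derivative f (at x) v) (at x) u"
  assume ne: "?P z \<noteq> ?Q z"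
  define e where "e = \<bar>?P z - ?Q z\<bar> / 2"
  have e: "e > 0" using ne by (simp add: e_def)
  have "continuous_on S ?P" "continuous_on S ?Q"
    using f by (auto intro: smooth_on_continuous smooth_on_derivative)
  then have "isCont ?P z" "isCont ?Q z" using S by (auto simp: continuous_on_eq_continuous_at)
  then obtain d1 d2 where d: "d1 > 0" "\<And>x. dist x z < d1 \<Longrightarrow> dist (?P x) (?P z) < e"
      "d2 > 0" "\<And>x. dist x z < d2 \<Longrightarrow> dist (?Q x) (?Q z) < e"
    unfolding continuous_at_eps_delta using e by metis
  obtain d3 where d3: "d3 > 0" "ball z d3 \<subseteq> S" using S open_contains_ball by blast
  define d where "d = min d1 (min d2 d3)"
  \<comment> \<open>\<open>h\<close> is so small that the parallelogram with sides \<open>h u\<close>, \<open>h v\<close> at \<open>z\<close> stays within distance \<open>d\<close> of \<open>z\<close>; adding 1 to the norms avoids division by zero.\<close>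
  define N where "N = norm u + norm v + 1"
  define h where "h = d / (2 * N)"
  have dp: "d > 0" using d d3 by (simp add: d_def)
  have np: "N > 0" unfolding N_def by (smt (verit) norm_ge_zero)
  have h: "h > 0" using dp np by (simp add: h_def)
  have near: "dist (z + s *\<^sub>R u + t *\<^sub>R v) z < d" if "0 \<le> s" "s \<le> h" "0 \<le> t" "t \<le> h" for s t
  proof -
    have "dist (z + s *\<^sub>R u + t *\<^sub>R v) z = norm (s *\<^sub>R u + t *\<^sub>R v)" by (simp add: dist_norm)
    also have "\<dots> \<le> s * norm u + t * norm v" using that by (metis norm_triangle_ineq norm_scaleR abs_of_nonneg)
    also have "\<dots> \<le> h * norm u + h * norm v" using that by (intro add_mono mult_right_mono) auto
    also have "\<dots> \<le> h * N" using h by (simp add: algebra_simps N_def)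
    also have "\<dots> = d / 2" using np by (simp add: h_def)
    also have "\<dots> < d" using dp by simp
    finally show ?thesis .
  qed
  have inS: "z + s *\<^sub>R u + t *\<^sub>R v \<in> S" if "0 \<le> s" "s \<le> h" "0 \<le> t" "t \<le> h" for s t
    using near[OF that] d3 by (auto simp: d_def dist_commute subset_iff)
  then have inS': "z + s *\<^sub>R v + t *\<^sub>R u \<in> S" if "0 \<le> s" "s \<le> h" "0 \<le> t" "t \<le> h" for s t
    using that by (metis add.assoc add.commute)
  obtain s t where 1: "0 < s" "s < h" "0 < t" "t < h" "f (z + h *\<^sub>R u + h *\<^sub>R v) - f (z + h *\<^sub>R u) - f (z + h *\<^sub>R v) + f z =
     h * h * ?P (z + s *\<^sub>R u + t *\<^sub>R v)"
    using second_difference[OF h inS f] by blast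
  obtain s' t' where 2: "0 < s'" "s' < h" "0 < t'" "t' < h" "f (z + h *\<^sub>R v + h *\<^sub>R u) - f (z + h *\<^sub>R v) - f (z + h *\<^sub>R u) + f z =
     h * h * ?Q (z + s' *\<^sub>R v + t' *\<^sub>R u)"
    using second_difference[OF h inS' f] by blast
  have swap: "z + h *\<^sub>R v + h *\<^sub>R u = z + h *\<^sub>R u + h *\<^sub>R v" by (simp add: add_ac)
  have "h * h * ?P (z + s *\<^sub>R u + t *\<^sub>R v) = h * h * ?Q (z + s' *\<^sub>R v + t' *\<^sub>R u)"
    using 1(5) 2(5)[unfolded swap] by linarith
  then have eq: "?P (z + s *\<^sub>R u + t *\<^sub>R v) = ?Q (z + t' *\<^sub>R u + s' *\<^sub>R v)" using h by (simp add: add_ac)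
  have "dist (?P (z + s *\<^sub>R u + t *\<^sub>R v)) (?P z) < e" using near[of s t] 1 by (intro d) (auto simp: d_def)
  moreover have "dist (?Q (z + t' *\<^sub>R u + s' *\<^sub>R v)) (?Q z) < e" using near[of t' s'] 2 by (intro d) (auto simp: d_def)
  ultimately show False unfolding eq e_def dist_real_def by (smt (verit) field_sum_of_halves)
qed

section \<open>Smooth maps between manifolds\<close>

lemma smooth_map_euclid_euclid: "smooth_map euclid euclid W f \<longleftrightarrow> open W \<and> smooth_on W f"
  by (auto simp: smooth_map_def euclid_def smooth_on_continuous)

lemma smooth_atlas_euclid: "smooth_atlas (euclid :: ('e, 'e::euclidean_space) atlas)"
  by (auto simp: smooth_atlas_def euclid_def homeomorphism_def id_def o_def smooth_on_linear)

lemma smooth_mapD: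
  assumes "smooth_map A B W f"
  shows "open W" "continuous_on W f"
    "(U, x) \<in> A \<Longrightarrow> (V, y) \<in> B \<Longrightarrow> smooth_on (x ` (U \<inter> W \<inter> f -` V)) (y \<circ> f \<circ> inv_into U x)"
  using assms unfolding smooth_map_def by auto

lemma smooth_atlasD:
  assumes "smooth_atlas A"
  shows "\<exists>U x. (U, x) \<in> A \<and> q \<in> U"
    and "(U, x) \<in> A \<Longrightarrow> open U" "(U, x) \<in> A \<Longrightarrow> inj_on x U"
    and "(U, x) \<in> A \<Longrightarrow> open W \<Longrightarrow> W \<subseteq> U \<Longrightarrow> open (x ` W)"
proof -
  have "q \<in> (\<Union>(U, x)\<in>A. U)" using assms unfolding smooth_atlas_def by auto
  then show "\<exists>U x. (U, x) \<in> A \<and> q \<in> U" by auto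
  have *: "open U" "open (x ` U)" "homeomorphism U (x ` U) x (inv_into U x)" if "(U, x) \<in> A"
    using assms that unfolding smooth_atlas_def by auto
  show "open U" if "(U, x) \<in> A" using *[OF that] by simp
  show "inj_on x U" if "(U, x) \<in> A" using *(3)[OF that] by (metis homeomorphism_def inj_on_inverseI)
  show "open (x ` W)" if "(U, x) \<in> A" "open W" "W \<subseteq> U"
    using homeomorphism_imp_open_map[OF *(3)[OF that(1)], of W] *(1,2)[OF that(1)] that by (simp add: openin_open_eq)
qed

text \<open>Smoothness in given charts is local, so near each point one may factor through a chart of the
  middle manifold.\<close>
lemma smooth_map_compose:
  assumes A: "smooth_atlas A" and B: "smooth_atlas B" and C: "smooth_atlas C"
    and f: "smooth_map A B W f" and g: "smooth_map B C V g"
  shows "smooth_map A C (W \<inter> f -` V) (g \<circ> f)"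
proof -
  have pre: "open (W \<inter> f -` T)" if "open T" for T
    using continuous_open_preimage[OF smooth_mapD(2,1)[OF f] that] .
  have "continuous_on (W \<inter> f -` V) (g \<circ> f)"
    by (rule continuous_on_compose) (auto intro: continuous_on_subset smooth_mapD(2)[OF f] smooth_mapD(2)[OF g])
  moreover have "smooth_on (x ` (U \<inter> (W \<inter> f -` V) \<inter> (g \<circ> f) -` Z)) (z \<circ> (g \<circ> f) \<circ> inv_into U x)"
    if U: "(U, x) \<in> A" and Z: "(Z, z) \<in> C" for U x Z z
  proof (rule smooth_on_local)
    fix s assume "s \<in> x ` (U \<inter> (W \<inter> f -` V) \<inter> (g \<circ> f) -` Z)"
    then obtain u where u: "u \<in> U" "u \<in> W" "f u \<in> V" "g (f u) \<in> Z" "s = x u" by auto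
    obtain Y y where Y: "(Y, y) \<in> B" "f u \<in> Y" using smooth_atlasD(1)[OF B] by metis
    note injx = smooth_atlasD(3)[OF A U] and injy = smooth_atlasD(3)[OF B Y(1)]
    have "open (V \<inter> g -` Z)"
      using continuous_open_preimage[OF smooth_mapD(2,1)[OF g] smooth_atlasD(2)[OF C Z]] .
    then have "open (V \<inter> g -` Z \<inter> Y)" using smooth_atlasD(2)[OF B Y(1)] by blast
    from pre[OF this] have "open (U \<inter> (W \<inter> f -` (V \<inter> g -` Z \<inter> Y)))" using smooth_atlasD(2)[OF A U] by blast
    then have oT: "open (x ` (U \<inter> (W \<inter> f -` (V \<inter> g -` Z \<inter> Y))))" (is "open ?T")
      using smooth_atlasD(4)[OF A U] by blast
    have "smooth_on ?T (\<lambda>s. (z \<circ> g \<circ> inv_into Y y) ((y \<circ> f \<circ> inv_into U x) s))"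
    proof (rule smooth_on_compose[OF oT, where f = "y \<circ> f \<circ> inv_into U x" and g = "z \<circ> g \<circ> inv_into Y y" and T = "y ` (Y \<inter> V \<inter> g -` Z)"])
      show "smooth_on ?T (y \<circ> f \<circ> inv_into U x)"
        by (rule smooth_on_subset[OF smooth_mapD(3)[OF f U Y(1)]]) auto
      show "smooth_on (y ` (Y \<inter> V \<inter> g -` Z)) (z \<circ> g \<circ> inv_into Y y)"
        by (rule smooth_mapD(3)[OF g Y(1) Z])
      show "(y \<circ> f \<circ> inv_into U x) ` ?T \<subseteq> y ` (Y \<inter> V \<inter> g -` Z)"
        using inv_into_f_f[OF injx] by auto
    qed
    then have "smooth_on ?T (z \<circ> (g \<circ> f) \<circ> inv_into U x)"
      by (rule smooth_on_cong[OF oT, rotated]) (use inv_into_f_f[OF injx] inv_into_f_f[OF injy] in auto)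
    then show "\<exists>T. open T \<and> s \<in> T \<and> smooth_on T (z \<circ> (g \<circ> f) \<circ> inv_into U x)"
      using oT u Y by blast
  qed
  ultimately show ?thesis
    unfolding smooth_map_def using pre[OF smooth_mapD(1)[OF g]] by auto
qed

lemma smooth_map_restrict:
  assumes f: "smooth_map A B W f" and W: "open W'" "W' \<subseteq> W"
  shows "smooth_map A B W' f"
proof -
  have "smooth_on (x ` (U \<inter> W' \<inter> f -` V)) (y \<circ> f \<circ> inv_into U x)"
    if "(U, x) \<in> A" "(V, y) \<in> B" for U x V y
    by (rule smooth_on_subset[OF smooth_mapD(3)[OF f that]]) (use W in auto)
  then show ?thesis
    unfolding smooth_map_def using W continuous_on_subset[OF smooth_mapD(2)[OF f]] by auto
qed

lemma smooth_map_cong: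
  assumes A: "smooth_atlas A" and B: "smooth_atlas B"
    and f: "smooth_map A B W f" and fg: "\<And>q. q \<in> W \<Longrightarrow> f q = g q"
  shows "smooth_map A B W g"
proof -
  have "smooth_on (x ` (U \<inter> W \<inter> g -` V)) (y \<circ> g \<circ> inv_into U x)"
    if U: "(U, x) \<in> A" and V: "(V, y) \<in> B" for U x V y
  proof -
    have eq: "U \<inter> W \<inter> g -` V = U \<inter> W \<inter> f -` V" using fg by auto
    have "open (U \<inter> (W \<inter> f -` V))"
      using continuous_open_preimage[OF smooth_mapD(2,1)[OF f] smooth_atlasD(2)[OF B V]]
        smooth_atlasD(2)[OF A U] by blast
    then have o: "open (x ` (U \<inter> W \<inter> f -` V))"
      using smooth_atlasD(4)[OF A U] by (simp add: Int_assoc)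
    show ?thesis unfolding eq
      by (rule smooth_on_cong[OF o _ smooth_mapD(3)[OF f U V]])
         (use fg inv_into_f_f[OF smooth_atlasD(3)[OF A U]] in auto)
  qed
  then show ?thesis
    unfolding smooth_map_def using smooth_mapD(1)[OF f] smooth_mapD(2)[OF f]
      continuous_on_cong[of W W f g] fg by auto
qed

lemma smooth_near_cong:
  assumes A: "smooth_atlas A" and f: "smooth_near A q f" and fg: "\<forall>\<^sub>F r in nhds q. f r = g r"
  shows "smooth_near A q g"
proof -
  obtain W where W: "q \<in> W" "smooth_map A euclid W f" using f by (auto simp: smooth_near_def)
  obtain N where N: "open N" "q \<in> N" "\<And>r. r \<in> N \<Longrightarrow> f r = g r" using fg by (auto simp: eventually_nhds)
  have "smooth_map A euclid (W \<inter> N) f"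
    using smooth_map_restrict[OF W(2)] smooth_mapD(1)[OF W(2)] N(1) by blast
  then have "smooth_map A euclid (W \<inter> N) g"
    by (rule smooth_map_cong[OF A smooth_atlas_euclid]) (use N in auto)
  then show ?thesis using W N by (auto simp: smooth_near_def)
qed

section \<open>Tangent vectors depend on germs only\<close>

text \<open>A tangent vector is a functional on all real functions, and no property of it refers to its base
  point. Dependence on germs is the substitute: it holds for tangent vectors, their combinations and
  brackets, and it is what makes the push-forward along a local diffeomorphism invertible.\<close>
definition germ_local :: "'a::topological_space \<Rightarrow> 'a tvec \<Rightarrow> bool" where
  "germ_local q v \<longleftrightarrow> (\<forall>f g. (\<forall>\<^sub>F r in nhds q. f r = g r) \<longrightarrow> v f = v g)"

lemma germ_localD: "germ_local q v \<Longrightarrow> (\<forall>\<^sub>F r in nhds q. f r = g r) \<Longrightarrow> v f = v g"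
  by (auto simp: germ_local_def)

lemma subspace_germ_local: "tv.subspace (Collect (germ_local q))"
proof (rule tv.subspaceI)
  show "0 \<in> Collect (germ_local q)" by (auto simp: germ_local_def)
next
  fix u v assume "u \<in> Collect (germ_local q)" "v \<in> Collect (germ_local q)"
  then show "u + v \<in> Collect (germ_local q)" unfolding germ_local_def mem_Collect_eq plus_fun_def by metis
next
  fix c v assume "v \<in> Collect (germ_local q)"
  then show "tv_scale c v \<in> Collect (germ_local q)" unfolding germ_local_def mem_Collect_eq tv_scale_def by metis
qed

lemma eventually_along_curve:
  assumes "smooth_map euclid A J c" "0 \<in> J" "\<forall>\<^sub>F r in nhds (c 0). P r"
  shows "\<forall>\<^sub>F t in nhds (0::real). P (c t)"
proof -
  obtain N where N: "open N" "c 0 \<in> N" "\<And>r. r \<in> N \<Longrightarrow> P r" using assms(3) by (auto simp: eventually_nhds)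
  have "open (J \<inter> c -` N)" using continuous_open_preimage[OF smooth_mapD(2,1)[OF assms(1)] N(1)] .
  then show ?thesis unfolding eventually_nhds using assms(2) N by blast
qed

lemma germ_local_velocity:
  assumes A: "smooth_atlas A" and c: "smooth_map euclid A J c" "0 \<in> J"
  shows "germ_local (c 0) (velocity A c)"
  unfolding germ_local_def
proof (intro allI impI)
  fix f g :: "'a \<Rightarrow> real" assume fg: "\<forall>\<^sub>F r in nhds (c 0). f r = g r"
  then have gf: "\<forall>\<^sub>F r in nhds (c 0). g r = f r" by (auto elim: eventually_mono)
  have "smooth_near A (c 0) f \<longleftrightarrow> smooth_near A (c 0) g"
    using smooth_near_cong[OF A _ fg] smooth_near_cong[OF A _ gf] by blast
  moreover have "deriv (f \<circ> c) 0 = deriv (g \<circ> c) 0"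
    by (rule deriv_cong_ev) (use eventually_along_curve[OF c fg] in auto)
  ultimately show "velocity A c f = velocity A c g" by (simp add: velocity_def)
qed

lemma germ_local_tangent_space:
  "smooth_atlas A \<Longrightarrow> v \<in> tangent_space A S q \<Longrightarrow> germ_local q v"
  by (auto simp: tangent_space_def intro: germ_local_velocity)

lemma germ_local_smooth_vf:
  "smooth_atlas A \<Longrightarrow> smooth_vf A W X \<Longrightarrow> q \<in> W \<Longrightarrow> germ_local q (X q)"
  by (auto simp: smooth_vf_def intro: germ_local_tangent_space)

lemma germ_local_lie_bracket:
  assumes A: "smooth_atlas A" and X: "smooth_vf A W X" and Y: "smooth_vf A W Y" and q: "q \<in> W"
  shows "germ_local q (lie_bracket A X Y q)"
  unfolding germ_local_def
proof (intro allI impI)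
  fix f g :: "'a \<Rightarrow> real" assume fg: "\<forall>\<^sub>F r in nhds q. f r = g r"
  then have gf: "\<forall>\<^sub>F r in nhds q. g r = f r" by (auto elim: eventually_mono)
  have sn: "smooth_near A q f \<longleftrightarrow> smooth_near A q g"
    using smooth_near_cong[OF A _ fg] smooth_near_cong[OF A _ gf] by blast
  obtain N where N: "open N" "q \<in> N" "\<And>r. r \<in> N \<Longrightarrow> f r = g r" using fg by (auto simp: eventually_nhds)
  have ev: "\<forall>\<^sub>F r in nhds q. Z r f = Z r g" if Z: "smooth_vf A W Z" for Z
  proof -
    have "Z r f = Z r g" if "r \<in> W \<inter> N" for r
      using that N germ_local_smooth_vf[OF A Z, of r]
      by (intro germ_localD[of r "Z r"]) (auto simp: eventually_nhds)
    moreover have "open (W \<inter> N)" using Z N by (auto simp: smooth_vf_def)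
    ultimately show ?thesis unfolding eventually_nhds using q N by blast
  qed
  show "lie_bracket A X Y q f = lie_bracket A X Y q g"
    unfolding lie_bracket_def sn
    using germ_localD[OF germ_local_smooth_vf[OF A X q] ev[OF Y]]
      germ_localD[OF germ_local_smooth_vf[OF A Y q] ev[OF X]] by simp
qed

lemma smooth_vf_restrict: "smooth_vf A W X \<Longrightarrow> open V \<Longrightarrow> V \<subseteq> W \<Longrightarrow> smooth_vf A V X"
  unfolding smooth_vf_def by (meson order_trans subsetD)

lemma section_on_restrict: "section_on A D W X \<Longrightarrow> open V \<Longrightarrow> V \<subseteq> W \<Longrightarrow> section_on A D V X"
  unfolding section_on_def using smooth_vf_restrict by blast

lemma tv_span_germ_local:
  "(\<And>v. v \<in> S \<Longrightarrow> germ_local q v) \<Longrightarrow> v \<in> tv.span S \<Longrightarrow> germ_local q v"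
  using tv.span_minimal[OF _ subspace_germ_local[of q], of S] by blast

lemma germ_local_derived:
  assumes A: "smooth_atlas A" and D: "\<And>v. v \<in> D q \<Longrightarrow> germ_local q v" and v: "v \<in> derived A D q"
  shows "germ_local q v"
  using v unfolding derived_def
  by (rule tv_span_germ_local[rotated]) (auto intro: D germ_local_lie_bracket[OF A] simp: section_on_def)

lemma germ_local_distribution:
  assumes A: "smooth_atlas A" and C: "distribution_on A k W C" and q: "q \<in> W" and v: "v \<in> C q"
  shows "germ_local q v"
proof -
  obtain V X where V: "q \<in> V" "\<forall>j<k. smooth_vf A V (X j)" "C q = tv.span ((\<lambda>j. X j q) ` {..<k})"
    using C q unfolding distribution_on_def by meson
  show ?thesis using v unfolding V(3)
    by (rule tv_span_germ_local[rotated]) (use V germ_local_smooth_vf[OF A] in auto)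
qed

interpretation tvp: vector_space_pair "tv_scale :: real \<Rightarrow> 'a tvec \<Rightarrow> 'a tvec" "tv_scale :: real \<Rightarrow> 'b tvec \<Rightarrow> 'b tvec"
  by unfold_locales

lemma linear_push_tvec: "Vector_Spaces.linear tv_scale tv_scale (push_tvec \<phi>)"
  by (auto simp: Vector_Spaces.linear_iff tv.vector_space_axioms push_tvec_def tv_scale_def fun_eq_iff)

text \<open>The space of all functionals has infinite dimension, so the dimension of an image is computed
  from the image of a basis.\<close>
lemma tv_dim_image:
  assumes f: "Vector_Spaces.linear tv_scale tv_scale f" and inj: "inj_on f (tv.span S)"
  shows "tv.dim (f ` S) = tv.dim S"
proof -
  obtain B where B: "B \<subseteq> S" "tv.independent B" "S \<subseteq> tv.span B" "card B = tv.dim S"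
    using tv.basis_exists by blast
  have iB: "inj_on f (tv.span B)" using inj tv.span_mono[OF B(1)] by (rule inj_on_subset)
  show ?thesis
  proof (rule tv.dim_unique)
    show "f ` B \<subseteq> f ` S" using B by blast
    show "f ` S \<subseteq> tv.span (f ` B)" using B(3) tvp.linear_span_image[OF f] by blast
    show "tv.independent (f ` B)" by (rule tvp.linear_independent_injective_image[OF f B(2) iB])
    show "card (f ` B) = tv.dim S"
      using B(4) card_image[OF inj_on_subset[OF iB tv.span_superset]] by simp
  qed
qed

section \<open>Naturality under local diffeomorphisms\<close>

text \<open>A diffeomorphism between open sets, given together with its inverse. The symmetric form lets every
  one-sided statement be applied to the inverse as well; the locale is left and entered again
  whenever a statement proved in it is needed for the inverse pair.\<close>
locale diffeo_pair =
  fixes A :: "('a::topological_space, 'e::euclidean_space) atlas"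
    and B :: "('b::topological_space, 'e) atlas"
    and U :: "'a set" and U' :: "'b set" and \<phi> :: "'a \<Rightarrow> 'b" and \<psi> :: "'b \<Rightarrow> 'a"
  assumes A: "smooth_atlas A" and B: "smooth_atlas B"
    and \<phi>: "smooth_map A B U \<phi>" and \<psi>: "smooth_map B A U' \<psi>"
    and img: "\<And>q. q \<in> U \<Longrightarrow> \<phi> q \<in> U'" and img': "\<And>s. s \<in> U' \<Longrightarrow> \<psi> s \<in> U"
    and \<psi>\<phi>: "\<And>q. q \<in> U \<Longrightarrow> \<psi> (\<phi> q) = q" and \<phi>\<psi>: "\<And>s. s \<in> U' \<Longrightarrow> \<phi> (\<psi> s) = s"
begin

lemma inverse: "diffeo_pair B A U' U \<psi> \<phi>"
  by unfold_locales (use A B \<phi> \<psi> img img' \<psi>\<phi> \<phi>\<psi> in auto)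

lemma open_image: assumes "open W" "W \<subseteq> U" shows "open (\<phi> ` W)"
proof -
  have "\<phi> ` W = U' \<inter> \<psi> -` W" using assms img \<psi>\<phi> \<phi>\<psi> by force
  then show ?thesis using continuous_open_preimage[OF smooth_mapD(2,1)[OF \<psi>] assms(1)] by simp
qed

lemma eventually_push:
  assumes q: "q \<in> U" and ev: "\<forall>\<^sub>F s in nhds (\<phi> q). P s"
  shows "\<forall>\<^sub>F r in nhds q. P (\<phi> r)"
proof -
  obtain N where N: "open N" "\<phi> q \<in> N" "\<And>s. s \<in> N \<Longrightarrow> P s" using ev by (auto simp: eventually_nhds)
  have "open (U \<inter> \<phi> -` N)" using continuous_open_preimage[OF smooth_mapD(2,1)[OF \<phi>] N(1)] .
  then show ?thesis unfolding eventually_nhds using q N by blast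
qed

lemma eventually_inverse: "q \<in> U \<Longrightarrow> \<forall>\<^sub>F r in nhds q. \<psi> (\<phi> r) = r"
  unfolding eventually_nhds using \<psi>\<phi> smooth_mapD(1)[OF \<phi>] by blast

lemma germ_local_push: "q \<in> U \<Longrightarrow> germ_local q v \<Longrightarrow> germ_local (\<phi> q) (push_tvec \<phi> v)"
  unfolding germ_local_def[of "\<phi> q"] push_tvec_def
  by (auto intro!: germ_localD[of q v] eventually_push)

text \<open>A composite \<open>f \<circ> \<psi> \<circ> \<phi>\<close> agrees with \<open>f\<close> on \<open>U\<close> only, so only functionals that depend on germs
  are recovered.\<close>
lemma push_push:
  assumes "q \<in> U" "germ_local q v" shows "push_tvec \<psi> (push_tvec \<phi> v) = v"
proof
  fix f
  have "v (f \<circ> \<psi> \<circ> \<phi>) = v f"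
    by (rule germ_localD[OF assms(2)]) (use eventually_inverse[OF assms(1)] in \<open>auto elim: eventually_mono\<close>)
  then show "push_tvec \<psi> (push_tvec \<phi> v) f = v f" by (simp add: push_tvec_def)
qed

lemma push_push_image:
  assumes "q \<in> U" "\<And>v. v \<in> S \<Longrightarrow> germ_local q v" shows "push_tvec \<psi> ` push_tvec \<phi> ` S = S"
  by (simp add: image_image push_push[OF assms(1)] assms(2) cong: image_cong)

lemma inj_push: "q \<in> U \<Longrightarrow> inj_on (push_tvec \<phi>) (Collect (germ_local q))"
  by (metis inj_onI mem_Collect_eq push_push)

lemma smooth_near_push1:
  assumes q: "q \<in> U" and g: "smooth_near B (\<phi> q) g" shows "smooth_near A q (g \<circ> \<phi>)"
proof -
  obtain W where W: "\<phi> q \<in> W" "smooth_map B euclid W g" using g by (auto simp: smooth_near_def)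
  from smooth_map_compose[OF A B smooth_atlas_euclid \<phi> W(2)] show ?thesis
    unfolding smooth_near_def using q W by (intro exI[of _ "U \<inter> \<phi> -` W"]) auto
qed

end

context diffeo_pair begin

lemma smooth_near_push:
  assumes q: "q \<in> U" shows "smooth_near A q (g \<circ> \<phi>) \<longleftrightarrow> smooth_near B (\<phi> q) g"
proof
  assume "smooth_near A q (g \<circ> \<phi>)"
  then have "smooth_near B (\<phi> q) ((g \<circ> \<phi>) \<circ> \<psi>)"
    using diffeo_pair.smooth_near_push1[OF inverse, of "\<phi> q" "g \<circ> \<phi>"] q img \<psi>\<phi> by simp
  then show "smooth_near B (\<phi> q) g"
    by (rule smooth_near_cong[OF B])
       (use diffeo_pair.eventually_inverse[OF inverse img[OF q]] in \<open>auto elim: eventually_mono\<close>)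
qed (rule smooth_near_push1[OF q])

lemma push_velocity: "c 0 \<in> U \<Longrightarrow> push_tvec \<phi> (velocity A c) = velocity B (\<phi> \<circ> c)"
  by (auto simp: push_tvec_def velocity_def fun_eq_iff smooth_near_push o_assoc)

lemma tangent_space_push1:
  assumes q: "q \<in> U" and S: "\<And>r. r \<in> U \<Longrightarrow> r \<in> S \<Longrightarrow> \<phi> r \<in> S'" and v: "v \<in> tangent_space A S q"
  shows "push_tvec \<phi> v \<in> tangent_space B S' (\<phi> q)"
proof -
  obtain c J where c: "v = velocity A c" "0 \<in> J" "smooth_map euclid A J c" "c 0 = q" "c ` J \<subseteq> S"
    using v by (auto simp: tangent_space_def)
  have "smooth_map euclid B (J \<inter> c -` U) (\<phi> \<circ> c)"
    by (rule smooth_map_compose[OF smooth_atlas_euclid A B c(3) \<phi>])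
  moreover have "push_tvec \<phi> v = velocity B (\<phi> \<circ> c)" using c q by (simp add: push_velocity)
  moreover have "(\<phi> \<circ> c) ` (J \<inter> c -` U) \<subseteq> S'" using c S by auto
  ultimately show ?thesis using c q unfolding tangent_space_def
    by (intro CollectI exI[of _ "\<phi> \<circ> c"] exI[of _ "J \<inter> c -` U"]) auto
qed

lemma smooth_vf_push:
  assumes X: "smooth_vf A W X" and W: "W \<subseteq> U"
  shows "smooth_vf B (\<phi> ` W) (\<lambda>s. push_tvec \<phi> (X (\<psi> s)))"
  unfolding smooth_vf_def
proof (intro conjI ballI allI impI)
  have oW: "open W" using X by (simp add: smooth_vf_def)
  then show o: "open (\<phi> ` W)" using open_image W by blast
  show "push_tvec \<phi> (X (\<psi> s)) \<in> tangent_space B UNIV s" if "s \<in> \<phi> ` W" for s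
  proof -
    obtain q where q: "q \<in> W" "s = \<phi> q" using \<open>s \<in> \<phi> ` W\<close> by auto
    then have "X q \<in> tangent_space A UNIV q" using X by (auto simp: smooth_vf_def)
    then show ?thesis using tangent_space_push1[of q UNIV UNIV "X q"] q W \<psi>\<phi>[of q] by auto
  qed
  fix V and f :: "'b \<Rightarrow> real" assume a: "V \<subseteq> \<phi> ` W \<and> smooth_map B euclid V f"
  have "smooth_map A euclid (U \<inter> \<phi> -` V) (f \<circ> \<phi>)"
    by (rule smooth_map_compose[OF A B smooth_atlas_euclid \<phi>]) (use a in auto)
  moreover have "U \<inter> \<phi> -` V \<subseteq> W" using a W \<psi>\<phi> by (auto, metis imageE subsetD)
  ultimately have "smooth_map A euclid (U \<inter> \<phi> -` V) (\<lambda>q. X q (f \<circ> \<phi>))"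
    using X unfolding smooth_vf_def by blast
  from smooth_map_compose[OF B A smooth_atlas_euclid \<psi> this]
  have "smooth_map B euclid (U' \<inter> \<psi> -` (U \<inter> \<phi> -` V)) ((\<lambda>q. X q (f \<circ> \<phi>)) \<circ> \<psi>)" .
  moreover have "U' \<inter> \<psi> -` (U \<inter> \<phi> -` V) = V"
  proof -
    have "V \<subseteq> U'" using a W img by blast
    then show ?thesis using img' \<phi>\<psi> by auto
  qed
  ultimately show "smooth_map B euclid V (\<lambda>q. push_tvec \<phi> (X (\<psi> q)) f)"
    by (simp add: push_tvec_def o_def)
qed

lemma lie_bracket_push:
  assumes V: "open V" "V \<subseteq> U" "q \<in> V"
    and X: "\<And>r. r \<in> V \<Longrightarrow> X' (\<phi> r) = push_tvec \<phi> (X r)" and Y: "\<And>r. r \<in> V \<Longrightarrow> Y' (\<phi> r) = push_tvec \<phi> (Y r)"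
    and loc: "germ_local q (X q)" "germ_local q (Y q)"
  shows "lie_bracket B X' Y' (\<phi> q) = push_tvec \<phi> (lie_bracket A X Y q)"
proof
  fix f
  have 1: "X q ((\<lambda>s. Y' s f) \<circ> \<phi>) = X q (\<lambda>r. Y r (f \<circ> \<phi>))"
    by (rule germ_localD[OF loc(1)]) (use V Y in \<open>auto simp: eventually_nhds push_tvec_def\<close>)
  have 2: "Y q ((\<lambda>s. X' s f) \<circ> \<phi>) = Y q (\<lambda>r. X r (f \<circ> \<phi>))"
    by (rule germ_localD[OF loc(2)]) (use V X in \<open>auto simp: eventually_nhds push_tvec_def\<close>)
  have "q \<in> U" using V by auto
  then show "lie_bracket B X' Y' (\<phi> q) f = push_tvec \<phi> (lie_bracket A X Y q) f"
    using 1 2 X[OF V(3)] Y[OF V(3)]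
    by (simp add: lie_bracket_def push_tvec_def smooth_near_push[OF \<open>q \<in> U\<close>, of f, symmetric])
qed

text \<open>Dependence on germs is part of the notion, since otherwise the relation could not be
  reversed.\<close>
definition transports :: "('a \<Rightarrow> 'a tvec set) \<Rightarrow> ('b \<Rightarrow> 'b tvec set) \<Rightarrow> bool" where
  "transports D E \<longleftrightarrow> (\<forall>q\<in>U. (\<forall>v\<in>D q. germ_local q v) \<and> push_tvec \<phi> ` D q = E (\<phi> q))"

lemma transports_inverse:
  assumes "transports D E" shows "diffeo_pair.transports U' \<psi> E D"
  unfolding diffeo_pair.transports_def[OF inverse]
proof (intro ballI conjI)
  fix s assume s: "s \<in> U'"
  have eq: "E s = push_tvec \<phi> ` D (\<psi> s)" and loc: "\<forall>v\<in>D (\<psi> s). germ_local (\<psi> s) v"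
    using assms s img' \<phi>\<psi> by (metis transports_def)+
  show "germ_local s v" if "v \<in> E s" for v
    using that loc germ_local_push[OF img'[OF s]] \<phi>\<psi>[OF s] unfolding eq by auto
  show "push_tvec \<psi> ` E s = D (\<psi> s)"
    unfolding eq image_image using push_push[OF img'[OF s]] loc by force
qed

lemma section_push:
  assumes X: "section_on A D W X" and W: "W \<subseteq> U" and DE: "\<And>q. q \<in> W \<Longrightarrow> push_tvec \<phi> ` D q \<subseteq> E (\<phi> q)"
  shows "section_on B E (\<phi> ` W) (\<lambda>s. push_tvec \<phi> (X (\<psi> s)))"
  using assms smooth_vf_push[of W X] \<psi>\<phi> by (auto simp: section_on_def subset_iff image_subset_iff)

lemma derived_push1:
  assumes DE: "transports D E" and q: "q \<in> U"
  shows "push_tvec \<phi> ` derived A D q \<subseteq> derived B E (\<phi> q)"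
proof -
  have "push_tvec \<phi> v \<in> derived B E (\<phi> q)"
    if "v \<in> D q \<union> {lie_bracket A X Y q |X Y W. q \<in> W \<and> section_on A D W X \<and> section_on A D W Y}" for v
    using that
  proof
    assume "v \<in> D q"
    then have "push_tvec \<phi> v \<in> E (\<phi> q)" using DE q by (auto simp: transports_def)
    then show ?thesis unfolding derived_def by (intro tv.span_base) auto
  next
    assume "v \<in> {lie_bracket A X Y q |X Y W. q \<in> W \<and> section_on A D W X \<and> section_on A D W Y}"
    then obtain X Y W where v: "v = lie_bracket A X Y q" "q \<in> W" "section_on A D W X" "section_on A D W Y"
      by auto
    let ?W = "W \<inter> U"
    let ?X = "\<lambda>s. push_tvec \<phi> (X (\<psi> s))" let ?Y = "\<lambda>s. push_tvec \<phi> (Y (\<psi> s))"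
    have o: "open ?W" using v smooth_mapD(1)[OF \<phi>] by (auto simp: section_on_def smooth_vf_def)
    have s: "section_on B E (\<phi> ` ?W) ?X" "section_on B E (\<phi> ` ?W) ?Y"
      using DE by (auto intro!: section_push[of D] section_on_restrict[OF _ o] v simp: transports_def)
    have "lie_bracket B ?X ?Y (\<phi> q) = push_tvec \<phi> v" unfolding v(1)
      by (rule lie_bracket_push[OF o])
         (use q v \<psi>\<phi> germ_local_smooth_vf[OF A] in \<open>auto simp: section_on_def\<close>)
    then show ?thesis unfolding derived_def using s q v by (intro tv.span_base UnI2 CollectI) (metis (mono_tags, lifting) IntI imageI)
  qed
  then have "push_tvec \<phi> ` (D q \<union> {lie_bracket A X Y q |X Y W. q \<in> W \<and> section_on A D W X \<and> section_on A D W Y}) \<subseteq> derived B E (\<phi> q)"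
    by blast
  then show ?thesis
    unfolding derived_def[of A] tvp.linear_span_image[OF linear_push_tvec, symmetric]
    by (rule tv.span_minimal) (simp add: derived_def)
qed

end

context diffeo_pair begin

lemma tangent_space_push:
  assumes q: "q \<in> U" and S: "\<And>r. r \<in> U \<Longrightarrow> r \<in> S \<longleftrightarrow> \<phi> r \<in> S'"
  shows "push_tvec \<phi> ` tangent_space A S q = tangent_space B S' (\<phi> q)"
proof
  show "push_tvec \<phi> ` tangent_space A S q \<subseteq> tangent_space B S' (\<phi> q)"
    using tangent_space_push1[OF q, of S S'] S by blast
  show "tangent_space B S' (\<phi> q) \<subseteq> push_tvec \<phi> ` tangent_space A S q"
  proof
    fix v assume v: "v \<in> tangent_space B S' (\<phi> q)"
    have "push_tvec \<psi> v \<in> tangent_space A S (\<psi> (\<phi> q))"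
      by (rule diffeo_pair.tangent_space_push1[OF inverse img[OF q] _ v]) (use S img' \<phi>\<psi> in auto)
    moreover have "push_tvec \<phi> (push_tvec \<psi> v) = v"
      using diffeo_pair.push_push[OF inverse img[OF q]] germ_local_tangent_space[OF B v] by blast
    ultimately show "v \<in> push_tvec \<phi> ` tangent_space A S q" using \<psi>\<phi>[OF q] by (metis image_eqI)
  qed
qed

lemma transports_derived:
  assumes DE: "transports D E" shows "transports (derived A D) (derived B E)"
  unfolding transports_def
proof (intro ballI conjI)
  fix q assume q: "q \<in> U"
  show loc: "germ_local q v" if "v \<in> derived A D q" for v
    using that by (rule germ_local_derived[OF A, rotated]) (use DE q in \<open>auto simp: transports_def\<close>)
  note inv = transports_inverse[OF DE]
  have "push_tvec \<psi> ` derived B E (\<phi> q) \<subseteq> derived A D q"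
    using diffeo_pair.derived_push1[OF inverse inv img[OF q]] \<psi>\<phi>[OF q] by simp
  then have "push_tvec \<phi> ` push_tvec \<psi> ` derived B E (\<phi> q) \<subseteq> push_tvec \<phi> ` derived A D q" by blast
  moreover have "push_tvec \<phi> (push_tvec \<psi> v) = v" if v: "v \<in> derived B E (\<phi> q)" for v
  proof (rule diffeo_pair.push_push[OF inverse img[OF q]])
    show "germ_local (\<phi> q) v" using v
      by (rule germ_local_derived[OF B, rotated]) (use inv img[OF q] in \<open>auto simp: diffeo_pair.transports_def[OF inverse]\<close>)
  qed
  ultimately have "derived B E (\<phi> q) \<subseteq> push_tvec \<phi> ` derived A D q" by (force simp: image_image)
  then show "push_tvec \<phi> ` derived A D q = derived B E (\<phi> q)"
    using derived_push1[OF DE q] by blast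
qed

lemma transports_flag: "transports D E \<Longrightarrow> transports (flag A D i) (flag B E i)"
  by (induction i) (auto simp: flag_def transports_derived)

lemma tv_dim_push:
  assumes "q \<in> U" "\<And>v. v \<in> S \<Longrightarrow> germ_local q v" shows "tv.dim (push_tvec \<phi> ` S) = tv.dim S"
  by (rule tv_dim_image[OF linear_push_tvec])
     (rule inj_on_subset[OF inj_push[OF assms(1)]], use tv_span_germ_local assms(2) in blast)

lemma distribution_push:
  assumes C: "distribution_on A k W C" and W: "W \<subseteq> U"
  shows "distribution_on B k (\<phi> ` W) (\<lambda>s. push_tvec \<phi> ` C (\<psi> s))"
  unfolding distribution_on_def
proof (intro conjI ballI)
  have "open W" using C by (simp add: distribution_on_def)
  then show "open (\<phi> ` W)" using open_image W by blast
  fix s assume "s \<in> \<phi> ` W"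
  then obtain q where q: "q \<in> W" "s = \<phi> q" by auto
  from bspec[OF conjunct2[OF C[unfolded distribution_on_def]] q(1)] obtain V X where
      VX: "q \<in> V \<and> V \<subseteq> W \<and> (\<forall>j<k. smooth_vf A V (X j)) \<and> open V \<and>
        (\<forall>r\<in>V. C r = tv.span ((\<lambda>j. X j r) ` {..<k}) \<and> tv.dim (C r) = k)" by (elim exE)
  then have V: "q \<in> V" "V \<subseteq> W" "open V" "\<forall>j<k. smooth_vf A V (X j)"
      "\<forall>r\<in>V. C r = tv.span ((\<lambda>j. X j r) ` {..<k}) \<and> tv.dim (C r) = k"
    by blast+
  have VU: "V \<subseteq> U" using V W by auto
  have "push_tvec \<phi> ` C (\<psi> r) = tv.span ((\<lambda>j. push_tvec \<phi> (X j (\<psi> r))) ` {..<k}) \<and> tv.dim (push_tvec \<phi> ` C (\<psi> r)) = k"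
    if "r \<in> \<phi> ` V" for r
  proof -
    obtain r0 where "r0 \<in> V" "r = \<phi> r0" using \<open>r \<in> \<phi> ` V\<close> by blast
    then have r0: "r0 \<in> V" "\<psi> r = r0" using VU \<psi>\<phi> by auto
    have "tv.dim (push_tvec \<phi> ` C r0) = tv.dim (C r0)"
      by (rule tv_dim_push[OF subsetD[OF VU r0(1)] germ_local_distribution[OF A C subsetD[OF V(2) r0(1)]]])
    moreover have "C r0 = tv.span ((\<lambda>j. X j r0) ` {..<k})" "tv.dim (C r0) = k" using V(5) r0(1) by blast+
    ultimately show ?thesis unfolding r0(2)
      using tvp.linear_span_image[OF linear_push_tvec, of \<phi> "(\<lambda>j. X j r0) ` {..<k}"]
      by (simp add: image_image)
  qed
  then show "\<exists>V' X'. s \<in> V' \<and> V' \<subseteq> \<phi> ` W \<and> (\<forall>j<k. smooth_vf B V' (X' j)) \<and> open V' \<and>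
      (\<forall>r\<in>V'. push_tvec \<phi> ` C (\<psi> r) = tv.span ((\<lambda>j. X' j r) ` {..<k}) \<and> tv.dim (push_tvec \<phi> ` C (\<psi> r)) = k)"
    using q V(1,2) open_image[OF V(3) VU] smooth_vf_push[OF V(4)[rule_format] VU]
    by (intro exI[of _ "\<phi> ` V"] exI[of _ "\<lambda>j s. push_tvec \<phi> (X j (\<psi> s))"] conjI) blast+
qed

text \<open>Involutivity and \<open>[C, D'] \<subseteq> D'\<close> are both closure conditions on brackets of sections. Sections on
  the target are pulled back, bracketed, and the bracket is pushed forward.\<close>
lemma bracket_closed_push:
  assumes cl: "\<And>V X Y. V \<subseteq> W \<Longrightarrow> section_on A C1 V X \<Longrightarrow> section_on A C2 V Y \<Longrightarrow> \<forall>q\<in>V. lie_bracket A X Y q \<in> C3 q"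
    and W: "W \<subseteq> U"
    and E1: "\<And>q. q \<in> W \<Longrightarrow> push_tvec \<psi> ` E1 (\<phi> q) \<subseteq> C1 q" and E2: "\<And>q. q \<in> W \<Longrightarrow> push_tvec \<psi> ` E2 (\<phi> q) \<subseteq> C2 q"
    and E3: "\<And>q. q \<in> W \<Longrightarrow> push_tvec \<phi> ` C3 q \<subseteq> E3 (\<phi> q)"
    and V: "V \<subseteq> \<phi> ` W" "section_on B E1 V X" "section_on B E2 V Y" and s: "s \<in> V"
  shows "lie_bracket B X Y s \<in> E3 s"
proof -
  let ?X = "\<lambda>q. push_tvec \<psi> (X (\<phi> q))" let ?Y = "\<lambda>q. push_tvec \<psi> (Y (\<phi> q))"
  have VU: "V \<subseteq> U'" using V W img by auto
  have sec: "section_on A C1 (\<psi> ` V) ?X" "section_on A C2 (\<psi> ` V) ?Y"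
    by (rule diffeo_pair.section_push[OF inverse V(2) VU] diffeo_pair.section_push[OF inverse V(3) VU];
       use V W E1 E2 \<psi>\<phi> in force)+
  have VW: "\<psi> ` V \<subseteq> W" using V W \<psi>\<phi> by force
  have b: "lie_bracket A ?X ?Y (\<psi> s) \<in> C3 (\<psi> s)" using cl[OF VW sec] s by auto
  have loc: "germ_local r (X r)" "germ_local r (Y r)" if "r \<in> V" for r
    using germ_local_smooth_vf[OF B] V(2,3) that by (auto simp: section_on_def)
  have "lie_bracket B X Y (\<phi> (\<psi> s)) = push_tvec \<phi> (lie_bracket A ?X ?Y (\<psi> s))"
  proof (rule lie_bracket_push[of "\<psi> ` V"])
    show "open (\<psi> ` V)" using V by (intro diffeo_pair.open_image[OF inverse] VU) (auto simp: section_on_def smooth_vf_def)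
    show "\<psi> ` V \<subseteq> U" using VW W by auto
    show "\<psi> s \<in> \<psi> ` V" using s by auto
    show "X (\<phi> r) = push_tvec \<phi> (push_tvec \<psi> (X (\<phi> r)))" "Y (\<phi> r) = push_tvec \<phi> (push_tvec \<psi> (Y (\<phi> r)))"
      if "r \<in> \<psi> ` V" for r
    proof -
      obtain t where "t \<in> V" "r = \<psi> t" using \<open>r \<in> \<psi> ` V\<close> by blast
      then have t: "t \<in> V" "\<phi> r = t" using VU \<phi>\<psi> by auto
      show "X (\<phi> r) = push_tvec \<phi> (push_tvec \<psi> (X (\<phi> r)))" "Y (\<phi> r) = push_tvec \<phi> (push_tvec \<psi> (Y (\<phi> r)))"
        unfolding t using diffeo_pair.push_push[OF inverse, of t] loc[OF t(1)] t VU by auto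
    qed
    have "\<phi> (\<psi> s) = s" using s VU \<phi>\<psi> by auto
    then show "germ_local (\<psi> s) (push_tvec \<psi> (X (\<phi> (\<psi> s))))" "germ_local (\<psi> s) (push_tvec \<psi> (Y (\<phi> (\<psi> s))))"
      using diffeo_pair.germ_local_push[OF inverse, of s] loc[OF s] s VU by auto
  qed
  moreover have "\<psi> s \<in> W" "\<phi> (\<psi> s) = s" using VW VU s \<phi>\<psi> by auto
  ultimately show ?thesis using b E3[of "\<psi> s"] by (metis image_eqI subsetD)
qed

lemma char_subdistribution_push:
  assumes C: "char_subdistribution_on A D i W C" and W: "W \<subseteq> U" and DE: "transports D E"
  shows "char_subdistribution_on B E i (\<phi> ` W) (\<lambda>s. push_tvec \<phi> ` C (\<psi> s))"
proof -
  obtain k where k: "distribution_on A k W C" "\<forall>q\<in>W. C q \<subseteq> flag A D i q \<and> tv.dim (flag A D i q) = k + 1"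
    using C unfolding char_subdistribution_on_def by auto
  have inv1: "\<And>V X Y. V \<subseteq> W \<Longrightarrow> section_on A C V X \<Longrightarrow> section_on A C V Y \<Longrightarrow> \<forall>q\<in>V. lie_bracket A X Y q \<in> C q"
   and inv2: "\<And>V X Y. V \<subseteq> W \<Longrightarrow> section_on A C V X \<Longrightarrow> section_on A (flag A D (i + 1)) V Y \<Longrightarrow>
        \<forall>q\<in>V. lie_bracket A X Y q \<in> flag A D (i + 1) q"
    using C unfolding char_subdistribution_on_def by blast+
  have loc: "germ_local q v" if "q \<in> W" "v \<in> C q" for q v
    using germ_local_distribution[OF A k(1) that] .
  have cc: "push_tvec \<psi> ` push_tvec \<phi> ` C (\<psi> (\<phi> q)) \<subseteq> C q" if "q \<in> W" for q
  proof -
    have "push_tvec \<psi> (push_tvec \<phi> v) \<in> C q" if "v \<in> C q" for v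
      using push_push[OF _ loc[OF \<open>q \<in> W\<close> that]] \<open>q \<in> W\<close> that W by auto
    then show ?thesis using \<psi>\<phi> W that by auto
  qed
  note fl = transports_flag[OF DE]
  have ff: "push_tvec \<phi> ` flag A D i q = flag B E i (\<phi> q)" "\<And>v. v \<in> flag A D i q \<Longrightarrow> germ_local q v" if "q \<in> W" for q i
    using fl[of i] that W by (auto simp: transports_def)
  have ff': "push_tvec \<psi> ` flag B E i (\<phi> q) \<subseteq> flag A D i q" if "q \<in> W" for q i
  proof -
    have "\<phi> q \<in> U'" "\<psi> (\<phi> q) = q" using that W img \<psi>\<phi> by blast+
    then show ?thesis using transports_inverse[OF fl[of i], unfolded diffeo_pair.transports_def[OF inverse]] by (metis order_refl)
  qed
  have W1: "\<psi> (\<phi> q) = q" if "q \<in> W" for q using that W \<psi>\<phi> by auto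
  show ?thesis unfolding char_subdistribution_on_def
  proof (intro conjI allI impI ballI exI)
    show "distribution_on B k (\<phi> ` W) (\<lambda>s. push_tvec \<phi> ` C (\<psi> s))" by (rule distribution_push[OF k(1) W])
    fix s assume "s \<in> \<phi> ` W"
    then obtain q where q: "q \<in> W" "s = \<phi> q" by auto
    have "push_tvec \<phi> ` C q \<subseteq> push_tvec \<phi> ` flag A D i q" using q(1) k(2) by blast
    then show "push_tvec \<phi> ` C (\<psi> s) \<subseteq> flag B E i s" using ff(1)[OF q(1)] W1[OF q(1)] by (simp add: q(2))
    have "tv.dim (push_tvec \<phi> ` flag A D i q) = tv.dim (flag A D i q)"
      using q W ff(2) by (intro tv_dim_push[of q]) auto
    then show "tv.dim (flag B E i s) = k + 1" using q ff(1)[of q i] k(2) by auto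
  next
    fix V X Y s assume "V \<subseteq> \<phi> ` W \<and> section_on B (\<lambda>s. push_tvec \<phi> ` C (\<psi> s)) V X \<and> section_on B (\<lambda>s. push_tvec \<phi> ` C (\<psi> s)) V Y" "s \<in> V"
    then show "lie_bracket B X Y s \<in> push_tvec \<phi> ` C (\<psi> s)"
      by (intro bracket_closed_push[where ?C1.0 = C and ?C2.0 = C and ?C3.0 = C and W = W
            and ?E1.0 = "\<lambda>s. push_tvec \<phi> ` C (\<psi> s)" and ?E2.0 = "\<lambda>s. push_tvec \<phi> ` C (\<psi> s)" and V = V])
         (use inv1 W cc W1 in auto)
  next
    fix V X Y s assume "V \<subseteq> \<phi> ` W \<and> section_on B (\<lambda>s. push_tvec \<phi> ` C (\<psi> s)) V X \<and> section_on B (flag B E (i + 1)) V Y" "s \<in> V"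
    then show "lie_bracket B X Y s \<in> flag B E (i + 1) s"
      by (intro bracket_closed_push[where ?C1.0 = C and ?C2.0 = "flag A D (i + 1)" and ?C3.0 = "flag A D (i + 1)" and W = W
            and ?E1.0 = "\<lambda>s. push_tvec \<phi> ` C (\<psi> s)" and ?E2.0 = "flag B E (i + 1)" and V = V])
         (use inv2 W cc ff ff' in auto)
  qed
qed

end

lemma char_subdistribution_restrict:
  assumes C: "char_subdistribution_on A D i W C" and W: "W' \<subseteq> W" "open W'"
  shows "char_subdistribution_on A D i W' C"
proof -
  obtain k where k: "distribution_on A k W C" "\<forall>q\<in>W. C q \<subseteq> flag A D i q \<and> tv.dim (flag A D i q) = k + 1"
    using C unfolding char_subdistribution_on_def by auto
  have "distribution_on A k W' C" unfolding distribution_on_def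
  proof (intro conjI ballI W)
    fix q assume q: "q \<in> W'"
    from bspec[OF conjunct2[OF k(1)[unfolded distribution_on_def]] subsetD[OF W(1) q]] obtain V X where
      VX: "q \<in> V \<and> V \<subseteq> W \<and> (\<forall>j<k. smooth_vf A V (X j)) \<and> open V \<and>
        (\<forall>r\<in>V. C r = tv.span ((\<lambda>j. X j r) ` {..<k}) \<and> tv.dim (C r) = k)" by (elim exE)
    then have VX: "q \<in> V" "V \<subseteq> W" "open V" "\<And>j. j < k \<Longrightarrow> smooth_vf A V (X j)"
        "\<And>r. r \<in> V \<Longrightarrow> C r = tv.span ((\<lambda>j. X j r) ` {..<k}) \<and> tv.dim (C r) = k"
      by blast+
    have o: "open (V \<inter> W')" using VX(3) W(2) by (rule open_Int)
    have "smooth_vf A (V \<inter> W') (X j)" if "j < k" for j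
      by (rule smooth_vf_restrict[OF VX(4)[OF that] o Int_lower1])
    then show "\<exists>V X. q \<in> V \<and> V \<subseteq> W' \<and> (\<forall>j<k. smooth_vf A V (X j)) \<and> open V \<and>
      (\<forall>r\<in>V. C r = tv.span ((\<lambda>j. X j r) ` {..<k}) \<and> tv.dim (C r) = k)"
      using q VX(1,5) o by (intro exI[of _ "V \<inter> W'"] exI[of _ X] conjI) blast+
  qed
  note dist = this
  have inv1: "\<And>V X Y. V \<subseteq> W \<Longrightarrow> section_on A C V X \<Longrightarrow> section_on A C V Y \<Longrightarrow> \<forall>q\<in>V. lie_bracket A X Y q \<in> C q"
   and inv2: "\<And>V X Y. V \<subseteq> W \<Longrightarrow> section_on A C V X \<Longrightarrow> section_on A (flag A D (i + 1)) V Y \<Longrightarrow>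
        \<forall>q\<in>V. lie_bracket A X Y q \<in> flag A D (i + 1) q"
    using C unfolding char_subdistribution_on_def by blast+
  show ?thesis unfolding char_subdistribution_on_def
  proof (intro conjI allI impI exI[of _ k] dist)
    show "\<forall>q\<in>W'. C q \<subseteq> flag A D i q \<and> tv.dim (flag A D i q) = k + 1" using k(2) W(1) by blast
  next
    fix V X Y assume "V \<subseteq> W' \<and> section_on A C V X \<and> section_on A C V Y"
    then show "\<forall>q\<in>V. lie_bracket A X Y q \<in> C q" using W(1) by (intro inv1) auto
  next
    fix V X Y assume "V \<subseteq> W' \<and> section_on A C V X \<and> section_on A (flag A D (i + 1)) V Y"
    then show "\<forall>q\<in>V. lie_bracket A X Y q \<in> flag A D (i + 1) q" using W(1) by (intro inv2) auto
  qed
qed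

text \<open>The predicate whose unique solution is \<open>char_space\<close>. It is natural without further assumptions,
  whereas the description operator is natural only where existence and uniqueness hold.\<close>
definition char_value :: "('a::topological_space, 'e::euclidean_space) atlas \<Rightarrow> ('a \<Rightarrow> 'a tvec set) \<Rightarrow> nat \<Rightarrow> 'a \<Rightarrow> 'a tvec set \<Rightarrow> bool" where
  "char_value A D i q V \<longleftrightarrow> (\<exists>W C. q \<in> W \<and> char_subdistribution_on A D i W C \<and> C q = V)"

lemma char_space_eq: "char_space A D i q = (THE V. char_value A D i q V)"
  by (simp add: char_space_def char_value_def)

lemma char_subdistribution_distribution:
  assumes "char_subdistribution_on A D i W C" shows "\<exists>k. distribution_on A k W C"
  using conjunct1[OF assms[unfolded char_subdistribution_on_def]] by (elim exE conjE) (rule exI)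

lemma distribution_on_open: "distribution_on A k W C \<Longrightarrow> open W"
  unfolding distribution_on_def by (rule conjunct1)

lemma germ_local_char_value:
  assumes "smooth_atlas A" "char_value A D i q V" "v \<in> V" shows "germ_local q v"
proof -
  obtain W C where C: "q \<in> W" "char_subdistribution_on A D i W C" "C q = V"
    using assms(2) by (auto simp: char_value_def)
  then obtain k where "distribution_on A k W C" using char_subdistribution_distribution by blast
  then show ?thesis using germ_local_distribution[OF assms(1) _ C(1)] C(3) assms(3) by blast
qed

lemma char_subdistribution_open: "char_subdistribution_on A D i W C \<Longrightarrow> open W"
  using char_subdistribution_distribution[of A D i W C] distribution_on_open by blast

context diffeo_pair begin

lemma char_value_push:
  assumes DE: "transports D E" and q: "q \<in> U" and V: "char_value A D i q V"
  shows "char_value B E i (\<phi> q) (push_tvec \<phi> ` V)"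
proof -
  obtain W C where W: "q \<in> W" "char_subdistribution_on A D i W C" "C q = V"
    using V by (auto simp: char_value_def)
  have "char_subdistribution_on A D i (W \<inter> U) C"
    using char_subdistribution_open[OF W(2)] smooth_mapD(1)[OF \<phi>]
    by (intro char_subdistribution_restrict[OF W(2)]) auto
  from char_subdistribution_push[OF this Int_lower2 DE] show ?thesis
    unfolding char_value_def using W(1) q W(3) \<psi>\<phi>[OF q]
    by (intro exI[of _ "\<phi> ` (W \<inter> U)"] exI[of _ "\<lambda>s. push_tvec \<phi> ` C (\<psi> s)"]) simp
qed

end

context diffeo_pair begin

lemma char_space_push:
  assumes DE: "transports D E" and q: "q \<in> U" and ex1: "\<exists>!V. char_value B E i (\<phi> q) V"
  shows "push_tvec \<phi> ` char_space A D i q = char_space B E i (\<phi> q)"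
    and "char_value A D i q (char_space A D i q)"
proof -
  from ex1 obtain V' where V': "char_value B E i (\<phi> q) V'" and
      uniq: "\<forall>V. char_value B E i (\<phi> q) V \<longrightarrow> V = V'" by (rule ex1E)
  have image_back: "push_tvec \<phi> ` push_tvec \<psi> ` V' = V'"
    by (rule diffeo_pair.push_push_image[OF inverse img[OF q] germ_local_char_value[OF B V']])
  have 1: "char_value A D i q (push_tvec \<psi> ` V')"
    using diffeo_pair.char_value_push[OF inverse transports_inverse[OF DE] img[OF q] V'] \<psi>\<phi>[OF q] by simp
  have 2: "V = push_tvec \<psi> ` V'" if V: "char_value A D i q V" for V
  proof -
    have "push_tvec \<phi> ` V = V'" by (rule uniq[rule_format, OF char_value_push[OF DE q V]])
    moreover have "push_tvec \<psi> ` push_tvec \<phi> ` V = V"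
      by (rule push_push_image[OF q germ_local_char_value[OF A V]])
    ultimately show ?thesis by simp
  qed
  have "char_space A D i q = push_tvec \<psi> ` V'" unfolding char_space_eq
    by (rule the_equality) (rule 1, rule 2)
  moreover have "char_space B E i (\<phi> q) = V'" unfolding char_space_eq
    by (rule the_equality) (rule V', erule uniq[rule_format])
  ultimately show "push_tvec \<phi> ` char_space A D i q = char_space B E i (\<phi> q)" "char_value A D i q (char_space A D i q)"
    using image_back 1 by simp_all
qed

lemma push_image_eq_iff:
  assumes "q \<in> U" "\<And>v. v \<in> S \<Longrightarrow> germ_local q v" "\<And>v. v \<in> T \<Longrightarrow> germ_local q v"
  shows "push_tvec \<phi> ` S = push_tvec \<phi> ` T \<longleftrightarrow> S = T"
  by (rule inj_on_image_eq_iff[OF inj_push[OF assms(1)]]) (use assms in auto)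

text \<open>Existence and uniqueness of the characteristic spaces are assumed on the target only, where they
  will be read off from a normal form.\<close>
lemma sing_set_push:
  assumes DE: "transports D E"
    and ex1: "\<And>s i. s \<in> U' \<Longrightarrow> i + 4 \<le> DIM('e) \<Longrightarrow> \<exists>!V. char_value B E i s V"
    and q: "q \<in> U"
  shows "q \<in> sing_set A D j i \<longleftrightarrow> \<phi> q \<in> sing_set B E j i"
  using q
proof (induction j arbitrary: q)
  case 0
  note fl = transports_flag[OF DE, of i, unfolded transports_def, rule_format, OF 0]
  show ?case
  proof (cases "i + 5 \<le> DIM('e)")
    case True
    then have e: "\<exists>!V. char_value B E (i + 1) (\<phi> q) V" using ex1[OF img[OF 0], of "i + 1"] by simp
    have "flag A D i q = char_space A D (i + 1) q \<longleftrightarrow> flag B E i (\<phi> q) = char_space B E (i + 1) (\<phi> q)"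
      unfolding conjunct2[OF fl, symmetric] char_space_push(1)[OF DE 0 e, symmetric]
      by (rule push_image_eq_iff[OF 0 bspec[OF conjunct1[OF fl]]
            germ_local_char_value[OF A char_space_push(2)[OF DE 0 e]], symmetric])
    then show ?thesis by simp
  qed auto
next
  case (Suc j)
  have big: "i + 5 \<le> DIM('e)" if "q \<in> sing_set A D j i" for q
    using that by (induction j) auto
  show ?case
  proof (cases "q \<in> sing_set A D j i \<and> Suc j \<le> i")
    case True
    let ?m = "i - Suc j"
    have e: "\<exists>!V. char_value B E ?m (\<phi> q) V" using ex1[OF img[OF Suc.prems], of ?m] big[of q] True by simp
    note fl = transports_flag[OF DE, of ?m, unfolded transports_def, rule_format, OF Suc.prems]
    have T: "push_tvec \<phi> ` tangent_space A (sing_set A D j i) q = tangent_space B (sing_set B E j i) (\<phi> q)"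
      by (rule tangent_space_push[OF Suc.prems]) (rule Suc.IH)
    have I: "push_tvec \<phi> ` (flag A D ?m q \<inter> tangent_space A (sing_set A D j i) q) =
        flag B E ?m (\<phi> q) \<inter> tangent_space B (sing_set B E j i) (\<phi> q)"
      unfolding T[symmetric] conjunct2[OF fl, symmetric]
      by (rule inj_on_image_Int[OF inj_push[OF Suc.prems]])
         (use conjunct1[OF fl] germ_local_tangent_space[OF A] in blast)+
    have "flag A D ?m q \<inter> tangent_space A (sing_set A D j i) q = char_space A D ?m q \<longleftrightarrow>
       flag B E ?m (\<phi> q) \<inter> tangent_space B (sing_set B E j i) (\<phi> q) = char_space B E ?m (\<phi> q)"
      unfolding I[symmetric] char_space_push(1)[OF DE Suc.prems e, symmetric]
    proof (rule push_image_eq_iff[OF Suc.prems, symmetric])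
      show "germ_local q v" if "v \<in> flag A D ?m q \<inter> tangent_space A (sing_set A D j i) q" for v
        using conjunct1[OF fl] that by blast
    qed (rule germ_local_char_value[OF A char_space_push(2)[OF DE Suc.prems e]])
    then show ?thesis using True Suc.IH[OF Suc.prems] by simp
  next
    case False
    then show ?thesis using Suc.IH[OF Suc.prems] by auto
  qed
qed

lemma sing_type_push:
  assumes "transports D E"
    and "\<And>s i. s \<in> U' \<Longrightarrow> i + 4 \<le> DIM('e) \<Longrightarrow> \<exists>!V. char_value B E i s V"
    and "q \<in> U"
  shows "sing_type A D q = sing_type B E (\<phi> q)"
  unfolding sing_type_def sing_letter_def using sing_set_push[OF assms] by simp

end

section \<open>Tangent vectors and vector fields on a Euclidean space\<close>

text \<open>The directional derivative along \<open>a\<close> at \<open>z\<close>, as a functional in the sense of \<open>velocity\<close>.\<close>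
definition dir_tvec :: "'e::euclidean_space \<Rightarrow> 'e \<Rightarrow> 'e tvec" where
  "dir_tvec z a = velocity euclid (\<lambda>t. z + t *\<^sub>R a)"

lemma smooth_near_euclid: "smooth_near euclid z f \<longleftrightarrow> (\<exists>W. z \<in> W \<and> open W \<and> smooth_on W f)"
  by (simp add: smooth_near_def smooth_map_euclid_euclid)

lemma smooth_near_linear: "bounded_linear f \<Longrightarrow> smooth_near euclid z f"
  unfolding smooth_near_euclid by (intro exI[of _ UNIV]) (simp add: smooth_on_linear)

lemma velocity_euclid:
  assumes c: "smooth_on J c" "open J" "0 \<in> J"
  shows "velocity euclid c f = (if smooth_near euclid (c 0) f
     then frechet_derivative f (at (c 0)) (frechet_derivative c (at 0) 1) else 0)"
proof (cases "smooth_near euclid (c 0) f")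
  case True
  then obtain W where W: "c 0 \<in> W" "open W" "smooth_on W f" by (auto simp: smooth_near_euclid)
  let ?c = "frechet_derivative c (at 0)" and ?f = "frechet_derivative f (at (c 0))"
  have "((\<lambda>t. f (c t)) has_derivative (\<lambda>r. ?f (?c r))) (at 0)"
    by (rule has_derivative_compose[OF smooth_on_has_derivative[OF c(1,3)] smooth_on_has_derivative[OF W(3,1)]])
  moreover have "(\<lambda>r. ?f (?c r)) = (*) (?f (?c 1))"
  proof
    fix r :: real
    have "?f (?c r) = ?f (?c (r *\<^sub>R 1))" by simp
    also have "\<dots> = r *\<^sub>R ?f (?c 1)"
      using linear_frechet_derivative[OF smooth_on_differentiable[OF c(1,3)]]
        linear_frechet_derivative[OF smooth_on_differentiable[OF W(3,1)]] by (simp only: linear_scale)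
    finally show "?f (?c r) = ?f (?c 1) * r" by simp
  qed
  ultimately have "((\<lambda>t. f (c t)) has_real_derivative ?f (?c 1)) (at 0)"
    by (simp only: has_field_derivative_def)
  then have "deriv (f \<circ> c) 0 = ?f (?c 1)" unfolding o_def by (rule DERIV_imp_deriv)
  then show ?thesis using True by (simp add: velocity_def)
qed (simp add: velocity_def)

lemma has_derivative_line: "((\<lambda>t. z + t *\<^sub>R a) has_derivative (\<lambda>r. r *\<^sub>R a)) (at t)"
  by (auto intro!: derivative_eq_intros)

lemma smooth_on_line: "smooth_on S (\<lambda>t::real. z + t *\<^sub>R a)"
proof -
  have "smooth_on UNIV (\<lambda>t::real. z + t *\<^sub>R a)"
    by (intro smooth_on_add smooth_on_const smooth_on_linear) (auto simp: bounded_linear_scaleR_left)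
  then show ?thesis by (rule smooth_on_subset) simp
qed

lemma dir_tvec_apply:
  "dir_tvec z a f = (if smooth_near euclid z f then frechet_derivative f (at z) a else 0)"
proof -
  have "frechet_derivative (\<lambda>t. z + t *\<^sub>R a) (at 0) 1 = a"
    using fun_cong[OF frechet_derivative_at[OF has_derivative_line[of z a 0]], of 1] by simp
  then show ?thesis
    using velocity_euclid[OF smooth_on_line[of UNIV z a], of f] by (simp add: dir_tvec_def)
qed

lemma velocity_eq_dir_tvec:
  assumes "smooth_on J c" "open J" "0 \<in> J"
  shows "velocity euclid c = dir_tvec (c 0) (frechet_derivative c (at 0) 1)"
  by (rule ext) (simp add: velocity_euclid[OF assms] dir_tvec_apply)

lemma dir_tvec_tangent: "dir_tvec z a \<in> tangent_space euclid UNIV z"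
  unfolding tangent_space_def dir_tvec_def
  by (intro CollectI exI[of _ "\<lambda>t. z + t *\<^sub>R a"] exI[of _ UNIV])
     (auto simp: smooth_map_euclid_euclid smooth_on_line)

lemma tangent_space_euclid: "tangent_space euclid UNIV z = range (dir_tvec z)"
proof
  show "tangent_space euclid UNIV z \<subseteq> range (dir_tvec z)"
    unfolding tangent_space_def by (auto simp: smooth_map_euclid_euclid velocity_eq_dir_tvec)
  show "range (dir_tvec z) \<subseteq> tangent_space euclid UNIV z" using dir_tvec_tangent by blast
qed

lemma germ_local_dir_tvec: "germ_local z (dir_tvec z a)"
  using germ_local_tangent_space[OF smooth_atlas_euclid dir_tvec_tangent] .

interpretation dtv: vector_space_pair "(*\<^sub>R) :: real \<Rightarrow> 'e::real_vector \<Rightarrow> 'e" "tv_scale :: real \<Rightarrow> 'b tvec \<Rightarrow> 'b tvec"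
  by unfold_locales

lemma linear_dir_tvec: "Vector_Spaces.linear (*\<^sub>R) tv_scale (dir_tvec z)"
proof -
  have "frechet_derivative f (at z) (a + b) = frechet_derivative f (at z) a + frechet_derivative f (at z) b"
       "frechet_derivative f (at z) (c *\<^sub>R a) = c * frechet_derivative f (at z) a"
    if "smooth_near euclid z f" for f :: "'a \<Rightarrow> real" and a b c
    using that linear_frechet_derivative[of f "at z"]
    by (auto simp: smooth_near_euclid smooth_on_differentiable linear_add linear_scale)
  then show ?thesis
    by (auto simp: Vector_Spaces.linear_iff tv.vector_space_axioms real_vector.vector_space_axioms
        tv_scale_def fun_eq_iff dir_tvec_apply)
qed

lemma frechet_derivative_linear: "bounded_linear f \<Longrightarrow> frechet_derivative f (at x) = f"
  using bounded_linear_imp_has_derivative frechet_derivative_at by metis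

lemma dir_tvec_linear: "bounded_linear f \<Longrightarrow> dir_tvec z a f = f a"
  by (simp add: dir_tvec_apply smooth_near_linear frechet_derivative_linear)

lemma inj_dir_tvec: "inj (dir_tvec z)"
proof (rule injI)
  fix a b assume "dir_tvec z a = dir_tvec z b"
  then have "a \<bullet> e = b \<bullet> e" for e
    using dir_tvec_linear[OF bounded_linear_inner_left[of e], of z] by metis
  then show "a = b" by (metis euclidean_eqI)
qed

lemma span_dir_tvec: "tv.span (dir_tvec z ` S) = dir_tvec z ` span S"
  using dtv.linear_span_image[OF linear_dir_tvec] by (simp add: span_raw_def)

lemma dim_dir_tvec:
  fixes S :: "'e::euclidean_space set"
  assumes "subspace S" shows "tv.dim (dir_tvec z ` S) = dim S"
proof -
  obtain B where B: "B \<subseteq> S" "independent B" "S \<subseteq> span B" "card B = dim S"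
    using basis_exists by blast
  show ?thesis
  proof (rule tv.dim_unique)
    show "dir_tvec z ` B \<subseteq> dir_tvec z ` S" using B by blast
    show "dir_tvec z ` S \<subseteq> tv.span (dir_tvec z ` B)" unfolding span_dir_tvec using B by blast
    show "tv.independent (dir_tvec z ` B)"
      by (rule dtv.linear_independent_injective_image[OF linear_dir_tvec])
         (use B(2) inj_on_subset[OF inj_dir_tvec] in \<open>auto simp: dependent_raw_def\<close>)
    show "card (dir_tvec z ` B) = dim S"
      using B(4) card_image[OF inj_on_subset[OF inj_dir_tvec subset_UNIV], of z B] by simp
  qed
qed

lemma push_dir_tvec:
  fixes F :: "'e::euclidean_space \<Rightarrow> 'e"
  assumes "diffeo_pair euclid euclid U U' F G" "z \<in> U"
  shows "push_tvec F (dir_tvec z a) = dir_tvec (F z) (frechet_derivative F (at z) a)"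
proof -
  interpret diffeo_pair euclid euclid U U' F G by fact
  have U: "open U" "smooth_on U F" using \<phi> by (auto simp: smooth_map_euclid_euclid)
  let ?c = "\<lambda>t. z + t *\<^sub>R a"
  let ?J = "?c -` U"
  have J: "open ?J" by (rule open_vimage[OF U(1)]) (intro continuous_intros)
  have s: "smooth_on ?J (F \<circ> ?c)" unfolding o_def
    by (rule smooth_on_compose[OF J _ smooth_on_line U(2)]) auto
  have "frechet_derivative (F \<circ> ?c) (at 0) = (\<lambda>r. frechet_derivative F (at z) (r *\<^sub>R a))"
    unfolding o_def
    by (rule frechet_derivative_at[symmetric], rule has_derivative_compose[OF has_derivative_line])
       (use smooth_on_has_derivative[OF U(2) assms(2)] in simp)
  then show ?thesis
    using velocity_eq_dir_tvec[OF s J] push_velocity[of ?c] assms(2) by (simp add: dir_tvec_def)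
qed

text \<open>The components of a vector field are its values on the coordinate functions, hence smooth.\<close>
lemma smooth_vf_euclidE:
  assumes "smooth_vf euclid W X"
  obtains Y where "smooth_on W Y" "\<And>z. z \<in> W \<Longrightarrow> X z = dir_tvec z (Y z)"
proof
  let ?Y = "\<lambda>z. \<Sum>b\<in>Basis. X z (\<lambda>r. r \<bullet> b) *\<^sub>R b"
  have W: "open W" using assms by (simp add: smooth_vf_def)
  have "smooth_on W (\<lambda>z. X z (\<lambda>r. r \<bullet> b))" for b
  proof -
    have "smooth_map euclid euclid W (\<lambda>r. r \<bullet> b)"
      using W by (simp add: smooth_map_euclid_euclid smooth_on_linear bounded_linear_inner_left)
    then have "smooth_map euclid euclid W (\<lambda>z. X z (\<lambda>r. r \<bullet> b))"
      using assms unfolding smooth_vf_def by blast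
    then show ?thesis by (simp add: smooth_map_euclid_euclid)
  qed
  then show "smooth_on W ?Y"
    by (intro smooth_on_sum smooth_on_scaleR smooth_on_const W)
  fix z assume "z \<in> W"
  then have "X z \<in> range (dir_tvec z)" using assms by (auto simp: smooth_vf_def tangent_space_euclid)
  then obtain a where a: "X z = dir_tvec z a" by auto
  have "?Y z = a"
    by (simp add: a dir_tvec_linear[OF bounded_linear_inner_left] euclidean_representation)
  then show "X z = dir_tvec z (?Y z)" using a by simp
qed

lemma dir_tvec_eq_derivative:
  "open V \<Longrightarrow> z \<in> V \<Longrightarrow> smooth_on V f \<Longrightarrow> dir_tvec z a f = frechet_derivative f (at z) a"
  by (auto simp: dir_tvec_apply smooth_near_euclid)

lemma smooth_vf_euclidI:
  assumes W: "open W" and Y: "smooth_on W Y" and X: "\<And>z. z \<in> W \<Longrightarrow> X z = dir_tvec z (Y z)"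
  shows "smooth_vf euclid W X"
  unfolding smooth_vf_def
proof (intro conjI ballI allI impI W)
  show "X z \<in> tangent_space euclid UNIV z" if "z \<in> W" for z using X[OF that] dir_tvec_tangent by simp
  fix V and f :: "'a \<Rightarrow> real" assume a: "V \<subseteq> W \<and> smooth_map euclid euclid V f"
  then have V: "open V" "smooth_on V f" by (auto simp: smooth_map_euclid_euclid)
  have "smooth_on V (\<lambda>z. frechet_derivative f (at z) (Y z))"
    using V smooth_on_subset[OF Y] a by (intro smooth_on_derivative_along) auto
  then have "smooth_on V (\<lambda>z. X z f)"
  proof (rule smooth_on_cong[OF V(1), rotated])
    fix z assume z: "z \<in> V"
    then have "z \<in> W" using a by blast
    then show "frechet_derivative f (at z) (Y z) = X z f"
      by (simp add: X dir_tvec_eq_derivative[OF V(1) z V(2)])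
  qed
  then show "smooth_map euclid euclid V (\<lambda>z. X z f)" using V by (simp add: smooth_map_euclid_euclid)
qed

text \<open>The second-order part of \<open>X (Y f)\<close> sees \<open>Y\<close> only through its value at \<open>z\<close>. By symmetry of the
  second derivative it cancels against that of \<open>Y (X f)\<close> in a bracket.\<close>
lemma derivative_along_derivative:
  fixes f :: "'v::euclidean_space \<Rightarrow> real"
  assumes S: "open S" "z \<in> S" and f: "smooth_on S f" and Y: "smooth_on S Y"
  shows "frechet_derivative (\<lambda>x. frechet_derivative f (at x) (Y x)) (at z) u =
    frechet_derivative f (at z) (frechet_derivative Y (at z) u) +
    frechet_derivative (\<lambda>x. frechet_derivative f (at x) (Y z)) (at z) u"
proof -
  let ?Df = "\<lambda>b x. frechet_derivative f (at x) b"
  have lin: "linear (frechet_derivative f (at x))" if "x \<in> S" for x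
    using smooth_on_differentiable[OF f that] by (rule linear_frechet_derivative)
  have exp: "frechet_derivative f (at x) v = (\<Sum>b\<in>Basis. (v \<bullet> b) * ?Df b x)" if "x \<in> S" for x v
  proof -
    have "frechet_derivative f (at x) v = frechet_derivative f (at x) (\<Sum>b\<in>Basis. (v \<bullet> b) *\<^sub>R b)"
      by (simp add: euclidean_representation)
    then show ?thesis by (simp add: linear_sum[OF lin[OF that]] linear_scale[OF lin[OF that]])
  qed
  have D: "(?Df b has_derivative frechet_derivative (?Df b) (at z)) (at z)" for b
    by (rule smooth_on_has_derivative[OF smooth_on_derivative[OF f] S(2)])
  have DY: "((\<lambda>x. Y x \<bullet> b) has_derivative (\<lambda>u. frechet_derivative Y (at z) u \<bullet> b)) (at z)" for b
    by (rule has_derivative_inner_left[OF smooth_on_has_derivative[OF Y S(2)]])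
  have "((\<lambda>x. \<Sum>b\<in>Basis. (Y x \<bullet> b) * ?Df b x) has_derivative
     (\<lambda>u. \<Sum>b\<in>Basis. (Y z \<bullet> b) * frechet_derivative (?Df b) (at z) u + (frechet_derivative Y (at z) u \<bullet> b) * ?Df b z)) (at z)"
    by (intro has_derivative_sum has_derivative_mult D DY)
  then have "((\<lambda>x. frechet_derivative f (at x) (Y x)) has_derivative
     (\<lambda>u. \<Sum>b\<in>Basis. (Y z \<bullet> b) * frechet_derivative (?Df b) (at z) u + (frechet_derivative Y (at z) u \<bullet> b) * ?Df b z)) (at z)"
    by (rule has_derivative_transform_within_open[OF _ S]) (rule exp[symmetric])
  from frechet_derivative_at[OF this, symmetric]
  have 1: "frechet_derivative (\<lambda>x. frechet_derivative f (at x) (Y x)) (at z) u =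
     (\<Sum>b\<in>Basis. (Y z \<bullet> b) * frechet_derivative (?Df b) (at z) u) + (\<Sum>b\<in>Basis. (frechet_derivative Y (at z) u \<bullet> b) * ?Df b z)"
    by (simp add: sum.distrib)
  have 2: "(\<Sum>b\<in>Basis. (frechet_derivative Y (at z) u \<bullet> b) * ?Df b z) = frechet_derivative f (at z) (frechet_derivative Y (at z) u)"
    by (rule exp[OF S(2), symmetric])
  have "((\<lambda>x. \<Sum>b\<in>Basis. (Y z \<bullet> b) * ?Df b x) has_derivative
     (\<lambda>u. \<Sum>b\<in>Basis. (Y z \<bullet> b) * frechet_derivative (?Df b) (at z) u)) (at z)"
    by (intro has_derivative_sum has_derivative_mult_right D)
  then have "((\<lambda>x. frechet_derivative f (at x) (Y z)) has_derivative
     (\<lambda>u. \<Sum>b\<in>Basis. (Y z \<bullet> b) * frechet_derivative (?Df b) (at z) u)) (at z)"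
    by (rule has_derivative_transform_within_open[OF _ S]) (rule exp[symmetric])
  from frechet_derivative_at[OF this, symmetric] 1 2 show ?thesis by simp
qed

text \<open>The bracket of functionals is the classical \<open>DT S - DS T\<close> for the component functions.\<close>
lemma lie_bracket_euclid:
  assumes W: "open W" "z \<in> W" and S: "smooth_on W S" and T: "smooth_on W T"
    and X: "\<And>r. r \<in> W \<Longrightarrow> X r = dir_tvec r (S r)" and Y: "\<And>r. r \<in> W \<Longrightarrow> Y r = dir_tvec r (T r)"
  shows "lie_bracket euclid X Y z =
    dir_tvec z (frechet_derivative T (at z) (S z) - frechet_derivative S (at z) (T z))"
proof
  fix f
  show "lie_bracket euclid X Y z f =
    dir_tvec z (frechet_derivative T (at z) (S z) - frechet_derivative S (at z) (T z)) f"
  proof (cases "smooth_near euclid z f")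
    case True
    then obtain N where N: "z \<in> N" "open N" "smooth_on N f" by (auto simp: smooth_near_euclid)
    let ?V = "W \<inter> N"
    have V: "open ?V" "z \<in> ?V" using W N by auto
    note sm = smooth_on_subset[OF N(3) Int_lower2[of W]] smooth_on_subset[OF S Int_lower1[of W N]]
      smooth_on_subset[OF T Int_lower1[of W N]]
    have half: "dir_tvec z a (\<lambda>r. Z r f) = frechet_derivative f (at z) (frechet_derivative Q (at z) a) +
        frechet_derivative (\<lambda>x. frechet_derivative f (at x) (Q z)) (at z) a"
      if Q: "smooth_on ?V Q" and Z: "\<And>r. r \<in> ?V \<Longrightarrow> Z r = dir_tvec r (Q r)" for Z Q a
    proof -
      have "\<forall>\<^sub>F r in nhds z. Z r f = frechet_derivative f (at r) (Q r)"
        unfolding eventually_nhds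
        by (intro exI[of _ ?V] conjI V ballI) (simp only: Z dir_tvec_eq_derivative[OF V(1) _ sm(1)])
      from germ_localD[OF germ_local_dir_tvec this, of a]
      have "dir_tvec z a (\<lambda>r. Z r f) = dir_tvec z a (\<lambda>r. frechet_derivative f (at r) (Q r))" .
      also have "\<dots> = frechet_derivative (\<lambda>r. frechet_derivative f (at r) (Q r)) (at z) a"
        by (rule dir_tvec_eq_derivative[OF V smooth_on_derivative_along[OF V(1) sm(1) Q]])
      finally show ?thesis using derivative_along_derivative[OF V sm(1) Q] by simp
    qed
    have lin: "linear (frechet_derivative f (at z))"
      using smooth_on_differentiable[OF N(3,1)] by (rule linear_frechet_derivative)
    have "lie_bracket euclid X Y z f = dir_tvec z (S z) (\<lambda>r. Y r f) - dir_tvec z (T z) (\<lambda>r. X r f)"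
      using True X[OF W(2)] Y[OF W(2)] by (simp add: lie_bracket_def)
    also have "\<dots> = frechet_derivative f (at z) (frechet_derivative T (at z) (S z)) - frechet_derivative f (at z) (frechet_derivative S (at z) (T z))"
      using half[OF sm(3), of Y "S z"] half[OF sm(2), of X "T z"] X Y
        second_derivative_symmetric[OF V sm(1), of "T z" "S z"] by simp
    also have "\<dots> = dir_tvec z (frechet_derivative T (at z) (S z) - frechet_derivative S (at z) (T z)) f"
      using True by (simp add: dir_tvec_apply linear_diff[OF lin])
    finally show ?thesis .
  next
    case False
    then show ?thesis by (simp add: lie_bracket_def dir_tvec_apply)
  qed
qed

section \<open>Coordinates\<close>

lemma bij_ix: "bij_betw (ix :: nat \<Rightarrow> 'n) {1..CARD('n)} (UNIV :: 'n::{finite,linorder} set)"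
proof -
  let ?L = "sorted_list_of_set (UNIV :: 'n set)"
  have "bij_betw (\<lambda>k. k - 1) {1..CARD('n)} {..<CARD('n)}"
    by (rule bij_betwI[where g = Suc]) auto
  moreover have "bij_betw (\<lambda>k. ?L ! k) {..<CARD('n)} UNIV"
    by (rule bij_betw_nth) auto
  ultimately have "bij_betw ((\<lambda>k. ?L ! k) \<circ> (\<lambda>k. k - 1)) {1..CARD('n)} UNIV" by (rule bij_betw_trans)
  then show ?thesis by (simp add: ix_def[abs_def] o_def)
qed

lemma bounded_linear_crd: "bounded_linear (crd k)"
  unfolding crd_def[abs_def] by (rule bounded_linear_vec_nth)

lemma crd_simps [simp]:
  "crd k 0 = 0" "crd k (a + b) = crd k a + crd k b" "crd k (a - b) = crd k a - crd k b"
  "crd k (- a) = - crd k a" "crd k (c *\<^sub>R a) = c * crd k a"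
  "crd k (sum f I) = (\<Sum>i\<in>I. crd k (f i))"
  by (simp_all add: crd_def)

lemma crd_pd:
  assumes "k \<in> {1..CARD('n)}" "j \<in> {1..CARD('n)}"
  shows "crd k (pd j :: real ^ 'n::{finite,linorder}) = (if k = j then 1 else 0)"
  using inj_onD[OF bij_betw_imp_inj_on[OF bij_ix[where 'n='n]], OF _ assms]
  by (auto simp: crd_def pd_def axis_def)

lemma crd_eqI:
  fixes x y :: "real ^ 'n::{finite,linorder}"
  assumes "\<And>k. k \<in> {1..CARD('n)} \<Longrightarrow> crd k x = crd k y" shows "x = y"
proof (rule vec_eq_iff[THEN iffD2], rule allI)
  fix i :: 'n
  have "i \<in> ix ` {1..CARD('n)}" using bij_ix[where 'n='n] by (simp add: bij_betw_def)
  then show "x $ i = y $ i" using assms by (auto simp: crd_def)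
qed

lemma sum_crd_pd:
  assumes "k \<in> {1..CARD('n)}" "I \<subseteq> {1..CARD('n)}"
  shows "(\<Sum>j\<in>I. c j * crd k (pd j :: real ^ 'n::{finite,linorder})) = (if k \<in> I then c k else 0)"
proof -
  have "(\<Sum>j\<in>I. c j * crd k (pd j :: (real, 'n) vec)) = (\<Sum>j\<in>I. if j = k then c j else 0)"
    by (rule sum.cong) (use assms crd_pd[where 'n='n] in auto)
  also have "\<dots> = (if k \<in> I then c k else 0)"
    using finite_subset[OF assms(2)] by (simp add: sum.delta)
  finally show ?thesis .
qed

lemma crd_low:
  assumes "k \<in> {1..CARD('n)}" "i \<le> CARD('n)"
  shows "crd k (low i (x :: real ^ 'n::{finite,linorder})) = (if k \<le> i then crd k x else 0)"
  unfolding low_def using assms sum_crd_pd[where 'n='n, of k "{1..i}" "\<lambda>j. crd j x"] by auto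

lemma inner_crd: "(x :: real ^ 'n::{finite,linorder}) \<bullet> y = (\<Sum>k\<in>{1..CARD('n)}. crd k x * crd k y)"
  unfolding inner_vec_def crd_def inner_real_def
  using sum.reindex_bij_betw[OF bij_ix[where 'n='n], of "\<lambda>i. x $ i * y $ i"] by simp

section \<open>Kumpera-Ruiz fields\<close>

lemma prolong_simps:
  "fst (prolong m p K) = (\<lambda>x. pd m)"
  "snd (prolong m p K) x = (case p of Reg c \<Rightarrow> crd m x + c | Sing \<Rightarrow> 1) *\<^sub>R fst K x +
     (case p of Reg c \<Rightarrow> 1 | Sing \<Rightarrow> crd m x) *\<^sub>R snd K x"
  by (cases p; cases K; simp)+

text \<open>The coefficients of \<open>\<kappa>\<^sub>1\<^sup>m\<^sup>-\<^sup>1\<close> and \<open>\<kappa>\<^sub>2\<^sup>m\<^sup>-\<^sup>1\<close> in \<open>\<kappa>\<^sub>2\<^sup>m\<close>. They treat both kinds of prolongation at once; one of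
  the two is always \<open>1\<close>.\<close>
definition coef1 :: "prolongation list \<Rightarrow> nat \<Rightarrow> real ^ 'n::{finite,linorder} \<Rightarrow> real" where
  "coef1 ps m z = (case ps ! (m - 4) of Reg c \<Rightarrow> crd m z + c | Sing \<Rightarrow> 1)"

definition coef2 :: "prolongation list \<Rightarrow> nat \<Rightarrow> real ^ 'n::{finite,linorder} \<Rightarrow> real" where
  "coef2 ps m z = (case ps ! (m - 4) of Reg c \<Rightarrow> 1 | Sing \<Rightarrow> crd m z)"

lemma coef_nonzero: "coef1 ps m z \<noteq> 0 \<or> coef2 ps m z \<noteq> 0"
  by (auto simp: coef1_def coef2_def split: prolongation.splits)

lemma kappa1_eq: "3 \<le> m \<Longrightarrow> kappa1 ps m z = pd m"
proof (cases "m - 3")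
  case 0 moreover assume "3 \<le> m" ultimately have "m = 3" by simp
  then show ?thesis by (simp add: kappa1_def)
next
  case (Suc j) moreover assume "3 \<le> m" ultimately have "j + 4 = m" by simp
  then show ?thesis using Suc by (simp add: kappa1_def prolong_simps)
qed

lemma kappa2_3: "kappa2 ps 3 z = crd 3 z *\<^sub>R pd 2 + pd 1"
  by (simp add: kappa2_def)

lemma kappa2_Suc:
  assumes "3 \<le> m"
  shows "kappa2 ps (Suc m) z = coef1 ps (Suc m) z *\<^sub>R pd m + coef2 ps (Suc m) z *\<^sub>R kappa2 ps m z"
proof -
  have "Suc m - 3 = Suc (m - 3)" "m - 3 + 4 = Suc m" "Suc m - 4 = m - 3" using assms by auto
  then show ?thesis
    using kappa1_eq[OF assms, of ps z]
    by (simp add: kappa1_def kappa2_def coef1_def coef2_def prolong_simps)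
qed

lemma kappa2_3_fun: "kappa2 ps 3 = (\<lambda>z. crd 3 z *\<^sub>R pd 2 + pd 1)"
  by (rule ext) (rule kappa2_3)

lemma kappa2_Suc_fun: "3 \<le> m \<Longrightarrow>
  kappa2 ps (Suc m) = (\<lambda>z. coef1 ps (Suc m) z *\<^sub>R pd m + coef2 ps (Suc m) z *\<^sub>R kappa2 ps m z)"
  by (rule ext) (rule kappa2_Suc)

lemma kappa2_step:
  assumes "4 \<le> m"
  shows "kappa2 ps m z = coef1 ps m z *\<^sub>R pd (m - 1) + coef2 ps m z *\<^sub>R kappa2 ps (m - 1) z"
  using kappa2_Suc[of "m - 1" ps z] assms by simp

lemma kappa2_crd_high:
  assumes "3 \<le> m" "m \<le> k" "k \<le> CARD('n)"
  shows "crd k (kappa2 ps m (z :: real ^ 'n::{finite,linorder})) = 0"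
  using assms(1,2)
proof (induction m rule: nat_induct_at_least)
  case base then show ?case using assms crd_pd[where 'n='n, of k] by (simp add: kappa2_3)
next
  case (Suc m) then show ?case using assms crd_pd[where 'n='n, of k] by (simp add: kappa2_Suc)
qed

lemma kappa2_cong:
  fixes z z' :: "real ^ 'n::{finite,linorder}"
  assumes "3 \<le> m" "\<And>k. k \<in> {1..m} \<Longrightarrow> crd k z = crd k z'"
  shows "kappa2 ps m z = kappa2 ps m z'"
  using assms
proof (induction m rule: nat_induct_at_least)
  case base then show ?case by (simp add: kappa2_3)
next
  case (Suc m)
  have "kappa2 ps m z = kappa2 ps m z'" using Suc.prems by (intro Suc.IH) auto
  moreover have "crd (Suc m) z = crd (Suc m) z'" using Suc.prems by simp
  ultimately show ?case using Suc.hyps by (simp add: kappa2_Suc coef1_def coef2_def split: prolongation.split)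
qed

lemma smooth_crd: "smooth_on UNIV (crd k)" by (rule smooth_on_linear[OF bounded_linear_crd])

lemma smooth_coef: "smooth_on UNIV (coef1 ps m)" "smooth_on UNIV (coef2 ps m)"
  unfolding coef1_def[abs_def] coef2_def[abs_def]
  by (cases "ps ! (m - 4)"; auto intro: smooth_on_add smooth_crd smooth_on_const)+

lemma smooth_kappa2: "3 \<le> m \<Longrightarrow> smooth_on UNIV (kappa2 ps m)"
proof (induction m rule: nat_induct_at_least)
  case base show ?case unfolding kappa2_3_fun
    by (intro smooth_on_add smooth_on_scaleR smooth_crd smooth_on_const open_UNIV)
next
  case (Suc m)
  show ?case unfolding kappa2_Suc_fun[OF Suc.hyps]
    by (intro smooth_on_add smooth_on_scaleR smooth_coef smooth_on_const open_UNIV Suc.IH)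
qed

lemma has_derivative_kappa2:
  "3 \<le> m \<Longrightarrow> (kappa2 ps m has_derivative frechet_derivative (kappa2 ps m) (at z)) (at z)"
  by (rule smooth_on_has_derivative[OF smooth_kappa2]) auto

text \<open>The direction \<open>\<partial>\<kappa>\<^sub>2\<^sup>m / \<partial>x\<^sub>m = [\<partial>\<^sub>m, \<kappa>\<^sub>2\<^sup>m]\<close>: for \<open>m \<ge> 4\<close>, the one of \<open>\<kappa>\<^sub>1\<^sup>m\<^sup>-\<^sup>1\<close>, \<open>\<kappa>\<^sub>2\<^sup>m\<^sup>-\<^sup>1\<close>
  that is multiplied by \<open>x\<^sub>m\<close>.\<close>
definition kdir :: "prolongation list \<Rightarrow> nat \<Rightarrow> real ^ 'n::{finite,linorder} \<Rightarrow> (real, 'n) vec" where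
  "kdir ps m z = (if m = 3 then pd 2 else case ps ! (m - 4) of Reg c \<Rightarrow> pd (m - 1) | Sing \<Rightarrow> kappa2 ps (m - 1) z)"

lemma frechet_derivativeI: "(f has_derivative f') (at x) \<Longrightarrow> frechet_derivative f (at x) = f'"
  using frechet_derivative_at by metis

lemma has_derivative_crd: "(crd k has_derivative crd k) (at z)"
  by (rule bounded_linear_imp_has_derivative[OF bounded_linear_crd])

lemma derivative_kappa2_vert:
  assumes "3 \<le> m" "\<And>k. k \<in> {1..<m} \<Longrightarrow> crd k v = 0"
  shows "frechet_derivative (kappa2 ps m) (at z) v = crd m v *\<^sub>R kdir ps m (z :: real ^ 'n::{finite,linorder})"
  using assms
proof (induction m rule: nat_induct_at_least)
  case base
  have "((\<lambda>z. crd 3 z *\<^sub>R pd 2 + pd 1) has_derivative (\<lambda>v. crd 3 v *\<^sub>R (pd 2 :: (real, 'n) vec))) (at z)"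
    by (auto intro!: derivative_eq_intros has_derivative_crd)
  then show ?case
    unfolding kappa2_3_fun by (simp add: frechet_derivativeI kdir_def)
next
  case (Suc m)
  let ?D = "frechet_derivative (kappa2 ps m) (at z)"
  have "?D v = crd m v *\<^sub>R kdir ps m z" using Suc.prems by (intro Suc.IH) auto
  then have D0: "?D v = 0" using Suc by simp
  note d = has_derivative_kappa2[OF Suc.hyps, of ps z] has_derivative_crd[of "Suc m" z]
  note eq = kappa2_Suc_fun[OF Suc.hyps]
  show ?case
  proof (cases "ps ! (Suc m - 4)")
    case (Reg c)
    have "(kappa2 ps (Suc m) has_derivative (\<lambda>v. crd (Suc m) v *\<^sub>R pd m + ?D v)) (at z)"
      unfolding eq coef1_def coef2_def Reg by (auto intro!: derivative_eq_intros d)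
    then show ?thesis using Suc.hyps Reg by (simp add: frechet_derivativeI kdir_def D0)
  next
    case Sing
    have "(kappa2 ps (Suc m) has_derivative (\<lambda>v. crd (Suc m) z *\<^sub>R ?D v + crd (Suc m) v *\<^sub>R kappa2 ps m z)) (at z)"
      unfolding eq coef1_def coef2_def Sing by (auto intro!: derivative_eq_intros d)
    then show ?thesis using Suc.hyps Sing by (simp add: frechet_derivativeI kdir_def D0)
  qed
qed

text \<open>The span of \<open>\<partial>\<^sub>m, \<dots>, \<partial>\<^sub>n\<close> (see \<open>vert_eq_span\<close>), described by equations so that derivatives of
  functions with values in it are seen to stay in it.\<close>
definition vert :: "nat \<Rightarrow> (real ^ 'n::{finite,linorder}) set" where
  "vert m = {v. \<forall>k\<in>{1..<m}. crd k v = 0}"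

text \<open>The span of \<open>\<partial>\<^sub>m, \<dots>, \<partial>\<^sub>n\<close> and \<open>\<kappa>\<^sub>2\<^sup>m\<close>, which will be the value of \<open>D\<^sup>(\<^sup>n\<^sup>-\<^sup>m\<^sup>)\<close>.\<close>
definition kr_space :: "prolongation list \<Rightarrow> nat \<Rightarrow> real ^ 'n::{finite,linorder} \<Rightarrow> (real, 'n) vec set" where
  "kr_space ps m z = {v. \<exists>f. v - f *\<^sub>R kappa2 ps m z \<in> vert m}"

lemma subspace_vert: "subspace (vert m)" unfolding vert_def by (auto intro!: subspaceI)

lemma vert_mono: "m \<le> k \<Longrightarrow> vert k \<subseteq> vert m" by (auto simp: vert_def)

lemma pd_vert: "m \<le> k \<Longrightarrow> k \<in> {1..CARD('n)} \<Longrightarrow> (pd k :: real ^ 'n::{finite,linorder}) \<in> vert m"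
  using crd_pd[where 'n='n] by (auto simp: vert_def)

lemma subspace_kr_space: "subspace (kr_space ps m z)"
proof (rule subspaceI)
  show "0 \<in> kr_space ps m z" unfolding kr_space_def
    by (intro CollectI exI[of _ 0]) (simp add: subspace_0[OF subspace_vert])
next
  fix x y assume "x \<in> kr_space ps m z" "y \<in> kr_space ps m z"
  then obtain f g where "x - f *\<^sub>R kappa2 ps m z \<in> vert m" "y - g *\<^sub>R kappa2 ps m z \<in> vert m" by (auto simp: kr_space_def)
  from subspace_add[OF subspace_vert this] show "x + y \<in> kr_space ps m z" unfolding kr_space_def
    by (intro CollectI exI[of _ "f + g"]) (simp add: algebra_simps)
next
  fix c x assume "x \<in> kr_space ps m z"
  then obtain f where "x - f *\<^sub>R kappa2 ps m z \<in> vert m" by (auto simp: kr_space_def)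
  from subspace_scale[OF subspace_vert this, of c] show "c *\<^sub>R x \<in> kr_space ps m z" unfolding kr_space_def
    by (intro CollectI exI[of _ "c * f"]) (simp add: algebra_simps)
qed

lemma vert_kr_space: "vert m \<subseteq> kr_space ps m z"
  unfolding kr_space_def by (intro subsetI CollectI exI[of _ 0]) simp

lemma kappa2_kr_space: "kappa2 ps m z \<in> kr_space ps m z"
  unfolding kr_space_def by (intro CollectI exI[of _ 1]) (simp add: subspace_0[OF subspace_vert])

lemma kappa2_not_vert:
  assumes "3 \<le> m" "m \<le> CARD('n)"
  shows "kappa2 ps m (z :: real ^ 'n::{finite,linorder}) \<notin> vert m"
  using assms
proof (induction m rule: nat_induct_at_least)
  case base
  have "crd 1 (kappa2 ps 3 z) = 1" using crd_pd[where 'n='n] base by (simp add: kappa2_3)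
  then show ?case by (auto simp: vert_def intro!: bexI[of _ 1])
next
  case (Suc m)
  show ?case
  proof
    let ?a = "coef1 ps (Suc m) z" and ?b = "coef2 ps (Suc m) z"
    assume a: "kappa2 ps (Suc m) z \<in> vert (Suc m)"
    have pm: "(pd m :: (real, 'n) vec) \<in> vert m" using Suc by (intro pd_vert) auto
    have "kappa2 ps (Suc m) z \<in> vert m" using a vert_mono[of m "Suc m"] by auto
    then have "kappa2 ps (Suc m) z - ?a *\<^sub>R pd m \<in> vert m"
      using pm by (intro subspace_diff subspace_scale subspace_vert)
    then have "?b *\<^sub>R kappa2 ps m z \<in> vert m" using Suc.hyps by (simp add: kappa2_Suc)
    then have b: "?b = 0"
      using subspace_scale[OF subspace_vert, of "?b *\<^sub>R kappa2 ps m z" m "1 / ?b"] Suc by (auto split: if_splits)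
    then have "crd m (kappa2 ps (Suc m) z) = ?a" using Suc crd_pd[where 'n='n, of m m] by (simp add: kappa2_Suc)
    moreover have "crd m (kappa2 ps (Suc m) z) = 0" using a Suc by (auto simp: vert_def)
    ultimately show False using coef_nonzero[of ps "Suc m" z] b by simp
  qed
qed

text \<open>\<open>\<kappa>\<^sub>1\<^sup>m\<close> and \<open>\<kappa>\<^sub>2\<^sup>m\<close> stay independent modulo the later coordinate fields. Every comparison of
  coefficients below rests on this.\<close>
lemma kappa2_pd_independent:
  assumes m: "3 \<le> m" "m \<le> CARD('n)"
    and v: "x *\<^sub>R pd m + y *\<^sub>R kappa2 ps m (z :: real ^ 'n::{finite,linorder}) \<in> vert (Suc m)"
  shows "x = 0" "y = 0"
proof -
  have pm: "(pd m :: (real, 'n) vec) \<in> vert m" using m by (intro pd_vert) auto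
  have "x *\<^sub>R pd m + y *\<^sub>R kappa2 ps m z - x *\<^sub>R pd m \<in> vert m"
    using pm v vert_mono[of m "Suc m"] by (intro subspace_diff subspace_scale subspace_vert) auto
  then have "y *\<^sub>R kappa2 ps m z \<in> vert m" by simp
  then show y: "y = 0"
    using subspace_scale[OF subspace_vert, of "y *\<^sub>R kappa2 ps m z" m "1 / y"] kappa2_not_vert[OF m, of ps z] by (auto split: if_splits)
  have "crd m (x *\<^sub>R pd m + y *\<^sub>R kappa2 ps m z) = 0" using v m by (auto simp: vert_def)
  then show "x = 0" using y crd_pd[where 'n='n, of m m] m by simp
qed

lemma vert_split:
  assumes "m \<in> {1..CARD('n)}" "(v :: real ^ 'n::{finite,linorder}) \<in> vert m"
  shows "v - crd m v *\<^sub>R pd m \<in> vert (Suc m)"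
  using assms crd_pd[where 'n='n] by (auto simp: vert_def less_Suc_eq)

text \<open>For \<open>m \<ge> 4\<close>, \<open>\<kappa>\<^sub>2\<^sup>m\<close> and \<open>kdir ps m\<close> are two combinations of \<open>\<kappa>\<^sub>1\<^sup>m\<^sup>-\<^sup>1\<close> and \<open>\<kappa>\<^sub>2\<^sup>m\<^sup>-\<^sup>1\<close> with determinant
  \<open>\<plusminus>1\<close>; so the flag grows at each step.\<close>
lemma kdir_not_kr_space:
  assumes m: "3 \<le> m" "m \<le> CARD('n)"
  shows "kdir ps m (z :: real ^ 'n::{finite,linorder}) \<notin> kr_space ps m z"
proof
  assume "kdir ps m z \<in> kr_space ps m z"
  then obtain f where f: "kdir ps m z - f *\<^sub>R kappa2 ps m z \<in> vert m" by (auto simp: kr_space_def)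
  show False
  proof (cases "m = 3")
    case True
    then have "crd 1 (pd 2 - f *\<^sub>R (crd 3 z *\<^sub>R pd 2 + pd 1 :: (real, 'n) vec)) = 0"
        "crd 2 (pd 2 - f *\<^sub>R (crd 3 z *\<^sub>R pd 2 + pd 1 :: (real, 'n) vec)) = 0"
      using f by (auto simp: kdir_def kappa2_3 vert_def)
    then show False using crd_pd[where 'n='n] m by auto
  next
    case False
    define k where "k = m - 1"
    have k: "3 \<le> k" "m = Suc k" "k \<le> CARD('n)" using m False by (auto simp: k_def)
    have km: "kappa2 ps m z = coef1 ps m z *\<^sub>R pd k + coef2 ps m z *\<^sub>R kappa2 ps k z" using kappa2_Suc[OF k(1)] k by simp
    show False
    proof (cases "ps ! (m - 4)")
      case (Reg c)
      have "(1 - f * coef1 ps m z) *\<^sub>R pd k + (- f) *\<^sub>R kappa2 ps k z \<in> vert (Suc k)"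
        using f k Reg False unfolding km by (simp add: kdir_def coef2_def algebra_simps)
      from kappa2_pd_independent[OF k(1,3) this] show False by simp
    next
      case Sing
      have "(- f) *\<^sub>R pd k + (1 - f * coef2 ps m z) *\<^sub>R kappa2 ps k z \<in> vert (Suc k)"
        using f k Sing False unfolding km by (simp add: kdir_def coef1_def algebra_simps)
      from kappa2_pd_independent[OF k(1,3) this] show False by simp
    qed
  qed
qed

text \<open>The same determinant shows that \<open>\<kappa>\<^sub>1\<^sup>m\<^sup>-\<^sup>1\<close> and \<open>\<kappa>\<^sub>2\<^sup>m\<^sup>-\<^sup>1\<close> are recovered from \<open>\<kappa>\<^sub>2\<^sup>m\<close> and
  \<open>kdir ps m\<close>.\<close>
lemma kr_space_step:
  assumes m: "4 \<le> m" "m \<le> CARD('n)"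
  shows "kr_space ps (m - 1) (z :: real ^ 'n::{finite,linorder}) = {v. \<exists>c. v - c *\<^sub>R kdir ps m z \<in> kr_space ps m z}"
proof -
  define k where "k = m - 1"
  have k: "3 \<le> k" "m = Suc k" "k \<le> CARD('n)" using m by (auto simp: k_def)
  have km: "kappa2 ps m z = coef1 ps m z *\<^sub>R pd k + coef2 ps m z *\<^sub>R kappa2 ps k z" using kappa2_Suc[OF k(1)] k by simp
  have kd: "kdir ps m z = (case ps ! (m - 4) of Reg c \<Rightarrow> pd k | Sing \<Rightarrow> kappa2 ps k z)" using k by (simp add: kdir_def split: prolongation.split)
  have pk: "(pd k :: (real, 'n) vec) \<in> vert k" using k by (intro pd_vert) auto
  note sub = subspace_kr_space[of ps k z] and subm = subspace_kr_space[of ps m z]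
  have in_k: "pd k \<in> kr_space ps k z" "kappa2 ps k z \<in> kr_space ps k z" using pk vert_kr_space kappa2_kr_space by blast+
  then have kd_in: "kdir ps m z \<in> kr_space ps k z" by (simp add: kd split: prolongation.split)
  have km_in: "kappa2 ps m z \<in> kr_space ps k z" unfolding km using in_k by (intro subspace_add subspace_scale sub)
  have sub1: "kr_space ps m z \<subseteq> kr_space ps k z"
  proof
    fix v assume "v \<in> kr_space ps m z"
    then obtain f where "v - f *\<^sub>R kappa2 ps m z \<in> vert m" by (auto simp: kr_space_def)
    then have "v - f *\<^sub>R kappa2 ps m z \<in> kr_space ps k z" using vert_mono[of k m] vert_kr_space[of k ps z] k by auto
    from subspace_add[OF sub this subspace_scale[OF sub km_in, of f]] show "v \<in> kr_space ps k z" by simp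
  qed
  define M where "M = {v. \<exists>c. v - c *\<^sub>R kdir ps m z \<in> kr_space ps m z}"
  have MI: "v \<in> M" if "v - c *\<^sub>R kdir ps m z \<in> kr_space ps m z" for v c using that by (auto simp: M_def)
  have sM: "subspace M"
  proof (rule subspaceI)
    show "0 \<in> M" by (rule MI[of _ 0]) (simp add: subspace_0[OF subm])
    show "x + y \<in> M" if "x \<in> M" "y \<in> M" for x y
    proof -
      obtain c d where "x - c *\<^sub>R kdir ps m z \<in> kr_space ps m z" "y - d *\<^sub>R kdir ps m z \<in> kr_space ps m z" using \<open>x \<in> M\<close> \<open>y \<in> M\<close> by (auto simp: M_def)
      from subspace_add[OF subm this] show ?thesis by (intro MI[of _ "c + d"]) (simp add: algebra_simps)
    qed
    show "a *\<^sub>R x \<in> M" if "x \<in> M" for x a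
    proof -
      obtain c where "x - c *\<^sub>R kdir ps m z \<in> kr_space ps m z" using \<open>x \<in> M\<close> by (auto simp: M_def)
      from subspace_scale[OF subm this, of a] show ?thesis by (intro MI[of _ "a * c"]) (simp add: algebra_simps)
    qed
  qed
  have M1: "kr_space ps m z \<subseteq> M" using MI[of _ 0] by auto
  have M2: "kdir ps m z \<in> M" by (rule MI[of _ 1]) (simp add: subspace_0[OF subm])
  have M3: "kappa2 ps m z \<in> M" using M1 kappa2_kr_space by blast
  have M4: "pd k \<in> M \<and> kappa2 ps k z \<in> M"
  proof (cases "ps ! (m - 4)")
    case (Reg c)
    have 1: "pd k \<in> M" using M2 Reg by (simp add: kd)
    from subspace_diff[OF sM M3 subspace_scale[OF sM 1, of "coef1 ps m z"]] 1 Reg show ?thesis by (simp add: km coef2_def)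
  next
    case Sing
    have 1: "kappa2 ps k z \<in> M" using M2 Sing by (simp add: kd)
    from subspace_diff[OF sM M3 subspace_scale[OF sM 1, of "coef2 ps m z"]] 1 Sing show ?thesis by (simp add: km coef1_def)
  qed
  have "kr_space ps k z \<subseteq> M"
  proof
    fix v assume "v \<in> kr_space ps k z"
    then obtain f where f: "v - f *\<^sub>R kappa2 ps k z \<in> vert k" (is "?w \<in> _") by (auto simp: kr_space_def)
    then have "?w - crd k ?w *\<^sub>R pd k \<in> vert m" using vert_split[of k ?w] k by auto
    then have "?w - crd k ?w *\<^sub>R pd k \<in> M" using M1 vert_kr_space by blast
    from subspace_add[OF sM this subspace_scale[OF sM conjunct1[OF M4], of "crd k ?w"]]
    have "?w \<in> M" by simp
    from subspace_add[OF sM this subspace_scale[OF sM conjunct2[OF M4], of f]] show "v \<in> M" by simp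
  qed
  moreover have "M \<subseteq> kr_space ps k z"
  proof
    fix v assume "v \<in> M"
    then obtain c where "v - c *\<^sub>R kdir ps m z \<in> kr_space ps m z" by (auto simp: M_def)
    then have "v - c *\<^sub>R kdir ps m z \<in> kr_space ps k z" using sub1 by blast
    from subspace_add[OF sub this subspace_scale[OF sub kd_in, of c]] show "v \<in> kr_space ps k z" by simp
  qed
  ultimately show ?thesis unfolding M_def k_def by blast
qed

lemma kr_space_Suc_subset:
  assumes "4 \<le> m" "m \<le> CARD('n)"
  shows "kr_space ps m (z :: real ^ 'n::{finite,linorder}) \<subseteq> kr_space ps (m - 1) z"
  unfolding kr_space_step[OF assms] by (intro subsetI CollectI exI[of _ 0]) simp

lemma vert_eq_span:
  assumes "1 \<le> m" shows "(vert m :: (real ^ 'n::{finite,linorder}) set) = span (pd ` {m..CARD('n)})"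
proof
  show "(vert m :: (real, 'n) vec set) \<subseteq> span (pd ` {m..CARD('n)})"
  proof
    fix v :: "(real, 'n) vec" assume v: "v \<in> vert m"
    have "v = (\<Sum>j\<in>{m..CARD('n)}. crd j v *\<^sub>R pd j)"
    proof (rule crd_eqI)
      fix k assume k: "k \<in> {1..CARD('n)}"
      show "crd k v = crd k (\<Sum>j\<in>{m..CARD('n)}. crd j v *\<^sub>R (pd j :: (real, 'n) vec))"
        using sum_crd_pd[where 'n='n, OF k, of "{m..CARD('n)}" "\<lambda>j. crd j v"] v k assms by (auto simp: vert_def)
    qed
    moreover have "(\<Sum>j\<in>{m..CARD('n)}. crd j v *\<^sub>R (pd j :: (real, 'n) vec)) \<in> span (pd ` {m..CARD('n)})"
      by (intro span_sum span_scale span_base) auto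
    ultimately show "v \<in> span (pd ` {m..CARD('n)})" by simp
  qed
  show "span (pd ` {m..CARD('n)}) \<subseteq> (vert m :: (real, 'n) vec set)"
    by (rule span_minimal[OF _ subspace_vert]) (use assms pd_vert[where 'n='n] in auto)
qed

lemma inj_pd: "inj_on (pd :: nat \<Rightarrow> real ^ 'n::{finite,linorder}) {1..CARD('n)}"
  using crd_pd[where 'n='n] by (intro inj_onI) (metis zero_neq_one)

lemma independent_pd: "independent ((pd :: nat \<Rightarrow> real ^ 'n::{finite,linorder}) ` {1..CARD('n)})"
proof (rule independent_if_scalars_zero)
  fix f :: "(real, 'n) vec \<Rightarrow> real" and x :: "(real, 'n) vec"
  assume s: "(\<Sum>v\<in>pd ` {1..CARD('n)}. f v *\<^sub>R v) = 0" and x: "x \<in> pd ` {1..CARD('n)}"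
  obtain k where k: "k \<in> {1..CARD('n)}" "x = pd k" using x by blast
  have "(\<Sum>j\<in>{1..CARD('n)}. f (pd j) *\<^sub>R (pd j :: (real, 'n) vec)) = 0" using s unfolding sum.reindex[OF inj_pd[where 'n='n]] o_def .
  then have "crd k (\<Sum>j\<in>{1..CARD('n)}. f (pd j) *\<^sub>R (pd j :: (real, 'n) vec)) = 0" by simp
  then have "(\<Sum>j\<in>{1..CARD('n)}. f (pd j) * crd k (pd j :: (real, 'n) vec)) = 0" by simp
  then show "f x = 0" using sum_crd_pd[OF k(1) order_refl, of "\<lambda>j. f (pd j)"] k by simp
qed simp

lemma dim_vert:
  assumes "1 \<le> m" shows "dim (vert m :: (real ^ 'n::{finite,linorder}) set) = CARD('n) + 1 - m"
proof -
  have sub: "{m..CARD('n)} \<subseteq> {1..CARD('n)}" using assms by auto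
  have "independent ((pd :: nat \<Rightarrow> (real, 'n) vec) ` {m..CARD('n)})"
    by (rule independent_mono[OF independent_pd]) (use sub in blast)
  then show ?thesis unfolding vert_eq_span[OF assms]
    using card_image[OF inj_on_subset[OF inj_pd sub]] by (simp add: dim_span dim_eq_card_independent)
qed

lemma kr_space_eq_span: "kr_space ps m (z :: real ^ 'n::{finite,linorder}) = span (insert (kappa2 ps m z) (vert m))"
proof -
  have "span (vert m) = (vert m :: (real, 'n) vec set)" by (rule span_eq_iff[THEN iffD2, OF subspace_vert])
  then show ?thesis unfolding kr_space_def span_insert by (simp only:)
qed

lemma dim_kr_space:
  assumes "3 \<le> m" "m \<le> CARD('n)"
  shows "dim (kr_space ps m (z :: real ^ 'n::{finite,linorder})) = CARD('n) + 2 - m"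
proof -
  have "kappa2 ps m z \<notin> span (vert m)"
    using kappa2_not_vert[OF assms] subspace_vert span_eq_iff by metis
  then show ?thesis using assms dim_vert[where 'n='n, of m] dim_insert[of "kappa2 ps m z" "vert m"]
    by (simp add: kr_space_eq_span dim_span)
qed

section \<open>The flag and the characteristic subdistributions of a Kumpera-Ruiz normal form\<close>

definition kr_distribution :: "prolongation list \<Rightarrow> real ^ 'n::{finite,linorder} \<Rightarrow> (real, 'n) vec tvec set" where
  "kr_distribution ps z = dir_tvec z ` kr_space ps CARD('n) z"

lemma section_on_euclidE:
  assumes X: "section_on euclid D W X" and D: "\<And>r. r \<in> W \<Longrightarrow> D r = dir_tvec r ` P r"
  obtains S where "open W" "smooth_on W S" "\<And>r. r \<in> W \<Longrightarrow> X r = dir_tvec r (S r)" "\<And>r. r \<in> W \<Longrightarrow> S r \<in> P r"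
proof -
  have vf: "smooth_vf euclid W X" "\<And>r. r \<in> W \<Longrightarrow> X r \<in> D r" using X by (auto simp: section_on_def)
  obtain S where S: "smooth_on W S" "\<And>r. r \<in> W \<Longrightarrow> X r = dir_tvec r (S r)"
    by (rule smooth_vf_euclidE[OF vf(1)]) blast
  have "S r \<in> P r" if "r \<in> W" for r
    using vf(2)[OF that] S(2)[OF that] D[OF that] injD[OF inj_dir_tvec] by (metis imageE)
  moreover have "open W" using vf(1) by (simp add: smooth_vf_def)
  ultimately show ?thesis using that S by blast
qed

lemma section_on_euclidI:
  assumes "open W" "smooth_on W S" "\<And>r. r \<in> W \<Longrightarrow> dir_tvec r (S r) \<in> D r"
  shows "section_on euclid D W (\<lambda>r. dir_tvec r (S r))"
  using assms smooth_vf_euclidI[OF assms(1,2)] by (simp add: section_on_def)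

lemma derivative_in_vert:
  assumes W: "open W" "z \<in> W" and R: "(R has_derivative R') (at z)" and v: "\<And>r. r \<in> W \<Longrightarrow> R r \<in> vert m"
  shows "R' u \<in> vert m"
proof -
  have "crd k (R' u) = 0" if "k \<in> {1..<m}" for k
  proof -
    have "((\<lambda>r. crd k (R r)) has_derivative (\<lambda>u. crd k (R' u))) (at z)"
      by (rule bounded_linear.has_derivative[OF bounded_linear_crd R])
    then have "((\<lambda>r. 0) has_derivative (\<lambda>u. crd k (R' u))) (at z)"
      by (rule has_derivative_transform_within_open[OF _ W]) (use v that in \<open>auto simp: vert_def\<close>)
    then have "(\<lambda>u. crd k (R' u)) = (\<lambda>u. 0)" using has_derivative_const has_derivative_unique by blast
    then show ?thesis by (rule fun_cong)
  qed
  then show ?thesis by (simp add: vert_def)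
qed

text \<open>A section is \<open>S = \<phi> \<kappa>\<^sub>2\<^sup>m + R\<close> with \<open>R\<close> in \<open>vert m\<close>. The coefficient \<open>\<phi>\<close> is differentiable because
  \<open>vert m\<close> is orthogonal to \<open>\<kappa>\<^sub>2\<^sup>m\<close>, so that it is a quotient of inner products. Differentiating the
  decomposition, only the term \<open>\<phi> D\<kappa>\<^sub>2\<^sup>m\<close> can leave the space.\<close>
lemma kr_section_derivative:
  fixes z :: "real ^ 'n::{finite,linorder}"
  assumes m: "3 \<le> m" "m \<le> CARD('n)" and W: "open W" "z \<in> W" and S: "(S has_derivative S') (at z)"
    and v: "\<And>r. r \<in> W \<Longrightarrow> S r \<in> kr_space ps m r" and f: "S z - f *\<^sub>R kappa2 ps m z \<in> vert m"
  shows "S' u - f *\<^sub>R frechet_derivative (kappa2 ps m) (at z) u \<in> kr_space ps m z"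
proof -
  let ?L = "kappa2 ps m" and ?L' = "frechet_derivative (kappa2 ps m) (at z)"
  define \<phi> where "\<phi> = (\<lambda>r. (S r \<bullet> ?L r) / (?L r \<bullet> ?L r))"
  have L0: "?L r \<bullet> ?L r \<noteq> 0" for r :: "(real, 'n) vec"
  proof
    assume "?L r \<bullet> ?L r = 0"
    then have "?L r \<in> vert m" by (simp add: subspace_0[OF subspace_vert])
    then show False using kappa2_not_vert[OF m] by blast
  qed
  have orth: "x \<bullet> ?L r = 0" if "x \<in> vert m" for x r :: "(real, 'n) vec"
    unfolding inner_crd
  proof (rule sum.neutral, rule ballI)
    fix k assume k: "k \<in> {1..CARD('n)}"
    show "crd k x * crd k (?L r) = 0"
      using k that kappa2_crd_high[where 'n='n, OF m(1), of k] by (cases "k < m") (auto simp: vert_def)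
  qed
  have coef: "\<phi> r = h" if "S r - h *\<^sub>R ?L r \<in> vert m" for r h
    using orth[OF that, of r] L0[of r] by (simp add: \<phi>_def inner_diff_left divide_simps)
  have R: "S r - \<phi> r *\<^sub>R ?L r \<in> vert m" if "r \<in> W" for r
    using v[OF that] coef by (auto simp: kr_space_def)
  have D: "(?L has_derivative ?L') (at z)" by (rule has_derivative_kappa2[OF m(1)])
  obtain \<phi>' where \<phi>': "(\<phi> has_derivative \<phi>') (at z)"
    using has_derivative_divide[OF has_derivative_inner[OF S D] has_derivative_inner[OF D D] L0] unfolding \<phi>_def by blast
  have "((\<lambda>r. S r - \<phi> r *\<^sub>R ?L r) has_derivative (\<lambda>u. S' u - (\<phi> z *\<^sub>R ?L' u + \<phi>' u *\<^sub>R ?L z))) (at z)"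
    by (intro has_derivative_diff has_derivative_scaleR S D \<phi>')
  from derivative_in_vert[OF W this R] have "S' u - (\<phi> z *\<^sub>R ?L' u + \<phi>' u *\<^sub>R ?L z) \<in> vert m" .
  then show ?thesis unfolding kr_space_def
    by (intro CollectI exI[of _ "\<phi>' u"]) (simp add: coef[OF f] algebra_simps)
qed

text \<open>Brackets modulo the space itself depend only on the values of the two sections at the point, and
  they are governed by the single direction \<open>kdir ps m z\<close>. This formula computes the flag and the
  characteristic subdistributions.\<close>
lemma kr_bracket:
  fixes z :: "real ^ 'n::{finite,linorder}"
  assumes m: "3 \<le> m" "m \<le> CARD('n)" and W: "open W" "z \<in> W"
    and S: "smooth_on W S" "\<And>r. r \<in> W \<Longrightarrow> S r \<in> kr_space ps m r" "S z - f *\<^sub>R kappa2 ps m z \<in> vert m"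
    and T: "smooth_on W T" "\<And>r. r \<in> W \<Longrightarrow> T r \<in> kr_space ps m r" "T z - g *\<^sub>R kappa2 ps m z \<in> vert m"
  shows "frechet_derivative T (at z) (S z) - frechet_derivative S (at z) (T z)
     - (g * crd m (S z) - f * crd m (T z)) *\<^sub>R kdir ps m z \<in> kr_space ps m z"
proof -
  let ?L = "kappa2 ps m z" and ?L' = "frechet_derivative (kappa2 ps m) (at z)"
  have lin: "linear ?L'"
    by (rule linear_frechet_derivative) (use has_derivative_kappa2[OF m(1)] in \<open>auto simp: differentiable_def\<close>)
  have Lv: "?L' x = h *\<^sub>R ?L' ?L + crd m x *\<^sub>R kdir ps m z" if x: "x - h *\<^sub>R ?L \<in> vert m" for x h
  proof -
    have "?L' (x - h *\<^sub>R ?L) = crd m (x - h *\<^sub>R ?L) *\<^sub>R kdir ps m z"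
      by (rule derivative_kappa2_vert[OF m(1)]) (use x in \<open>auto simp: vert_def\<close>)
    moreover have "crd m ?L = 0" using m by (intro kappa2_crd_high) auto
    ultimately show ?thesis by (simp add: linear_diff[OF lin] linear_scale[OF lin] algebra_simps)
  qed
  have "frechet_derivative T (at z) (S z) - g *\<^sub>R ?L' (S z) \<in> kr_space ps m z"
    by (rule kr_section_derivative[OF m W smooth_on_has_derivative[OF T(1) W(2)] T(2,3)])
  moreover have "frechet_derivative S (at z) (T z) - f *\<^sub>R ?L' (T z) \<in> kr_space ps m z"
    by (rule kr_section_derivative[OF m W smooth_on_has_derivative[OF S(1) W(2)] S(2,3)])
  ultimately have "frechet_derivative T (at z) (S z) - g *\<^sub>R ?L' (S z) - (frechet_derivative S (at z) (T z) - f *\<^sub>R ?L' (T z)) \<in> kr_space ps m z"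
    by (rule subspace_diff[OF subspace_kr_space])
  then show ?thesis unfolding Lv[OF S(3)] Lv[OF T(3)] by (simp add: algebra_simps)
qed

text \<open>By \<open>kr_bracket\<close> brackets add at most the direction \<open>kdir ps m z\<close>, and the bracket of \<open>\<partial>\<^sub>m\<close> and
  \<open>\<kappa>\<^sub>2\<^sup>m\<close> is that direction.\<close>
lemma derived_kr:
  fixes z :: "real ^ 'n::{finite,linorder}"
  assumes D: "\<And>r. D r = dir_tvec r ` kr_space ps m r" and m: "4 \<le> m" "m \<le> CARD('n)"
  shows "derived euclid D z = dir_tvec z ` kr_space ps (m - 1) z"
proof -
  have m3: "3 \<le> m" using m by simp
  let ?B = "{lie_bracket euclid X Y z |X Y W. z \<in> W \<and> section_on euclid D W X \<and> section_on euclid D W Y}"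
  let ?G = "dir_tvec z ` kr_space ps (m - 1) z"
  have subG: "tv.span ?G = ?G" unfolding span_dir_tvec using span_eq_iff subspace_kr_space by metis
  have "?B \<subseteq> ?G"
  proof
    fix v assume "v \<in> ?B"
    then obtain X Y W where v: "v = lie_bracket euclid X Y z" "z \<in> W" "section_on euclid D W X" "section_on euclid D W Y" by blast
    obtain S where S: "open W" "smooth_on W S" "\<And>r. r \<in> W \<Longrightarrow> X r = dir_tvec r (S r)" "\<And>r. r \<in> W \<Longrightarrow> S r \<in> kr_space ps m r"
      by (rule section_on_euclidE[OF v(3) D]) blast
    obtain T where T: "open W" "smooth_on W T" "\<And>r. r \<in> W \<Longrightarrow> Y r = dir_tvec r (T r)" "\<And>r. r \<in> W \<Longrightarrow> T r \<in> kr_space ps m r"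
      by (rule section_on_euclidE[OF v(4) D]) blast
    obtain f g where fg: "S z - f *\<^sub>R kappa2 ps m z \<in> vert m" "T z - g *\<^sub>R kappa2 ps m z \<in> vert m"
      using S(4)[OF v(2)] T(4)[OF v(2)] by (auto simp: kr_space_def)
    have "frechet_derivative T (at z) (S z) - frechet_derivative S (at z) (T z) \<in> kr_space ps (m - 1) z"
      unfolding kr_space_step[OF m]
      by (intro CollectI exI) (rule kr_bracket[OF m3 m(2) S(1) v(2) S(2,4) fg(1) T(2,4) fg(2)])
    moreover have "v = dir_tvec z (frechet_derivative T (at z) (S z) - frechet_derivative S (at z) (T z))"
      unfolding v(1) by (rule lie_bracket_euclid[OF S(1) v(2) S(2) T(2) S(3) T(3)])
    ultimately show "v \<in> ?G" by blast
  qed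
  moreover have "D z \<subseteq> ?G" unfolding D using kr_space_Suc_subset[OF m] by blast
  ultimately have 1: "derived euclid D z \<subseteq> ?G"
    unfolding derived_def using tv.span_mono[of "D z \<union> ?B" ?G] subG by blast
  have kd: "dir_tvec z (kdir ps m z) \<in> derived euclid D z"
  proof -
    let ?X = "\<lambda>r :: (real, 'n) vec. dir_tvec r (pd m)" and ?Y = "\<lambda>r. dir_tvec r (kappa2 ps m r)"
    have pm: "(pd m :: (real, 'n) vec) \<in> vert m" using m by (intro pd_vert) auto
    have sX: "section_on euclid D UNIV ?X"
      by (rule section_on_euclidI[OF open_UNIV smooth_on_const]) (use pm vert_kr_space D in blast)
    have sY: "section_on euclid D UNIV ?Y"
      by (rule section_on_euclidI[OF open_UNIV smooth_kappa2[OF m3]]) (use kappa2_kr_space D in blast)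
    have "lie_bracket euclid ?X ?Y z = dir_tvec z (frechet_derivative (kappa2 ps m) (at z) (pd m) - frechet_derivative (\<lambda>r. pd m) (at z) (kappa2 ps m z))"
      by (rule lie_bracket_euclid[OF open_UNIV UNIV_I smooth_on_const smooth_kappa2[OF m3] refl refl])
    also have "frechet_derivative (kappa2 ps m) (at z) (pd m) = kdir ps m z"
      using derivative_kappa2_vert[OF m3, of "pd m" ps z] pm crd_pd[where 'n='n, of m m] m by (auto simp: vert_def)
    finally have "dir_tvec z (kdir ps m z) = lie_bracket euclid ?X ?Y z" by simp
    then show ?thesis unfolding derived_def using sX sY by (intro tv.span_base UnI2 CollectI) blast
  qed
  have "?G \<subseteq> derived euclid D z"
  proof
    fix v assume "v \<in> ?G"
    then obtain a where a: "v = dir_tvec z a" "a \<in> kr_space ps (m - 1) z" by blast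
    then obtain c where c: "a - c *\<^sub>R kdir ps m z \<in> kr_space ps m z" unfolding kr_space_step[OF m] by blast
    have "dir_tvec z (a - c *\<^sub>R kdir ps m z) \<in> derived euclid D z"
      unfolding derived_def D using c by (intro tv.span_base UnI1) blast
    moreover have "tv_scale c (dir_tvec z (kdir ps m z)) \<in> derived euclid D z"
      using kd tv.span_scale unfolding derived_def by blast
    ultimately have "dir_tvec z (a - c *\<^sub>R kdir ps m z) + tv_scale c (dir_tvec z (kdir ps m z)) \<in> derived euclid D z"
      unfolding derived_def by (rule tv.span_add)
    then show "v \<in> derived euclid D z"
      using linear_dir_tvec[of z] unfolding a Vector_Spaces.linear_iff by (metis diff_add_cancel)
  qed
  then show ?thesis using 1 by blast
qed

lemma flag_kr:
  fixes z :: "real ^ 'n::{finite,linorder}"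
  assumes "i + 3 \<le> CARD('n)"
  shows "flag euclid (kr_distribution ps) i z = dir_tvec z ` kr_space ps (CARD('n) - i) z"
  using assms
proof (induction i arbitrary: z)
  case 0 then show ?case by (simp add: flag_def kr_distribution_def)
next
  case (Suc i)
  have "flag euclid (kr_distribution ps) (Suc i) z = derived euclid (flag euclid (kr_distribution ps) i) z"
    by (simp add: flag_def)
  also have "\<dots> = dir_tvec z ` kr_space ps (CARD('n) - i - 1) z"
    by (rule derived_kr) (use Suc in auto)
  finally show ?case by simp
qed

lemma dim_flag_kr:
  fixes z :: "real ^ 'n::{finite,linorder}"
  assumes "i + 3 \<le> CARD('n)"
  shows "tv.dim (flag euclid (kr_distribution ps) i z) = i + 2"
  unfolding flag_kr[OF assms] dim_dir_tvec[OF subspace_kr_space] using assms by (simp add: dim_kr_space)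

lemma char_subdistribution_kr:
  assumes i: "i + 4 \<le> CARD('n)"
  shows "char_subdistribution_on euclid (kr_distribution ps) i UNIV
    (\<lambda>z :: real ^ 'n::{finite,linorder}. dir_tvec z ` vert (CARD('n) - i))"
proof -
  let ?m = "CARD('n) - i"
  have m: "4 \<le> ?m" "?m \<le> CARD('n)" "3 \<le> ?m - 1" "?m - 1 \<le> CARD('n)" "1 \<le> ?m" using i by auto
  have img: "(\<lambda>j. pd (?m + j) :: (real, 'n) vec) ` {..<i + 1} = pd ` {?m..CARD('n)}"
  proof -
    have "(\<lambda>j. ?m + j) ` {..<i + 1} = {?m..CARD('n)}"
    proof (intro equalityI subsetI)
      fix k assume "k \<in> {?m..CARD('n)}"
      then show "k \<in> (\<lambda>j. ?m + j) ` {..<i + 1}" using i by (intro image_eqI[of _ _ "k - ?m"]) auto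
    qed (use i in auto)
    then show ?thesis by (metis image_image)
  qed
  have dv: "tv.dim (dir_tvec z ` vert ?m) = i + 1" for z :: "(real, 'n) vec"
    unfolding dim_dir_tvec[OF subspace_vert] dim_vert[OF m(5)] using i by simp
  have "distribution_on euclid (i + 1) UNIV (\<lambda>z :: (real, 'n) vec. dir_tvec z ` vert ?m)"
    unfolding distribution_on_def
  proof (intro conjI ballI open_UNIV)
    fix q :: "(real, 'n) vec"
    have "dir_tvec r ` vert ?m = tv.span ((\<lambda>j. dir_tvec r (pd (?m + j))) ` {..<i + 1})" for r :: "(real, 'n) vec"
      unfolding vert_eq_span[OF m(5)] span_dir_tvec[symmetric] img[symmetric] image_image ..
    moreover have "smooth_vf euclid UNIV (\<lambda>r :: (real, 'n) vec. dir_tvec r (pd (?m + j)))" for j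
      by (rule smooth_vf_euclidI[OF open_UNIV smooth_on_const refl])
    ultimately show "\<exists>V X. q \<in> V \<and> V \<subseteq> UNIV \<and> (\<forall>j<i + 1. smooth_vf euclid V (X j)) \<and> open V \<and>
      (\<forall>r\<in>V. dir_tvec r ` vert ?m = tv.span ((\<lambda>j. X j r) ` {..<i + 1}) \<and> tv.dim (dir_tvec r ` vert ?m) = i + 1)"
      using dv by (intro exI[of _ UNIV] exI[of _ "\<lambda>j r. dir_tvec r (pd (?m + j))"]) simp
  qed
  note dist = this
  show ?thesis unfolding char_subdistribution_on_def
  proof (intro conjI allI impI exI[of _ "i + 1"] dist)
    have "i + 3 \<le> CARD('n)" using i by simp
    note fl = flag_kr[OF this, of ps] dim_flag_kr[OF this, of ps]
    show "\<forall>q :: (real, 'n) vec\<in>UNIV. dir_tvec q ` vert ?m \<subseteq> flag euclid (kr_distribution ps) i q \<and>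
      tv.dim (flag euclid (kr_distribution ps) i q) = i + 1 + 1"
      using fl(2) by (simp add: fl(1) image_mono vert_kr_space)
  next
    fix V :: "(real, 'n) vec set" and X Y
    assume a: "V \<subseteq> UNIV \<and> section_on euclid (\<lambda>z. dir_tvec z ` vert ?m) V X \<and> section_on euclid (\<lambda>z. dir_tvec z ` vert ?m) V Y"
    show "\<forall>q\<in>V. lie_bracket euclid X Y q \<in> dir_tvec q ` vert ?m"
    proof
      fix q assume q: "q \<in> V"
      obtain S where S: "open V" "smooth_on V S" "\<And>r. r \<in> V \<Longrightarrow> X r = dir_tvec r (S r)" "\<And>r. r \<in> V \<Longrightarrow> S r \<in> vert ?m"
        by (rule section_on_euclidE[OF conjunct1[OF conjunct2[OF a]] refl]) blast
      obtain T where T: "open V" "smooth_on V T" "\<And>r. r \<in> V \<Longrightarrow> Y r = dir_tvec r (T r)" "\<And>r. r \<in> V \<Longrightarrow> T r \<in> vert ?m"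
        by (rule section_on_euclidE[OF conjunct2[OF conjunct2[OF a]] refl]) blast
      have "frechet_derivative T (at q) (S q) - frechet_derivative S (at q) (T q) \<in> vert ?m"
        by (intro subspace_diff subspace_vert derivative_in_vert[OF S(1) q smooth_on_has_derivative[OF S(2) q]]
            derivative_in_vert[OF S(1) q smooth_on_has_derivative[OF T(2) q]] S T)
      moreover have "lie_bracket euclid X Y q = dir_tvec q (frechet_derivative T (at q) (S q) - frechet_derivative S (at q) (T q))"
        by (rule lie_bracket_euclid[OF S(1) q S(2) T(2) S(3) T(3)])
      ultimately show "lie_bracket euclid X Y q \<in> dir_tvec q ` vert ?m" by blast
    qed
  next
    fix V :: "(real, 'n) vec set" and X Y
    assume a: "V \<subseteq> UNIV \<and> section_on euclid (\<lambda>z. dir_tvec z ` vert ?m) V X \<and> section_on euclid (flag euclid (kr_distribution ps) (i + 1)) V Y"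
    have i1: "i + 1 + 3 \<le> CARD('n)" using i by simp
    show "\<forall>q\<in>V. lie_bracket euclid X Y q \<in> flag euclid (kr_distribution ps) (i + 1) q"
    proof
      fix q assume q: "q \<in> V"
      obtain S where S: "open V" "smooth_on V S" "\<And>r. r \<in> V \<Longrightarrow> X r = dir_tvec r (S r)" "\<And>r. r \<in> V \<Longrightarrow> S r \<in> vert ?m"
        by (rule section_on_euclidE[OF conjunct1[OF conjunct2[OF a]] refl]) blast
      obtain T where T: "open V" "smooth_on V T" "\<And>r. r \<in> V \<Longrightarrow> Y r = dir_tvec r (T r)" "\<And>r. r \<in> V \<Longrightarrow> T r \<in> kr_space ps (CARD('n) - (i + 1)) r"
        by (rule section_on_euclidE[OF conjunct2[OF conjunct2[OF a]] flag_kr[OF i1]]) blast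
      have e: "CARD('n) - (i + 1) = ?m - 1" by simp
      have vm: "vert ?m \<subseteq> (vert (?m - 1) :: (real, 'n) vec set)" by (rule vert_mono) simp
      obtain g where g: "T q - g *\<^sub>R kappa2 ps (?m - 1) q \<in> vert (?m - 1)" using T(4)[OF q] unfolding e by (auto simp: kr_space_def)
      have f: "S q - 0 *\<^sub>R kappa2 ps (?m - 1) q \<in> vert (?m - 1)" using S(4)[OF q] vm by auto
      have c: "crd (?m - 1) (S q) = 0" using S(4)[OF q] m by (auto simp: vert_def)
      have "frechet_derivative T (at q) (S q) - frechet_derivative S (at q) (T q)
          - (g * crd (?m - 1) (S q) - 0 * crd (?m - 1) (T q)) *\<^sub>R kdir ps (?m - 1) q \<in> kr_space ps (?m - 1) q"
      proof (rule kr_bracket[OF m(3,4) S(1) q S(2) _ f T(2) _ g])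
        show "S r \<in> kr_space ps (?m - 1) r" if "r \<in> V" for r
          using S(4)[OF that] vm vert_kr_space[of "?m - 1" ps r] by blast
        show "T r \<in> kr_space ps (?m - 1) r" if "r \<in> V" for r using T(4)[OF that] unfolding e .
      qed
      then have "frechet_derivative T (at q) (S q) - frechet_derivative S (at q) (T q) \<in> kr_space ps (CARD('n) - (i + 1)) q"
        unfolding c e by simp
      moreover have "lie_bracket euclid X Y q = dir_tvec q (frechet_derivative T (at q) (S q) - frechet_derivative S (at q) (T q))"
        by (rule lie_bracket_euclid[OF S(1) q S(2) T(2) S(3) T(3)])
      ultimately show "lie_bracket euclid X Y q \<in> flag euclid (kr_distribution ps) (i + 1) q"
        unfolding flag_kr[OF i1] by blast
    qed
  qed
qed

text \<open>Let a section \<open>X\<close> of a candidate have the component \<open>f\<close> along \<open>\<kappa>\<^sub>2\<^sup>m = a \<kappa>\<^sub>1\<^sup>m\<^sup>-\<^sup>1 + b \<kappa>\<^sub>2\<^sup>m\<^sup>-\<^sup>1\<close>.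
  Bracketing \<open>X\<close> with the sections \<open>\<kappa>\<^sub>1\<^sup>m\<^sup>-\<^sup>1\<close> and \<open>\<kappa>\<^sub>2\<^sup>m\<^sup>-\<^sup>1\<close> of the next bundle gives \<open>f b\<close> and
  \<open>f a\<close> times a direction outside it, so \<open>f = 0\<close>. Thus the candidate lies in \<open>vert m\<close>, and the
  dimensions agree.\<close>
lemma char_value_kr_unique:
  fixes z :: "real ^ 'n::{finite,linorder}"
  assumes i: "i + 4 \<le> CARD('n)" and V: "char_value euclid (kr_distribution ps) i z V"
  shows "V = dir_tvec z ` vert (CARD('n) - i)"
proof -
  let ?m = "CARD('n) - i"
  have m: "4 \<le> ?m" "?m \<le> CARD('n)" "3 \<le> ?m - 1" "?m - 1 \<le> CARD('n)" "1 \<le> ?m" "?m = Suc (?m - 1)" using i by auto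
  have i3: "i + 3 \<le> CARD('n)" and i1: "i + 1 + 3 \<le> CARD('n)" and e: "CARD('n) - (i + 1) = ?m - 1" using i by auto
  note fl = flag_kr[OF i3, of ps] and fl1 = flag_kr[OF i1, of ps, unfolded e]
  obtain W C where W: "z \<in> W" "char_subdistribution_on euclid (kr_distribution ps) i W C" "C z = V"
    using V by (auto simp: char_value_def)
  then obtain k where k: "distribution_on euclid k W C" and
      kk: "\<forall>q\<in>W. C q \<subseteq> flag euclid (kr_distribution ps) i q \<and> tv.dim (flag euclid (kr_distribution ps) i q) = k + 1"
    unfolding char_subdistribution_on_def by auto
  have inv2: "\<And>V X Y. V \<subseteq> W \<Longrightarrow> section_on euclid C V X \<Longrightarrow> section_on euclid (flag euclid (kr_distribution ps) (i + 1)) V Y \<Longrightarrow>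
        \<forall>q\<in>V. lie_bracket euclid X Y q \<in> flag euclid (kr_distribution ps) (i + 1) q"
    using W(2) unfolding char_subdistribution_on_def by blast
  have kval: "k = i + 1" using bspec[OF kk W(1)] dim_flag_kr[OF i3, of ps z] by simp
  from bspec[OF conjunct2[OF k[unfolded distribution_on_def]] W(1)] obtain N X where
      "z \<in> N \<and> N \<subseteq> W \<and> (\<forall>j<k. smooth_vf euclid N (X j)) \<and> open N \<and>
        (\<forall>r\<in>N. C r = tv.span ((\<lambda>j. X j r) ` {..<k}) \<and> tv.dim (C r) = k)" by (elim exE)
  then have N: "z \<in> N" "N \<subseteq> W" "open N" "\<And>j. j < k \<Longrightarrow> smooth_vf euclid N (X j)"
     "\<And>r. r \<in> N \<Longrightarrow> C r = tv.span ((\<lambda>j. X j r) ` {..<k})" "tv.dim (C z) = k"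
    by blast+
  have "X j z \<in> dir_tvec z ` vert ?m" if j: "j < k" for j
  proof -
    have secC: "section_on euclid C N (X j)" unfolding section_on_def
      using N(4)[OF j] N(5) j by (auto intro: tv.span_base)
    have "section_on euclid (flag euclid (kr_distribution ps) i) N (X j)"
      using secC kk N(2) unfolding section_on_def by blast
    then obtain S where S: "smooth_on N S" "\<And>r. r \<in> N \<Longrightarrow> X j r = dir_tvec r (S r)" "\<And>r. r \<in> N \<Longrightarrow> S r \<in> kr_space ps ?m r"
      by (rule section_on_euclidE[OF _ fl]) blast
    obtain f where f: "S z - f *\<^sub>R kappa2 ps ?m z \<in> vert ?m" (is "?R \<in> _") using S(3)[OF N(1)] by (auto simp: kr_space_def)
    let ?k = "?m - 1"
    let ?a = "coef1 ps ?m z" and ?b = "coef2 ps ?m z"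
    have km: "kappa2 ps ?m z = ?a *\<^sub>R pd ?k + ?b *\<^sub>R kappa2 ps ?k z" using kappa2_step[OF m(1)] .
    have pk: "(pd ?k :: (real, 'n) vec) \<in> vert ?k" using m by (intro pd_vert) auto
    have "?R \<in> vert ?k" by (rule subsetD[OF vert_mono f]) simp
    from subspace_add[OF subspace_vert this subspace_scale[OF subspace_vert pk, of "f * ?a"]]
    have fb: "S z - (f * ?b) *\<^sub>R kappa2 ps ?k z \<in> vert ?k" unfolding km by (simp add: algebra_simps)
    have cS: "crd ?k (S z) = f * ?a"
    proof -
      have "crd ?k ?R = 0" using f m by (auto simp: vert_def)
      moreover have "crd ?k (kappa2 ps ?k z) = 0" using m by (intro kappa2_crd_high) auto
      moreover have "crd ?k (pd ?k :: (real, 'n) vec) = 1" using crd_pd[where 'n='n, of ?k ?k] m by simp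
      ultimately show ?thesis unfolding km by simp
    qed
    have Sk: "S r \<in> kr_space ps ?k r" if "r \<in> N" for r using S(3)[OF that] kr_space_Suc_subset[OF m(1,2)] by blast
    \<comment> \<open>Here \<open>T\<close> is an arbitrary section of the next bundle; it will be \<open>\<kappa>\<^sub>1\<close> and \<open>\<kappa>\<^sub>2\<close>, with \<open>g = 0\<close> and \<open>g = 1\<close>.\<close>
    have test: "(g * crd ?k (S z) - (f * ?b) * crd ?k (T z)) *\<^sub>R kdir ps ?k z \<in> kr_space ps ?k z"
      if T: "smooth_on N T" "\<And>r. r \<in> N \<Longrightarrow> T r \<in> kr_space ps ?k r" and g: "T z - g *\<^sub>R kappa2 ps ?k z \<in> vert ?k" for T g
    proof -
      have sT: "section_on euclid (flag euclid (kr_distribution ps) (i + 1)) N (\<lambda>r. dir_tvec r (T r))"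
        by (rule section_on_euclidI[OF N(3) T(1)]) (use T(2) fl1 in blast)
      have "lie_bracket euclid (X j) (\<lambda>r. dir_tvec r (T r)) z \<in> flag euclid (kr_distribution ps) (i + 1) z"
        using inv2[OF N(2) secC sT] N(1) by blast
      moreover have "lie_bracket euclid (X j) (\<lambda>r. dir_tvec r (T r)) z =
          dir_tvec z (frechet_derivative T (at z) (S z) - frechet_derivative S (at z) (T z))"
        by (rule lie_bracket_euclid[OF N(3,1) S(1) T(1) S(2) refl])
      ultimately have "dir_tvec z (frechet_derivative T (at z) (S z) - frechet_derivative S (at z) (T z)) \<in> dir_tvec z ` kr_space ps ?k z"
        unfolding fl1 by (simp only:)
      then have b: "frechet_derivative T (at z) (S z) - frechet_derivative S (at z) (T z) \<in> kr_space ps ?k z"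
        using inj_image_mem_iff[OF inj_dir_tvec] by blast
      have "frechet_derivative T (at z) (S z) - frechet_derivative S (at z) (T z)
          - (g * crd ?k (S z) - (f * ?b) * crd ?k (T z)) *\<^sub>R kdir ps ?k z \<in> kr_space ps ?k z"
        by (rule kr_bracket[OF m(3,4) N(3,1) S(1) Sk fb T g])
      from subspace_diff[OF subspace_kr_space b this] show ?thesis by simp
    qed
    have zero: "c = 0" if "c *\<^sub>R kdir ps ?k z \<in> kr_space ps ?k z" for c
    proof (rule ccontr)
      assume "c \<noteq> 0"
      then have "kdir ps ?k z \<in> kr_space ps ?k z" using subspace_scale[OF subspace_kr_space that, of "1 / c"] by simp
      then show False using kdir_not_kr_space[OF m(3,4)] by blast
    qed
    have "0 * crd ?k (S z) - (f * ?b) * crd ?k (pd ?k :: (real, 'n) vec) = 0"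
      by (rule zero, rule test[OF smooth_on_const]) (use pk vert_kr_space in auto)
    then have 1: "f * ?b = 0" using crd_pd[where 'n='n, of ?k ?k] m by simp
    have "1 * crd ?k (S z) - (f * ?b) * crd ?k (kappa2 ps ?k z) = 0"
    proof (rule zero, rule test)
      show "smooth_on N (kappa2 ps ?k)" by (rule smooth_on_subset[OF smooth_kappa2[OF m(3)]]) simp
    qed (use kappa2_kr_space in \<open>auto simp: subspace_0[OF subspace_vert]\<close>)
    then have "f * ?a = 0" using 1 cS by simp
    then have "f = 0" using 1 coef_nonzero[of ps ?m z] by auto
    then have "S z \<in> vert ?m" using f by simp
    then show ?thesis using S(2)[OF N(1)] by simp
  qed
  then have "C z \<subseteq> tv.span (dir_tvec z ` vert ?m)" unfolding N(5)[OF N(1)] by (intro tv.span_mono) auto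
  also have "\<dots> = dir_tvec z ` vert ?m" unfolding span_dir_tvec using span_eq_iff subspace_vert by metis
  finally have sub: "C z \<subseteq> dir_tvec z ` vert ?m" .
  define Q where "Q = {a. dir_tvec z a \<in> C z}"
  have CQ: "C z = dir_tvec z ` Q" using sub by (auto simp: Q_def)
  have lin: "dir_tvec z (a + b) = dir_tvec z a + dir_tvec z b" "dir_tvec z (c *\<^sub>R a) = tv_scale c (dir_tvec z a)" for a b c
    using linear_dir_tvec[of z] unfolding Vector_Spaces.linear_iff by auto
  have Cs: "tv.subspace (C z)" unfolding N(5)[OF N(1)] by (rule tv.subspace_span)
  have "dir_tvec z 0 = 0" using lin(2)[of 0 0] by simp
  then have sQ: "subspace Q" unfolding Q_def
    by (intro subspaceI CollectI) (simp_all add: lin tv.subspace_0[OF Cs] tv.subspace_add[OF Cs] tv.subspace_scale[OF Cs])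
  have "Q \<subseteq> vert ?m" using sub CQ inj_image_subset_iff[OF inj_dir_tvec] by blast
  moreover have "dim Q = dim (vert ?m :: (real, 'n) vec set)"
    using N(6) i unfolding CQ dim_dir_tvec[OF sQ] kval dim_vert[OF m(5)] by simp
  ultimately have "Q = vert ?m" using subspace_dim_equal[OF sQ subspace_vert] by simp
  then show ?thesis using CQ W(3) by simp
qed

lemma char_value_kr:
  fixes z :: "real ^ 'n::{finite,linorder}"
  assumes "i + 4 \<le> CARD('n)"
  shows "char_value euclid (kr_distribution ps) i z V \<longleftrightarrow> V = dir_tvec z ` vert (CARD('n) - i)"
proof
  assume "V = dir_tvec z ` vert (CARD('n) - i)"
  then show "char_value euclid (kr_distribution ps) i z V"
    unfolding char_value_def using char_subdistribution_kr[OF assms, of ps] by blast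
qed (rule char_value_kr_unique[OF assms])

lemma char_space_kr:
  fixes z :: "real ^ 'n::{finite,linorder}"
  assumes "i + 4 \<le> CARD('n)"
  shows "char_space euclid (kr_distribution ps) i z = dir_tvec z ` vert (CARD('n) - i)"
  unfolding char_space_eq char_value_kr[OF assms] by simp

text \<open>Both spaces contain \<open>vert m\<close> with codimension one, and the remaining directions \<open>\<kappa>\<^sub>2\<^sup>m\<close> and
  \<open>\<partial>\<^sub>m\<^sub>-\<^sub>1\<close> are parallel modulo \<open>vert m\<close> iff the coefficient of \<open>\<kappa>\<^sub>2\<^sup>m\<^sup>-\<^sup>1\<close> vanishes.\<close>
lemma kr_space_eq_vert_iff:
  fixes z :: "real ^ 'n::{finite,linorder}"
  assumes m: "4 \<le> m" "m \<le> CARD('n)"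
  shows "kr_space ps m z = vert (m - 1) \<longleftrightarrow> coef2 ps m z = 0"
proof -
  let ?k = "m - 1"
  have k: "3 \<le> ?k" "?k \<le> CARD('n)" "m = Suc ?k" using m by auto
  have pk: "(pd ?k :: (real, 'n) vec) \<in> vert ?k" using k by (intro pd_vert) auto
  note km = kappa2_step[OF m(1), of ps z]
  show ?thesis
  proof
    assume "kr_space ps m z = vert ?k"
    then have "kappa2 ps m z \<in> vert ?k" using kappa2_kr_space by blast
    from subspace_diff[OF subspace_vert this subspace_scale[OF subspace_vert pk, of "coef1 ps m z"]]
    have "coef2 ps m z *\<^sub>R kappa2 ps ?k z \<in> vert ?k" unfolding km by simp
    from subspace_scale[OF subspace_vert this, of "1 / coef2 ps m z"] show "coef2 ps m z = 0"
      using kappa2_not_vert[OF k(1,2), of ps z] by (auto split: if_splits)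
  next
    assume b: "coef2 ps m z = 0"
    then have a: "coef1 ps m z \<noteq> 0" using coef_nonzero by blast
    have km: "kappa2 ps m z = coef1 ps m z *\<^sub>R pd ?k" using km b by simp
    show "kr_space ps m z = vert ?k"
    proof (intro equalityI subsetI)
      fix v assume "v \<in> kr_space ps m z"
      then obtain f where f: "v - f *\<^sub>R kappa2 ps m z \<in> vert m" by (auto simp: kr_space_def)
      then have "v - f *\<^sub>R kappa2 ps m z \<in> vert ?k" using vert_mono[of ?k m] by auto
      from subspace_add[OF subspace_vert this subspace_scale[OF subspace_vert pk, of "f * coef1 ps m z"]]
      show "v \<in> vert ?k" by (simp add: km)
    next
      fix v :: "(real, 'n) vec" assume "v \<in> vert ?k"
      then have "v - crd ?k v *\<^sub>R pd ?k \<in> vert m" using vert_split[of ?k v] k by auto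
      then show "v \<in> kr_space ps m z" unfolding kr_space_def km using a
        by (intro CollectI exI[of _ "crd ?k v / coef1 ps m z"]) simp
    qed
  qed
qed

lemma sing_set_kr:
  fixes z :: "real ^ 'n::{finite,linorder}"
  assumes "i + 5 \<le> CARD('n)"
  shows "z \<in> sing_set euclid (kr_distribution ps) 0 i \<longleftrightarrow> coef2 ps (CARD('n) - i) z = 0"
proof -
  have i: "i + 3 \<le> CARD('n)" "i + 1 + 4 \<le> CARD('n)" "4 \<le> CARD('n) - i" "CARD('n) - i \<le> CARD('n)"
    "CARD('n) - (i + 1) = CARD('n) - i - 1" using assms by auto
  have "z \<in> sing_set euclid (kr_distribution ps) 0 i \<longleftrightarrow> flag euclid (kr_distribution ps) i z = char_space euclid (kr_distribution ps) (i + 1) z"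
    using assms by simp
  also have "\<dots> \<longleftrightarrow> kr_space ps (CARD('n) - i) z = vert (CARD('n) - i - 1)"
    unfolding flag_kr[OF i(1)] char_space_kr[OF i(2)] i(5) by (rule inj_image_eq_iff[OF inj_dir_tvec])
  also have "\<dots> \<longleftrightarrow> coef2 ps (CARD('n) - i) z = 0" by (rule kr_space_eq_vert_iff[OF i(3,4)])
  finally show ?thesis .
qed

text \<open>The letter for \<open>i\<close> has position \<open>n - i\<close> counted from the right. It is \<open>a\<^sub>1\<close> iff \<open>0\<close> lies in the
  first singular set, that is, iff the coefficient of \<open>\<kappa>\<^sub>2\<^sup>i\<^sup>-\<^sup>1\<close> in \<open>\<kappa>\<^sub>2\<^sup>i\<close> vanishes at \<open>0\<close>; this
  coefficient is \<open>1\<close> for a regular and \<open>x\<^sub>i\<close> for a singular prolongation.\<close>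
lemma sing_type_kr:
  assumes i: "5 \<le> i" "i \<le> CARD('n)"
  shows "sing_type euclid (kr_distribution ps) (0 :: real ^ 'n::{finite,linorder}) ! (i - 4) = 1 \<longleftrightarrow> ps ! (i - 4) = Sing"
proof -
  let ?S = "sing_set euclid (kr_distribution ps :: (real, 'n) vec \<Rightarrow> _)"
  have dim: "DIM((real, 'n) vec) = CARD('n)" by simp
  have "sing_type euclid (kr_distribution ps) (0 :: (real, 'n) vec) ! (i - 4) = sing_letter euclid (kr_distribution ps) (0 :: (real, 'n) vec) (CARD('n) - i)"
    unfolding sing_type_def dim using i by (subst rev_nth) (auto intro!: arg_cong[where f = "sing_letter _ _ _"])
  moreover have "sing_letter euclid (kr_distribution ps) (0 :: (real, 'n) vec) m = 1 \<longleftrightarrow> 0 \<in> ?S 0 m" for m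
  proof -
    have "(LEAST j. 0 \<in> ?S j (m + j)) = 0 \<longleftrightarrow> 0 \<in> ?S 0 m" if "\<exists>j. 0 \<in> ?S j (m + j)"
      using LeastI_ex[OF that] by (auto intro: Least_eq_0 simp del: sing_set.simps)
    moreover have "\<exists>j. 0 \<in> ?S j (m + j)" if "0 \<in> ?S 0 m" using that by (intro exI[of _ 0]) (simp only: add_0_right)
    ultimately show ?thesis unfolding sing_letter_def by (auto simp del: sing_set.simps)
  qed
  moreover have "0 \<in> ?S 0 (CARD('n) - i) \<longleftrightarrow> ps ! (i - 4) = Sing"
    using sing_set_kr[of "CARD('n) - i" "0 :: (real, 'n) vec" ps] i
    by (simp add: coef2_def split: prolongation.splits del: sing_set.simps)
  ultimately show ?thesis by simp
qed

section \<open>Contact transformations in Kumpera-Ruiz coordinates\<close>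

lemma diffeo_pair_of_diffeo_on:
  assumes "smooth_atlas A" "smooth_atlas B" "diffeo_on A B U f"
  shows "diffeo_pair A B U (f ` U) f (inv_into U f)"
  using assms unfolding diffeo_on_def
  by unfold_locales (auto simp: inv_into_f_f f_inv_into_f inv_into_into)

lemma diffeo_pair_compose:
  assumes "diffeo_pair A B U U' \<phi> \<psi>" "diffeo_pair B C V V' \<phi>' \<psi>'"
  shows "diffeo_pair A C (U \<inter> \<phi> -` V) (V' \<inter> \<psi>' -` U') (\<phi>' \<circ> \<phi>) (\<psi> \<circ> \<psi>')"
proof -
  interpret f: diffeo_pair A B U U' \<phi> \<psi> by fact
  interpret g: diffeo_pair B C V V' \<phi>' \<psi>' by fact
  show ?thesis
    by unfold_locales
       (auto intro: smooth_map_compose[OF f.A f.B g.B f.\<phi> g.\<phi>] smooth_map_compose[OF g.B f.B f.A g.\<psi> f.\<psi>]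
         f.A g.B simp: f.img f.img' g.img g.img' f.\<psi>\<phi> f.\<phi>\<psi> g.\<psi>\<phi> g.\<phi>\<psi>)
qed

lemma transports_compose:
  assumes f: "diffeo_pair A B U U' \<phi> \<psi>" and g: "diffeo_pair B C V V' \<phi>' \<psi>'"
    and DE: "diffeo_pair.transports U \<phi> D E" and EF: "diffeo_pair.transports V \<phi>' E F"
  shows "diffeo_pair.transports (U \<inter> \<phi> -` V) (\<phi>' \<circ> \<phi>) D F"
proof -
  have push: "push_tvec (\<phi>' \<circ> \<phi>) v = push_tvec \<phi>' (push_tvec \<phi> v)" for v
    by (simp add: push_tvec_def o_assoc)
  show ?thesis
    unfolding diffeo_pair.transports_def[OF diffeo_pair_compose[OF f g]] push image_image[symmetric]
    using DE EF unfolding diffeo_pair.transports_def[OF f] diffeo_pair.transports_def[OF g] by simp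
qed

lemma span_kappa:
  fixes z :: "real ^ 'n::{finite,linorder}"
  assumes "3 \<le> CARD('n)"
  shows "span {kappa1 ps CARD('n) z, kappa2 ps CARD('n) z} = kr_space ps CARD('n) z"
proof -
  have "vert CARD('n) = span {pd CARD('n) :: (real, 'n) vec}"
    using vert_eq_span[where 'n='n, of "CARD('n)"] assms by simp
  then show ?thesis
    unfolding kr_space_def kappa1_eq[OF assms] insert_commute[of "pd CARD('n)"] span_insert[of "kappa2 ps CARD('n) z"] by simp
qed

text \<open>By definition \<open>coord_tvec\<close> is the push-forward of a directional derivative under the inverse chart,
  so Kumpera-Ruiz coordinates are a contact transformation onto the model distribution.\<close>
lemma kr_coordinates_transports:
  fixes A :: "('a::topological_space, real ^ 'n::{finite,linorder}) atlas"
  assumes A: "smooth_atlas A" and n: "3 \<le> CARD('n)" and x: "kr_coordinates A D p U x ps"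
  shows "diffeo_pair A euclid U (x ` U) x (inv_into U x)"
    and "diffeo_pair.transports U x D (kr_distribution ps)"
proof -
  have d: "diffeo_on A euclid U x" using x by (simp add: kr_coordinates_def)
  show pair: "diffeo_pair A euclid U (x ` U) x (inv_into U x)"
    by (rule diffeo_pair_of_diffeo_on[OF A smooth_atlas_euclid d])
  note inv = diffeo_pair.inverse[OF pair]
  have "diffeo_pair.transports (x ` U) (inv_into U x) (kr_distribution ps) D"
    unfolding diffeo_pair.transports_def[OF inv]
  proof (intro ballI conjI)
    fix z assume z: "z \<in> x ` U"
    show "germ_local z v" if "v \<in> kr_distribution ps z" for v
      using that germ_local_dir_tvec by (auto simp: kr_distribution_def)
    let ?q = "inv_into U x z"
    have q: "?q \<in> U" "x ?q = z" using z by (auto simp: inv_into_into f_inv_into_f)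
    have c: "coord_tvec A U x ?q a = push_tvec (inv_into U x) (dir_tvec z a)" for a
      unfolding coord_tvec_def dir_tvec_def q(2)
      by (subst diffeo_pair.push_velocity[OF inv]) (use z in \<open>auto simp: o_def\<close>)
    have "D ?q = tv.span {coord_tvec A U x ?q (kappa1 ps CARD('n) z), coord_tvec A U x ?q (kappa2 ps CARD('n) z)}"
      using x q unfolding kr_coordinates_def by metis
    also have "{coord_tvec A U x ?q (kappa1 ps CARD('n) z), coord_tvec A U x ?q (kappa2 ps CARD('n) z)} =
        push_tvec (inv_into U x) ` dir_tvec z ` {kappa1 ps CARD('n) z, kappa2 ps CARD('n) z}"
      by (simp add: c)
    also have "tv.span \<dots> = push_tvec (inv_into U x) ` kr_distribution ps z"
      unfolding tvp.linear_span_image[OF linear_push_tvec] span_dir_tvec kr_distribution_def span_kappa[OF n] ..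
    finally show "push_tvec (inv_into U x) ` kr_distribution ps z = D ?q" by simp
  qed
  from diffeo_pair.transports_inverse[OF inv this]
  show "diffeo_pair.transports U x D (kr_distribution ps)" .
qed

lemma sing_type_kr_push:
  fixes A :: "('a::topological_space, real ^ 'n::{finite,linorder}) atlas"
  assumes pair: "diffeo_pair A euclid U U' x x'" and t: "diffeo_pair.transports U x D (kr_distribution ps)" and q: "q \<in> U"
  shows "sing_type A D q = sing_type euclid (kr_distribution ps) (x q)"
  by (rule diffeo_pair.sing_type_push[OF pair t _ q]) (simp add: char_value_kr)

lemma sing_type_kr_coordinates:
  fixes A :: "('a::topological_space, real ^ 'n::{finite,linorder}) atlas"
  assumes A: "smooth_atlas A" and n: "3 \<le> CARD('n)" and x: "kr_coordinates A D p U x ps"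
  shows "sing_type A D p = sing_type euclid (kr_distribution ps) (0 :: (real, 'n) vec)"
  using sing_type_kr_push[OF kr_coordinates_transports[OF assms], of p] x by (simp add: kr_coordinates_def)

lemma goursat_germ_local:
  assumes "smooth_atlas A" "goursat A D" "v \<in> D q" shows "germ_local q v"
  using assms germ_local_distribution[of A 2 UNIV D] by (auto simp: goursat_def)

lemma contact_transformation_in_coordinates:
  fixes A :: "('a::topological_space, real ^ 'n::{finite,linorder}) atlas" and B :: "('b::topological_space, (real, 'n) vec) atlas"
  assumes A: "smooth_atlas A" and B: "smooth_atlas B" and D: "goursat A D"
    and ct: "contact_transformation A D B E U \<phi>"
    and x: "kr_coordinates A D p Ux x ps" and y: "kr_coordinates B E p' Uy y qs"
  shows "\<exists>W' \<Psi>. diffeo_pair euclid euclid (x ` (U \<inter> Ux \<inter> \<phi> -` Uy)) W' (y \<circ> \<phi> \<circ> inv_into Ux x) \<Psi> \<and>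
     diffeo_pair.transports (x ` (U \<inter> Ux \<inter> \<phi> -` Uy)) (y \<circ> \<phi> \<circ> inv_into Ux x) (kr_distribution ps) (kr_distribution qs)"
proof -
  have n: "3 \<le> CARD('n)" using D by (simp add: goursat_def)
  note px = kr_coordinates_transports[OF A n x] and py = kr_coordinates_transports[OF B n y]
  note ipx = diffeo_pair.inverse[OF px(1)] diffeo_pair.transports_inverse[OF px]
  have p\<phi>: "diffeo_pair A B U (\<phi> ` U) \<phi> (inv_into U \<phi>)"
    by (rule diffeo_pair_of_diffeo_on[OF A B]) (use ct in \<open>simp add: contact_transformation_def\<close>)
  have t\<phi>: "diffeo_pair.transports U \<phi> D E"
    unfolding diffeo_pair.transports_def[OF p\<phi>] using ct goursat_germ_local[OF A D]
    by (auto simp: contact_transformation_def)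
  note c1 = diffeo_pair_compose[OF ipx(1) p\<phi>] transports_compose[OF ipx(1) p\<phi> ipx(2) t\<phi>]
  note c2 = diffeo_pair_compose[OF c1(1) py(1)] transports_compose[OF c1(1) py(1) c1(2) py(2)]
  have inj: "inj_on x Ux" using x by (simp add: kr_coordinates_def diffeo_on_def)
  have dom: "x ` Ux \<inter> inv_into Ux x -` U \<inter> (\<phi> \<circ> inv_into Ux x) -` Uy = x ` (U \<inter> Ux \<inter> \<phi> -` Uy)"
    using inv_into_f_f[OF inj] by auto
  show ?thesis using c2 unfolding dom o_assoc by blast
qed

section \<open>The coefficient functions\<close>

lemma kappa1_fun: "3 \<le> m \<Longrightarrow> kappa1 ps m = (\<lambda>z. pd m)"
  by (rule ext) (rule kappa1_eq)

definition nu :: "prolongation list \<Rightarrow> (real ^ 'n::{finite,linorder} \<Rightarrow> (real, 'n) vec) \<Rightarrow> nat \<Rightarrow> (real, 'n) vec \<Rightarrow> real" where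
  "nu ps \<Phi> i = lie_deriv (kappa1 ps i) (\<lambda>z. crd i (\<Phi> z))"

definition eta :: "prolongation list \<Rightarrow> (real ^ 'n::{finite,linorder} \<Rightarrow> (real, 'n) vec) \<Rightarrow> nat \<Rightarrow> (real, 'n) vec \<Rightarrow> real" where
  "eta ps \<Phi> i = lie_deriv (kappa2 ps i) (\<lambda>z. crd i (\<Phi> z))"

text \<open>The component of the image of \<open>\<kappa>\<^sub>1\<^sup>i\<close> along \<open>\<kappa>\<^sub>2\<^sup>i\<close>. It vanishes for \<open>i \<ge> 4\<close>; with it the index 3 fits the
  general scheme.\<close>
definition lam :: "prolongation list \<Rightarrow> (real ^ 'n::{finite,linorder} \<Rightarrow> (real, 'n) vec) \<Rightarrow> nat \<Rightarrow> (real, 'n) vec \<Rightarrow> real" where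
  "lam ps \<Phi> i z = (if i = 3 then lie_deriv (kappa1 ps 3) (\<lambda>z. crd 1 (\<Phi> z)) z else 0)"

text \<open>The relations express \<open>\<mu>\<^sub>i\<close> as a polynomial in \<open>x\<^sub>i\<close> and the coefficients with index \<open>i - 1\<close>. Taking this
  as the definition makes smoothness and triangular dependence evident. The argument is \<open>i - 3\<close>.\<close>
primrec mu_rec :: "prolongation list \<Rightarrow> (real ^ 'n::{finite,linorder} \<Rightarrow> (real, 'n) vec) \<Rightarrow> nat \<Rightarrow> (real, 'n) vec \<Rightarrow> real" where
  "mu_rec ps \<Phi> 0 z = lie_deriv (kappa2 ps 3) (\<lambda>z. crd 1 (\<Phi> z)) z"
| "mu_rec ps \<Phi> (Suc j) z = (case ps ! j of
      Reg c \<Rightarrow> coef1 ps (j + 4) z * lam ps \<Phi> (j + 3) z + mu_rec ps \<Phi> j z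
    | Sing \<Rightarrow> nu ps \<Phi> (j + 3) z + crd (j + 4) z * eta ps \<Phi> (j + 3) z)"

definition mu :: "prolongation list \<Rightarrow> (real ^ 'n::{finite,linorder} \<Rightarrow> (real, 'n) vec) \<Rightarrow> nat \<Rightarrow> (real, 'n) vec \<Rightarrow> real" where
  "mu ps \<Phi> i = mu_rec ps \<Phi> (i - 3)"

lemma mu_3: "mu ps \<Phi> 3 z = lie_deriv (kappa2 ps 3) (\<lambda>z. crd 1 (\<Phi> z)) z"
  by (simp add: mu_def)

lemma mu_step:
  assumes "4 \<le> i"
  shows "mu ps \<Phi> i z = (case ps ! (i - 4) of
      Reg c \<Rightarrow> coef1 ps i z * lam ps \<Phi> (i - 1) z + mu ps \<Phi> (i - 1) z
    | Sing \<Rightarrow> nu ps \<Phi> (i - 1) z + crd i z * eta ps \<Phi> (i - 1) z)"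
proof -
  obtain j where j: "i = j + 4" using le_Suc_ex[OF assms] by (metis add.commute)
  have e: "j + 4 - 3 = Suc j" "j + 4 - 1 = j + 3" "j + 3 - 3 = j" "j + 4 - 4 = j" by auto
  show ?thesis unfolding j mu_def e by simp
qed

text \<open>A contact transformation that fixes the origin, written in Kumpera-Ruiz coordinates on both
  sides.\<close>
locale kr_contact =
  fixes ps qs :: "prolongation list"
    and \<Phi> \<Psi> :: "real ^ 'n::{finite,linorder} \<Rightarrow> (real, 'n) vec" and W W' :: "(real, 'n) vec set"
  assumes pair: "diffeo_pair euclid euclid W W' \<Phi> \<Psi>"
    and tr: "diffeo_pair.transports W \<Phi> (kr_distribution ps) (kr_distribution qs)"
    and zero: "0 \<in> W" "\<Phi> 0 = 0"
    and n3: "3 \<le> CARD('n)"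
    and first: "4 \<le> CARD('n) \<Longrightarrow> ps ! 0 = Reg 0" "4 \<le> CARD('n) \<Longrightarrow> qs ! 0 = Reg 0"
begin

abbreviation D\<Phi> :: "(real, 'n) vec \<Rightarrow> (real, 'n) vec \<Rightarrow> (real, 'n) vec" where
  "D\<Phi> z \<equiv> frechet_derivative \<Phi> (at z)"

lemma inverse_contact: "kr_contact qs ps \<Psi> \<Phi> W' W"
proof (rule kr_contact.intro)
  show "diffeo_pair euclid euclid W' W \<Psi> \<Phi>" by (rule diffeo_pair.inverse[OF pair])
  show "diffeo_pair.transports W' \<Psi> (kr_distribution qs) (kr_distribution ps)"
    by (rule diffeo_pair.transports_inverse[OF pair tr])
  show "0 \<in> W'" "\<Psi> 0 = 0" using diffeo_pair.img[OF pair zero(1)] diffeo_pair.\<psi>\<phi>[OF pair zero(1)] zero(2) by auto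
qed (use n3 first in auto)

lemma openW: "open W" and smooth_\<Phi>: "smooth_on W \<Phi>"
  using diffeo_pair.\<phi>[OF pair] by (auto simp: smooth_map_euclid_euclid)

lemma has_derivative_\<Phi>: "z \<in> W \<Longrightarrow> (\<Phi> has_derivative D\<Phi> z) (at z)"
  by (rule smooth_on_has_derivative[OF smooth_\<Phi>])

lemma linear_D\<Phi>: "z \<in> W \<Longrightarrow> linear (D\<Phi> z)"
  by (rule linear_frechet_derivative[OF smooth_on_differentiable[OF smooth_\<Phi>]])

lemma has_derivative_crd_\<Phi>: "z \<in> W \<Longrightarrow> ((\<lambda>z. crd k (\<Phi> z)) has_derivative (\<lambda>v. crd k (D\<Phi> z v))) (at z)"
  by (rule bounded_linear.has_derivative[OF bounded_linear_crd has_derivative_\<Phi>])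

lemma lie_deriv_crd_\<Phi>: "z \<in> W \<Longrightarrow> lie_deriv X (\<lambda>z. crd k (\<Phi> z)) z = crd k (D\<Phi> z (X z))"
  unfolding lie_deriv_def frechet_derivativeI[OF has_derivative_crd_\<Phi>] ..

lemma push_dir: "z \<in> W \<Longrightarrow> push_tvec \<Phi> ` dir_tvec z ` S = dir_tvec (\<Phi> z) ` D\<Phi> z ` S"
  by (simp add: image_image push_dir_tvec[OF pair])

text \<open>For \<open>m \<le> n\<close> these are the characteristic spaces; \<open>m = n + 1\<close> is the zero space.\<close>
lemma D\<Phi>_vert:
  assumes z: "z \<in> W" and m: "4 \<le> m" "m \<le> CARD('n) + 1"
  shows "D\<Phi> z ` vert m = vert m"
proof (cases "m = CARD('n) + 1")
  case True
  have "v = 0" if "v \<in> vert m" for v :: "(real, 'n) vec"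
    by (rule crd_eqI) (use that True in \<open>auto simp: vert_def\<close>)
  then have "(vert m :: (real, 'n) vec set) = {0}" using subspace_0[OF subspace_vert] by blast
  then show ?thesis by (simp add: linear_0[OF linear_D\<Phi>[OF z]])
next
  case False
  then have i: "(CARD('n) - m) + 4 \<le> CARD('n)" "CARD('n) - (CARD('n) - m) = m" using m by auto
  have ex1: "\<exists>!V. char_value euclid (kr_distribution qs) (CARD('n) - m) (\<Phi> z) V"
    unfolding char_value_kr[OF i(1)] by simp
  have "push_tvec \<Phi> ` dir_tvec z ` vert m = dir_tvec (\<Phi> z) ` vert m"
    using diffeo_pair.char_space_push(1)[OF pair tr z ex1] unfolding char_space_kr[OF i(1)] i(2) .
  then show ?thesis unfolding push_dir[OF z] inj_image_eq_iff[OF inj_dir_tvec] .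
qed

lemma D\<Phi>_kr_space:
  assumes z: "z \<in> W" and m: "3 \<le> m" "m \<le> CARD('n)"
  shows "D\<Phi> z ` kr_space ps m z = kr_space qs m (\<Phi> z)"
proof -
  have i: "(CARD('n) - m) + 3 \<le> CARD('n)" "CARD('n) - (CARD('n) - m) = m" using m by auto
  have "push_tvec \<Phi> ` flag euclid (kr_distribution ps) (CARD('n) - m) z = flag euclid (kr_distribution qs) (CARD('n) - m) (\<Phi> z)"
    using diffeo_pair.transports_flag[OF pair tr] z unfolding diffeo_pair.transports_def[OF pair] by blast
  then show ?thesis unfolding flag_kr[OF i(1)] i(2) push_dir[OF z] inj_image_eq_iff[OF inj_dir_tvec] .
qed

lemma D\<Phi>_inj: assumes z: "z \<in> W" shows "inj (D\<Phi> z)"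
proof (rule injI)
  fix a b assume "D\<Phi> z a = D\<Phi> z b"
  then have "push_tvec \<Phi> (dir_tvec z a) = push_tvec \<Phi> (dir_tvec z b)" by (simp add: push_dir_tvec[OF pair z])
  then have "dir_tvec z a = dir_tvec z b"
    using diffeo_pair.push_push[OF pair z germ_local_dir_tvec] by metis
  then show "a = b" by (rule injD[OF inj_dir_tvec])
qed

lemma same_singularities:
  assumes "5 \<le> i" "i \<le> CARD('n)" shows "ps ! (i - 4) = Sing \<longleftrightarrow> qs ! (i - 4) = Sing"
  using sing_type_kr_push[OF pair tr zero(1)] sing_type_kr[OF assms, of ps] sing_type_kr[OF assms, of qs] zero(2) by simp

text \<open>Membership in \<open>vert (i + 1)\<close> expresses an equality of vectors on \<open>\<real>\<^sup>i\<close>. The coefficients are read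
  off from the first and the third coordinate: \<open>\<kappa>\<^sub>2\<^sup>3\<close> has the entries \<open>1\<close> and \<open>0\<close> there.\<close>
lemma frame_base:
  assumes z: "z \<in> W"
  shows "D\<Phi> z (pd 3) - nu ps \<Phi> 3 z *\<^sub>R pd 3 - lam ps \<Phi> 3 z *\<^sub>R kappa2 qs 3 (\<Phi> z) \<in> vert 4"
    "D\<Phi> z (kappa2 ps 3 z) - eta ps \<Phi> 3 z *\<^sub>R pd 3 - mu ps \<Phi> 3 z *\<^sub>R kappa2 qs 3 (\<Phi> z) \<in> vert 4"
proof -
  have k1: "crd 1 (kappa2 qs 3 (\<Phi> z)) = 1" using n3 crd_pd[where 'n='n] by (simp add: kappa2_3)
  have k3: "crd 3 (kappa2 qs 3 (\<Phi> z)) = 0" using n3 by (intro kappa2_crd_high) auto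
  have *: "D\<Phi> z u - crd 3 (D\<Phi> z u) *\<^sub>R pd 3 - crd 1 (D\<Phi> z u) *\<^sub>R kappa2 qs 3 (\<Phi> z) \<in> vert 4"
    if u: "u \<in> kr_space ps 3 z" for u
  proof -
    have "D\<Phi> z u \<in> kr_space qs 3 (\<Phi> z)" using D\<Phi>_kr_space[OF z order_refl n3] u by blast
    then obtain f where f: "D\<Phi> z u - f *\<^sub>R kappa2 qs 3 (\<Phi> z) \<in> vert 3" (is "?v \<in> _") by (auto simp: kr_space_def)
    have "crd 1 ?v = 0" using f by (auto simp: vert_def)
    then have f1: "f = crd 1 (D\<Phi> z u)" using k1 by simp
    have "?v - crd 3 ?v *\<^sub>R pd 3 \<in> vert (Suc 3)" by (rule vert_split) (use f n3 in auto)
    then show ?thesis using k3 f1 by (simp add: algebra_simps)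
  qed
  have "(pd 3 :: (real, 'n) vec) \<in> vert 3" using n3 by (intro pd_vert) auto
  then have "pd 3 \<in> kr_space ps 3 z" using vert_kr_space by blast
  from *[OF this]
  show "D\<Phi> z (pd 3) - nu ps \<Phi> 3 z *\<^sub>R pd 3 - lam ps \<Phi> 3 z *\<^sub>R kappa2 qs 3 (\<Phi> z) \<in> vert 4"
    by (simp add: nu_def lam_def lie_deriv_crd_\<Phi>[OF z] kappa1_eq)
  from *[OF kappa2_kr_space]
  show "D\<Phi> z (kappa2 ps 3 z) - eta ps \<Phi> 3 z *\<^sub>R pd 3 - mu ps \<Phi> 3 z *\<^sub>R kappa2 qs 3 (\<Phi> z) \<in> vert 4"
    by (simp add: eta_def mu_3 lie_deriv_crd_\<Phi>[OF z])
qed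

lemma frame_first:
  assumes z: "z \<in> W" and i: "4 \<le> i" "i \<le> CARD('n)"
  shows "D\<Phi> z (pd i) - nu ps \<Phi> i z *\<^sub>R pd i \<in> vert (Suc i)"
proof -
  have "(pd i :: (real, 'n) vec) \<in> vert i" using i by (intro pd_vert) auto
  then have "D\<Phi> z (pd i) \<in> vert i" using D\<Phi>_vert[OF z, of i] i by auto
  then show ?thesis using vert_split[of i "D\<Phi> z (pd i)"] i
    by (simp add: nu_def lie_deriv_crd_\<Phi>[OF z] kappa1_eq)
qed

text \<open>The image of \<open>\<kappa>\<^sub>2\<^sup>i\<close> is \<open>f\<close> times the field on the other side modulo \<open>vert i\<close>, because the flag is
  preserved. Expanding it through the frame with index \<open>i - 1\<close> and comparing coefficients gives two
  equations. The second one (regular case) or the first one (singular case) identifies \<open>f\<close> with the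
  recursively defined \<open>\<mu>\<^sub>i\<close>.\<close>
lemma frame_step:
  assumes z: "z \<in> W" and i: "4 \<le> i" "i \<le> CARD('n)"
    and k1: "D\<Phi> z (pd (i - 1)) - nu ps \<Phi> (i - 1) z *\<^sub>R pd (i - 1) - lam ps \<Phi> (i - 1) z *\<^sub>R kappa2 qs (i - 1) (\<Phi> z) \<in> vert i"
    and k2: "D\<Phi> z (kappa2 ps (i - 1) z) - eta ps \<Phi> (i - 1) z *\<^sub>R pd (i - 1) - mu ps \<Phi> (i - 1) z *\<^sub>R kappa2 qs (i - 1) (\<Phi> z) \<in> vert i"
  shows "D\<Phi> z (kappa2 ps i z) - eta ps \<Phi> i z *\<^sub>R pd i - mu ps \<Phi> i z *\<^sub>R kappa2 qs i (\<Phi> z) \<in> vert (Suc i)"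
    and "coef1 ps i z * nu ps \<Phi> (i - 1) z + coef2 ps i z * eta ps \<Phi> (i - 1) z = mu ps \<Phi> i z * coef1 qs i (\<Phi> z)"
    and "coef1 ps i z * lam ps \<Phi> (i - 1) z + coef2 ps i z * mu ps \<Phi> (i - 1) z = mu ps \<Phi> i z * coef2 qs i (\<Phi> z)"
    and "mu ps \<Phi> i z \<noteq> 0"
proof -
  let ?k = "i - 1"
  let ?a = "coef1 ps i z" and ?b = "coef2 ps i z" and ?a' = "coef1 qs i (\<Phi> z)" and ?b' = "coef2 qs i (\<Phi> z)"
  let ?K = "kappa2 qs ?k (\<Phi> z)"
  have k: "3 \<le> ?k" "?k \<le> CARD('n)" "Suc ?k = i" "3 \<le> i" using i by auto
  note lin = linear_D\<Phi>[OF z]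
  have kp: "kappa2 ps i z = ?a *\<^sub>R pd ?k + ?b *\<^sub>R kappa2 ps ?k z" and kq: "kappa2 qs i (\<Phi> z) = ?a' *\<^sub>R pd ?k + ?b' *\<^sub>R ?K"
    using kappa2_step[OF i(1)] by auto
  have "D\<Phi> z (kappa2 ps i z) \<in> kr_space qs i (\<Phi> z)" using D\<Phi>_kr_space[OF z k(4) i(2)] kappa2_kr_space by blast
  then obtain f where f: "D\<Phi> z (kappa2 ps i z) - f *\<^sub>R kappa2 qs i (\<Phi> z) \<in> vert i" (is "?v \<in> _") by (auto simp: kr_space_def)
  have "?a *\<^sub>R (D\<Phi> z (pd ?k) - nu ps \<Phi> ?k z *\<^sub>R pd ?k - lam ps \<Phi> ?k z *\<^sub>R ?K) +
      ?b *\<^sub>R (D\<Phi> z (kappa2 ps ?k z) - eta ps \<Phi> ?k z *\<^sub>R pd ?k - mu ps \<Phi> ?k z *\<^sub>R ?K) \<in> vert i"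
    by (intro subspace_add subspace_scale subspace_vert k1 k2)
  from subspace_diff[OF subspace_vert f this]
  have "(?a * nu ps \<Phi> ?k z + ?b * eta ps \<Phi> ?k z - f * ?a') *\<^sub>R pd ?k + (?a * lam ps \<Phi> ?k z + ?b * mu ps \<Phi> ?k z - f * ?b') *\<^sub>R ?K \<in> vert (Suc ?k)"
    unfolding kq k(3) unfolding kp linear_add[OF lin] linear_scale[OF lin] by (simp add: algebra_simps)
  from kappa2_pd_independent[OF k(1,2) this]
  have r: "?a * nu ps \<Phi> ?k z + ?b * eta ps \<Phi> ?k z = f * ?a'" "?a * lam ps \<Phi> ?k z + ?b * mu ps \<Phi> ?k z = f * ?b'" by auto
  \<comment> \<open>At most one of the two coefficients varies; the constant one is \<open>1\<close> and yields \<open>f\<close>.\<close>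
  have fmu: "f = mu ps \<Phi> i z"
  proof (cases "i = 4")
    case True
    then show ?thesis using r(2) first i by (simp add: mu_step coef2_def)
  next
    case False
    then have "ps ! (i - 4) = Sing \<longleftrightarrow> qs ! (i - 4) = Sing" using i by (intro same_singularities) auto
    then show ?thesis using r i by (simp add: mu_step coef1_def coef2_def split: prolongation.splits)
  qed
  have "crd i (kappa2 qs i (\<Phi> z)) = 0" using i by (intro kappa2_crd_high) auto
  then show "D\<Phi> z (kappa2 ps i z) - eta ps \<Phi> i z *\<^sub>R pd i - mu ps \<Phi> i z *\<^sub>R kappa2 qs i (\<Phi> z) \<in> vert (Suc i)"
    using vert_split[of i ?v] f i fmu by (simp add: eta_def lie_deriv_crd_\<Phi>[OF z] algebra_simps)
  show "?a * nu ps \<Phi> ?k z + ?b * eta ps \<Phi> ?k z = mu ps \<Phi> i z * ?a'" "?a * lam ps \<Phi> ?k z + ?b * mu ps \<Phi> ?k z = mu ps \<Phi> i z * ?b'"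
    using r fmu by auto
  \<comment> \<open>Otherwise \<open>\<kappa>\<^sub>2\<^sup>i\<close> would be mapped into \<open>vert i\<close>, hence lie in it.\<close>
  show "mu ps \<Phi> i z \<noteq> 0"
  proof
    assume "mu ps \<Phi> i z = 0"
    then have "D\<Phi> z (kappa2 ps i z) \<in> D\<Phi> z ` vert i" using f fmu D\<Phi>_vert[OF z, of i] i by simp
    then have "kappa2 ps i z \<in> vert i" using inj_image_mem_iff[OF D\<Phi>_inj[OF z]] by blast
    then show False using kappa2_not_vert[OF k(4) i(2)] by blast
  qed
qed

lemma frame:
  assumes z: "z \<in> W" and i: "3 \<le> i" "i \<le> CARD('n)"
  shows "D\<Phi> z (pd i) - nu ps \<Phi> i z *\<^sub>R pd i - lam ps \<Phi> i z *\<^sub>R kappa2 qs i (\<Phi> z) \<in> vert (Suc i)"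
    and "D\<Phi> z (kappa2 ps i z) - eta ps \<Phi> i z *\<^sub>R pd i - mu ps \<Phi> i z *\<^sub>R kappa2 qs i (\<Phi> z) \<in> vert (Suc i)"
  using i
proof (induction i rule: nat_induct_at_least)
  case base
  { case 1 then show ?case using frame_base[OF z] by simp }
  { case 2 then show ?case using frame_base[OF z] by simp }
next
  case (Suc i)
  { case 1 then show ?case using frame_first[OF z, of "Suc i"] Suc.hyps by (simp add: lam_def) }
  { case 2 then show ?case using frame_step(1)[OF z, of "Suc i"] Suc.IH Suc.hyps by simp }
qed

lemma prolonged_relations:
  assumes z: "z \<in> W" and i: "4 \<le> i" "i \<le> CARD('n)"
  shows "coef1 ps i z * nu ps \<Phi> (i - 1) z + coef2 ps i z * eta ps \<Phi> (i - 1) z = mu ps \<Phi> i z * coef1 qs i (\<Phi> z)"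
    and "coef1 ps i z * lam ps \<Phi> (i - 1) z + coef2 ps i z * mu ps \<Phi> (i - 1) z = mu ps \<Phi> i z * coef2 qs i (\<Phi> z)"
    and "mu ps \<Phi> i z \<noteq> 0"
proof -
  have k: "3 \<le> i - 1" "i - 1 \<le> CARD('n)" "Suc (i - 1) = i" using i by auto
  note s = frame_step[OF z i frame[OF z k(1,2), unfolded k(3)]]
  show "coef1 ps i z * nu ps \<Phi> (i - 1) z + coef2 ps i z * eta ps \<Phi> (i - 1) z = mu ps \<Phi> i z * coef1 qs i (\<Phi> z)"
    "coef1 ps i z * lam ps \<Phi> (i - 1) z + coef2 ps i z * mu ps \<Phi> (i - 1) z = mu ps \<Phi> i z * coef2 qs i (\<Phi> z)"
    "mu ps \<Phi> i z \<noteq> 0" using s(2-4) .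
qed

lemma relation_4:
  assumes z: "z \<in> W" and n: "4 \<le> CARD('n)"
  shows "mu ps \<Phi> 4 z = mu ps \<Phi> 3 z + crd 4 z * lam ps \<Phi> 3 z" "mu ps \<Phi> 4 z \<noteq> 0"
    "crd 4 (\<Phi> z) = (eta ps \<Phi> 3 z + crd 4 z * nu ps \<Phi> 3 z) / mu ps \<Phi> 4 z"
proof -
  show "mu ps \<Phi> 4 z = mu ps \<Phi> 3 z + crd 4 z * lam ps \<Phi> 3 z" using first(1)[OF n] by (simp add: mu_step coef1_def)
  show m: "mu ps \<Phi> 4 z \<noteq> 0" by (rule prolonged_relations(3)[OF z order_refl n])
  show "crd 4 (\<Phi> z) = (eta ps \<Phi> 3 z + crd 4 z * nu ps \<Phi> 3 z) / mu ps \<Phi> 4 z"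
    using prolonged_relations(1)[OF z order_refl n] m first n by (simp add: coef1_def coef2_def field_simps)
qed

lemma relation_regular:
  assumes z: "z \<in> W" and i: "5 \<le> i" "i \<le> CARD('n)" and c: "ps ! (i - 4) = Reg c" "qs ! (i - 4) = Reg c'"
  shows "mu ps \<Phi> i z = mu ps \<Phi> (i - 1) z" "mu ps \<Phi> (i - 1) z \<noteq> 0"
    "crd i (\<Phi> z) = 1 / mu ps \<Phi> (i - 1) z * ((crd i z + c) * nu ps \<Phi> (i - 1) z + eta ps \<Phi> (i - 1) z) - c'"
proof -
  have i4: "4 \<le> i" using i by simp
  show m: "mu ps \<Phi> i z = mu ps \<Phi> (i - 1) z" using c i by (simp add: mu_step lam_def)
  show m0: "mu ps \<Phi> (i - 1) z \<noteq> 0" using prolonged_relations(3)[OF z i4 i(2)] m by simp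
  show "crd i (\<Phi> z) = 1 / mu ps \<Phi> (i - 1) z * ((crd i z + c) * nu ps \<Phi> (i - 1) z + eta ps \<Phi> (i - 1) z) - c'"
    using prolonged_relations(1)[OF z i4 i(2)] m m0 c by (simp add: coef1_def coef2_def field_simps)
qed

lemma relation_singular:
  assumes z: "z \<in> W" and i: "5 \<le> i" "i \<le> CARD('n)" and c: "ps ! (i - 4) = Sing"
  shows "mu ps \<Phi> i z = nu ps \<Phi> (i - 1) z + crd i z * eta ps \<Phi> (i - 1) z" "mu ps \<Phi> i z \<noteq> 0"
    "crd i (\<Phi> z) = crd i z * mu ps \<Phi> (i - 1) z / mu ps \<Phi> i z"
proof -
  have i4: "4 \<le> i" using i by simp
  have i3: "i - Suc 0 \<noteq> 3" using i by simp
  have c': "qs ! (i - 4) = Sing" using same_singularities[OF i] c by simp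
  show m: "mu ps \<Phi> i z = nu ps \<Phi> (i - 1) z + crd i z * eta ps \<Phi> (i - 1) z" using c i by (simp add: mu_step)
  show m0: "mu ps \<Phi> i z \<noteq> 0" by (rule prolonged_relations(3)[OF z i4 i(2)])
  show "crd i (\<Phi> z) = crd i z * mu ps \<Phi> (i - 1) z / mu ps \<Phi> i z"
    using prolonged_relations(2)[OF z i4 i(2)] m0 c c' i3 by (simp add: coef1_def coef2_def lam_def field_simps)
qed

lemma regular_constants:
  assumes i: "5 \<le> i" "i \<le> CARD('n)" and c: "ps ! (i - 4) = Reg c" "qs ! (i - 4) = Reg c'"
  shows "c' = c * (nu ps \<Phi> (i - 1) 0 / mu ps \<Phi> (i - 1) 0) + eta ps \<Phi> (i - 1) 0 / mu ps \<Phi> (i - 1) 0"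
  using relation_regular(2,3)[OF zero(1) i c] zero(2) by (simp add: field_simps)

end

section \<open>Cubes\<close>

lemma cube_crd: "z \<in> cube r \<longleftrightarrow> (\<forall>k\<in>{1..CARD('n)}. \<bar>crd k (z :: real ^ 'n::{finite,linorder})\<bar> < r)"
proof
  assume a: "\<forall>k\<in>{1..CARD('n)}. \<bar>crd k z\<bar> < r"
  have "\<bar>z $ i\<bar> < r" for i
  proof -
    have "i \<in> ix ` {1..CARD('n)}" using bij_ix[where 'n='n] by (simp add: bij_betw_def)
    then show ?thesis using a by (auto simp: crd_def)
  qed
  then show "z \<in> cube r" by (simp add: cube_def)
qed (simp add: cube_def crd_def)

lemma open_cube: "open (cube r :: (real ^ 'n::finite) set)"
proof -
  have "cube r = (\<Inter>k\<in>UNIV. {x :: (real, 'n) vec. \<bar>x $ k\<bar> < r})" by (auto simp: cube_def)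
  then show ?thesis by (auto intro!: open_INT open_Collect_less continuous_intros)
qed

lemma cube_subset_open:
  fixes S :: "(real ^ 'n::finite) set"
  assumes "open S" "0 \<in> S" shows "\<exists>r>0. cube r \<subseteq> S"
proof -
  obtain e where e: "e > 0" "ball 0 e \<subseteq> S" using assms open_contains_ball by blast
  define r where "r = e / CARD('n)"
  have r: "r > 0" using e by (simp add: r_def)
  have "norm x < e" if "x \<in> cube r" for x :: "(real, 'n) vec"
  proof -
    have "norm x \<le> (\<Sum>i\<in>UNIV. \<bar>x $ i\<bar>)" by (rule norm_le_l1_cart)
    also have "\<dots> < (\<Sum>i\<in>(UNIV :: 'n set). r)" by (rule sum_strict_mono) (use that in \<open>auto simp: cube_def\<close>)
    also have "\<dots> = e" by (simp add: r_def)
    finally show ?thesis .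
  qed
  then show ?thesis using e r by (intro exI[of _ r]) auto
qed

lemma zero_cube: "0 < r \<Longrightarrow> 0 \<in> cube r" by (simp add: cube_def)

lemma cube_mono: "r \<le> s \<Longrightarrow> cube r \<subseteq> cube s"
  unfolding cube_def using less_le_trans by blast

lemma cube_pos: "z \<in> cube r \<Longrightarrow> 0 < r"
  unfolding cube_def by (smt (verit) mem_Collect_eq abs_ge_zero)

lemma low_cube:
  fixes z :: "real ^ 'n::{finite,linorder}"
  assumes "i \<le> CARD('n)" "z \<in> cube r" shows "low i z \<in> cube r"
  using assms crd_low[where 'n='n, of _ i z] cube_pos[OF assms(2)] by (auto simp: cube_crd)

lemma cube_segment:
  assumes "x \<in> cube r" "y \<in> cube r" "0 \<le> t" "t \<le> 1"
  shows "x + t *\<^sub>R (y - x) \<in> (cube r :: (real ^ 'n::finite) set)"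
  unfolding cube_def
proof (intro CollectI allI)
  fix k
  have "\<bar>x $ k\<bar> < r" "\<bar>y $ k\<bar> < r" using assms by (auto simp: cube_def)
  then have "x $ k \<in> {-r<..<r}" "y $ k \<in> {-r<..<r}" by auto
  then have "(1 - t) *\<^sub>R x $ k + t *\<^sub>R y $ k \<in> {-r<..<r}"
    using assms by (intro convexD[OF convex_real_interval(8)]) auto
  then show "\<bar>(x + t *\<^sub>R (y - x)) $ k\<bar> < r" by (auto simp: algebra_simps)
qed

lemma low_eqI:
  fixes x y :: "real ^ 'n::{finite,linorder}"
  assumes "i \<le> CARD('n)" "\<And>k. k \<in> {1..i} \<Longrightarrow> crd k x = crd k y" shows "low i x = low i y"
  by (rule crd_eqI) (use assms in \<open>auto simp: crd_low\<close>)

lemma low_low: "i \<le> CARD('n) \<Longrightarrow> j \<le> CARD('n) \<Longrightarrow> low i (low j (z :: real ^ 'n::{finite,linorder})) = low (min i j) z"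
  by (rule crd_eqI) (auto simp: crd_low)

lemma Rsub_low: "i \<le> CARD('n) \<Longrightarrow> z \<in> Rsub i \<longleftrightarrow> low i z = (z :: real ^ 'n::{finite,linorder})"
proof
  assume i: "i \<le> CARD('n)" and z: "z \<in> Rsub i"
  show "low i z = z" by (rule crd_eqI) (use i z in \<open>auto simp: crd_low Rsub_def\<close>)
next
  assume i: "i \<le> CARD('n)" and z: "low i z = z"
  have "crd k z = 0" if "k \<in> {i<..CARD('n)}" for k
    using crd_low[where 'n='n, of k i z] that i unfolding z by auto
  then show "z \<in> Rsub i" by (auto simp: Rsub_def)
qed

lemma linear_low: "bounded_linear (low i)"
proof -
  have "linear (low i)" unfolding low_def[abs_def]
    by (rule linearI) (simp_all add: algebra_simps sum.distrib scaleR_sum_right)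
  then show ?thesis by (rule linear_conv_bounded_linear[THEN iffD1])
qed

lemma low_minus_vert: "i \<le> CARD('n) \<Longrightarrow> z - low i z \<in> vert (Suc i)" for z :: "real ^ 'n::{finite,linorder}"
  by (auto simp: vert_def crd_low)

lemma low_vert: "i \<le> CARD('n) \<Longrightarrow> v \<in> vert (Suc i) \<Longrightarrow> low i v = 0" for v :: "real ^ 'n::{finite,linorder}"
  by (rule crd_eqI) (auto simp: vert_def crd_low)

lemma low_pd: "k \<in> {1..i} \<Longrightarrow> i \<le> CARD('n) \<Longrightarrow> low i (pd k) = (pd k :: real ^ 'n::{finite,linorder})"
  by (rule crd_eqI) (auto simp: crd_low crd_pd[where 'n='n])

lemma low_kappa2:
  fixes z :: "real ^ 'n::{finite,linorder}"
  assumes "3 \<le> m" "m \<le> i" "i \<le> CARD('n)" shows "low i (kappa2 ps m z) = kappa2 ps m z"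
proof (rule crd_eqI)
  fix k assume "k \<in> {1..CARD('n)}"
  then show "crd k (low i (kappa2 ps m z)) = crd k (kappa2 ps m z)"
    using assms kappa2_crd_high[where 'n='n, OF assms(1), of k] by (auto simp: crd_low)
qed

lemma kappa2_low:
  fixes z :: "real ^ 'n::{finite,linorder}"
  assumes "3 \<le> m" "m \<le> i" "i \<le> CARD('n)" shows "kappa2 ps m (low i z) = kappa2 ps m z"
  by (rule kappa2_cong[OF assms(1)]) (use assms in \<open>auto simp: crd_low\<close>)

section \<open>The relations on a cube\<close>

lemma has_real_derivative_line:
  assumes "(f has_derivative f') (at (a + s *\<^sub>R w))"
  shows "((\<lambda>s. f (a + s *\<^sub>R w) :: real) has_real_derivative f' w) (at s)"
proof -
  have "((\<lambda>s. f (a + s *\<^sub>R w)) has_derivative (\<lambda>r. f' (r *\<^sub>R w))) (at s)"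
    by (rule has_derivative_compose[OF has_derivative_line assms])
  moreover have "(\<lambda>r. f' (r *\<^sub>R w)) = (*) (f' w)"
    using linear_scale[OF has_derivative_linear[OF assms]] by auto
  ultimately show ?thesis by (simp only: has_field_derivative_def)
qed

lemma depends_on_first_mono:
  assumes "depends_on_first i r (f :: real ^ 'n::{finite,linorder} \<Rightarrow> real)" "i \<le> j" "j \<le> CARD('n)"
  shows "depends_on_first j r f"
  unfolding depends_on_first_def
proof
  fix x :: "(real, 'n) vec" assume x: "x \<in> cube r"
  have "low i (low j x) = low i x" using assms by (simp add: low_low min_absorb1)
  then show "f x = f (low j x)"
    using assms x low_cube[OF assms(3) x] unfolding depends_on_first_def by metis
qed

context kr_contact
begin

text \<open>On the segment from \<open>low m x\<close> to \<open>x\<close> the velocity lies in \<open>vert (m + 1)\<close>, which the derivative of \<open>\<Phi>\<close>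
  preserves; so the earlier components of \<open>\<Phi>\<close> do not change. The maximum with 3 is needed because
  \<open>vert m\<close> is preserved for \<open>m \<ge> 4\<close> only.\<close>
lemma depends_component:
  assumes R: "cube R \<subseteq> W" and i: "1 \<le> i" "i \<le> CARD('n)"
  shows "depends_on_first (max 3 i) R (\<lambda>z. crd i (\<Phi> z))"
  unfolding depends_on_first_def
proof
  fix x :: "(real, 'n) vec" assume x: "x \<in> cube R"
  let ?m = "max 3 i"
  have m: "?m \<le> CARD('n)" using n3 i by simp
  let ?y = "low ?m x"
  have y: "?y \<in> cube R" by (rule low_cube[OF m x])
  have xy: "x - ?y \<in> vert (Suc ?m)" by (rule low_minus_vert[OF m])
  have "\<exists>t::real. 0 < t \<and> t < 1 \<and> crd i (\<Phi> (?y + 1 *\<^sub>R (x - ?y))) - crd i (\<Phi> (?y + 0 *\<^sub>R (x - ?y))) = (1 - 0) * (0 :: real)"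
  proof (rule MVT2[where f = "\<lambda>t. crd i (\<Phi> (?y + t *\<^sub>R (x - ?y)))" and f' = "\<lambda>_. 0"])
    fix t :: real assume t: "0 \<le> t" "t \<le> 1"
    let ?p = "?y + t *\<^sub>R (x - ?y)"
    have p: "?p \<in> W" using cube_segment[OF y x t] R by blast
    have "D\<Phi> ?p (x - ?y) \<in> vert (Suc ?m)" using D\<Phi>_vert[OF p, of "Suc ?m"] xy m by auto
    then have "crd i (D\<Phi> ?p (x - ?y)) = 0" using i by (auto simp: vert_def)
    then show "((\<lambda>t. crd i (\<Phi> (?y + t *\<^sub>R (x - ?y)))) has_real_derivative 0) (at t)"
      using has_real_derivative_line[OF has_derivative_crd_\<Phi>[OF p, of i]] by simp
  qed simp
  then show "crd i (\<Phi> x) = crd i (\<Phi> ?y)" by auto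
qed

lemma crd_\<Phi>_low:
  assumes R: "cube R \<subseteq> W" and i: "1 \<le> i" "i \<le> m" "3 \<le> m" "m \<le> CARD('n)" and z: "z \<in> cube R"
  shows "crd i (\<Phi> z) = crd i (\<Phi> (low m z))"
proof -
  have "depends_on_first m R (\<lambda>z. crd i (\<Phi> z))"
    by (rule depends_on_first_mono[OF depends_component[OF R]]) (use i in auto)
  then show ?thesis using z by (simp add: depends_on_first_def)
qed

lemma low_\<Phi>_low:
  assumes "cube R \<subseteq> W" "3 \<le> m" "m \<le> CARD('n)" "z \<in> cube R"
  shows "low m (\<Phi> (low m z)) = low m (\<Phi> z)"
  by (rule low_eqI) (use assms crd_\<Phi>_low[OF assms(1)] in auto)

lemma crd_D\<Phi>_low:
  assumes R: "cube R \<subseteq> W" and i: "1 \<le> i" "i \<le> m" "3 \<le> m" "m \<le> CARD('n)" and z: "z \<in> cube R"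
  shows "crd i (D\<Phi> z v) = crd i (D\<Phi> (low m z) (low m v))"
proof -
  have zW: "z \<in> W" "low m z \<in> W" using R z low_cube[OF i(4) z] by auto
  have "((\<lambda>z. crd i (\<Phi> (low m z))) has_derivative (\<lambda>v. crd i (D\<Phi> (low m z) (low m v)))) (at z)"
    by (rule has_derivative_compose[OF bounded_linear_imp_has_derivative[OF linear_low] has_derivative_crd_\<Phi>[OF zW(2)]])
  then have "((\<lambda>z. crd i (\<Phi> z)) has_derivative (\<lambda>v. crd i (D\<Phi> (low m z) (low m v)))) (at z)"
    by (rule has_derivative_transform_within_open[OF _ open_cube z]) (use crd_\<Phi>_low[OF R i] in simp)
  from has_derivative_unique[OF has_derivative_crd_\<Phi>[OF zW(1)] this] show ?thesis by (rule fun_cong)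
qed

lemma depends_nu:
  assumes R: "cube R \<subseteq> W" and i: "3 \<le> i" "i \<le> CARD('n)"
  shows "depends_on_first i R (nu ps \<Phi> i)"
  unfolding depends_on_first_def
proof
  fix z :: "(real, 'n) vec" assume z: "z \<in> cube R"
  have zW: "z \<in> W" "low i z \<in> W" using R z low_cube[OF i(2) z] by auto
  show "nu ps \<Phi> i z = nu ps \<Phi> i (low i z)"
    using crd_D\<Phi>_low[OF R _ order_refl i z, of "pd i"] i
    by (simp add: nu_def lie_deriv_crd_\<Phi> zW kappa1_eq low_pd)
qed

lemma depends_eta:
  assumes R: "cube R \<subseteq> W" and i: "3 \<le> i" "i \<le> CARD('n)"
  shows "depends_on_first i R (eta ps \<Phi> i)"
  unfolding depends_on_first_def
proof
  fix z :: "(real, 'n) vec" assume z: "z \<in> cube R"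
  have zW: "z \<in> W" "low i z \<in> W" using R z low_cube[OF i(2) z] by auto
  show "eta ps \<Phi> i z = eta ps \<Phi> i (low i z)"
    using crd_D\<Phi>_low[OF R _ order_refl i z, of "kappa2 ps i z"] i
    by (simp add: eta_def lie_deriv_crd_\<Phi> zW low_kappa2 kappa2_low)
qed

lemma depends_lam:
  assumes R: "cube R \<subseteq> W" and i: "3 \<le> i" "i \<le> CARD('n)"
  shows "depends_on_first i R (lam ps \<Phi> i)"
  unfolding depends_on_first_def
proof
  fix z :: "(real, 'n) vec" assume z: "z \<in> cube R"
  have zW: "z \<in> W" "low 3 z \<in> W" using R z low_cube[OF n3 z] by auto
  show "lam ps \<Phi> i z = lam ps \<Phi> i (low i z)"
    using crd_D\<Phi>_low[OF R, of 1 3 z "pd 3"] n3 z low_pd[where 'n='n, of 3 3]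
    by (simp add: lam_def lie_deriv_crd_\<Phi> zW kappa1_eq)
qed

lemma depends_mu:
  assumes R: "cube R \<subseteq> W" and i: "3 \<le> i" "i \<le> CARD('n)"
  shows "depends_on_first i R (mu ps \<Phi> i)"
  using i
proof (induction i rule: nat_induct_at_least)
  case base
  show ?case unfolding depends_on_first_def
  proof
    fix z :: "(real, 'n) vec" assume z: "z \<in> cube R"
    have zW: "z \<in> W" "low 3 z \<in> W" using R z low_cube[OF n3 z] by auto
    show "mu ps \<Phi> 3 z = mu ps \<Phi> 3 (low 3 z)"
      using crd_D\<Phi>_low[OF R, of 1 3 z "kappa2 ps 3 z"] n3 z
      by (simp add: mu_3 lie_deriv_crd_\<Phi> zW low_kappa2 kappa2_low)
  qed
next
  case (Suc i)
  have m: "4 \<le> Suc i" "i \<le> CARD('n)" using Suc by auto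
  note d = depends_on_first_mono[OF depends_nu[OF R Suc.hyps m(2)] _ Suc.prems] depends_on_first_mono[OF depends_eta[OF R Suc.hyps m(2)] _ Suc.prems]
    depends_on_first_mono[OF depends_lam[OF R Suc.hyps m(2)] _ Suc.prems] depends_on_first_mono[OF Suc.IH[OF m(2)] _ Suc.prems]
  show ?case unfolding depends_on_first_def
  proof
    fix z :: "(real, 'n) vec" assume z: "z \<in> cube R"
    have c: "crd (Suc i) (low (Suc i) z) = crd (Suc i) z" using Suc.prems by (simp add: crd_low)
    have "nu ps \<Phi> i z = nu ps \<Phi> i (low (Suc i) z)" "eta ps \<Phi> i z = eta ps \<Phi> i (low (Suc i) z)"
      "lam ps \<Phi> i z = lam ps \<Phi> i (low (Suc i) z)" "mu ps \<Phi> i z = mu ps \<Phi> i (low (Suc i) z)"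
      using d z unfolding depends_on_first_def by auto
    then show "mu ps \<Phi> (Suc i) z = mu ps \<Phi> (Suc i) (low (Suc i) z)"
      using c by (simp add: mu_step[OF m(1)] coef1_def split: prolongation.split)
  qed
qed

lemma smooth_lie_deriv:
  assumes "smooth_on UNIV X" shows "smooth_on W (lie_deriv X (\<lambda>z. crd k (\<Phi> z)))"
  unfolding lie_deriv_def[abs_def]
  by (intro smooth_on_derivative_along openW smooth_on_linear_compose[OF bounded_linear_crd] smooth_\<Phi>
      smooth_on_subset[OF assms]) simp

lemma smooth_kappa1: "3 \<le> i \<Longrightarrow> smooth_on UNIV (kappa1 ps i)"
  by (simp only: kappa1_fun smooth_on_const)

lemma smooth_nu: "3 \<le> i \<Longrightarrow> smooth_on W (nu ps \<Phi> i)"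
  unfolding nu_def by (rule smooth_lie_deriv[OF smooth_kappa1])

lemma smooth_eta: "3 \<le> i \<Longrightarrow> smooth_on W (eta ps \<Phi> i)"
  unfolding eta_def by (rule smooth_lie_deriv[OF smooth_kappa2])

lemma smooth_lam: "smooth_on W (lam ps \<Phi> i)"
proof (cases "i = 3")
  case True
  then have "lam ps \<Phi> i = lie_deriv (kappa1 ps 3) (\<lambda>z. crd 1 (\<Phi> z))" by (simp add: lam_def[abs_def])
  then show ?thesis using smooth_lie_deriv[OF smooth_kappa1] by simp
next
  case False
  then have "lam ps \<Phi> i = (\<lambda>z. 0)" by (simp add: lam_def[abs_def])
  then show ?thesis by (simp add: smooth_on_const)
qed

lemma smooth_mu: "3 \<le> i \<Longrightarrow> smooth_on W (mu ps \<Phi> i)"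
proof (induction i rule: nat_induct_at_least)
  case base
  have "mu ps \<Phi> 3 = lie_deriv (kappa2 ps 3) (\<lambda>z. crd 1 (\<Phi> z))" by (rule ext) (rule mu_3)
  then show ?case using smooth_lie_deriv[OF smooth_kappa2] by simp
next
  case (Suc i)
  have s: "smooth_on W (coef1 ps (Suc i))" "smooth_on W (crd (Suc i))"
    using smooth_on_subset[OF smooth_coef(1)] smooth_on_subset[OF smooth_crd] by blast+
  have "mu ps \<Phi> (Suc i) = (case ps ! (Suc i - 4) of
      Reg c \<Rightarrow> (\<lambda>z. coef1 ps (Suc i) z * lam ps \<Phi> i z + mu ps \<Phi> i z)
    | Sing \<Rightarrow> (\<lambda>z. nu ps \<Phi> i z + crd (Suc i) z * eta ps \<Phi> i z))"
    by (rule ext) (use Suc.hyps in \<open>simp add: mu_step split: prolongation.split\<close>)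
  then show ?case using Suc s
    by (cases "ps ! (Suc i - 4)") (simp_all add: smooth_on_add smooth_on_mult openW smooth_nu smooth_eta smooth_lam)
qed

text \<open>\<open>\<nu>\<^sub>i\<close> is the derivative of \<open>\<Phi>\<^sub>i\<close> along \<open>x\<^sub>i\<close>, which may be computed from any formula for \<open>\<Phi>\<^sub>i\<close> that is
  valid on the coordinate line.\<close>
lemma nu_eqI:
  assumes R: "cube R \<subseteq> W" and z: "z \<in> cube R" and i: "3 \<le> i"
    and h: "(h has_real_derivative d) (at 0)"
    and eq: "\<And>t. z + t *\<^sub>R pd i \<in> cube R \<Longrightarrow> crd i (\<Phi> (z + t *\<^sub>R pd i)) = h t"
  shows "nu ps \<Phi> i z = d"
proof -
  have zW: "z \<in> W" using R z by blast
  have D: "((\<lambda>t. crd i (\<Phi> (z + t *\<^sub>R pd i))) has_real_derivative crd i (D\<Phi> z (pd i))) (at 0)"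
    using has_real_derivative_line[of "\<lambda>z. crd i (\<Phi> z)" "\<lambda>v. crd i (D\<Phi> z v)" z 0 "pd i"] has_derivative_crd_\<Phi>[OF zW] by simp
  have ev: "\<forall>\<^sub>F t in nhds (0::real). crd i (\<Phi> (z + t *\<^sub>R pd i)) = h t"
  proof -
    have "open ((\<lambda>t::real. z + t *\<^sub>R pd i) -` cube R)"
      by (rule open_vimage[OF open_cube]) (intro continuous_intros)
    then show ?thesis unfolding eventually_nhds using z eq by (intro exI[of _ "(\<lambda>t. z + t *\<^sub>R pd i) -` cube R"]) auto
  qed
  have "(h has_real_derivative crd i (D\<Phi> z (pd i))) (at 0)"
    using D unfolding DERIV_cong_ev[OF refl ev refl] .
  then have "crd i (D\<Phi> z (pd i)) = d" using h by (rule DERIV_unique)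
  then show ?thesis by (simp add: nu_def lie_deriv_crd_\<Phi>[OF zW] kappa1_eq[OF i])
qed

text \<open>Hence only the explicit \<open>x\<^sub>i\<close> in the formulas for \<open>\<Phi>\<^sub>i\<close> has to be differentiated.\<close>
lemma constant_along:
  assumes R: "cube R \<subseteq> W" and z: "z \<in> cube R" and i: "4 \<le> i" "i \<le> CARD('n)" and w: "z + t *\<^sub>R pd i \<in> cube R"
  shows "nu ps \<Phi> (i - 1) (z + t *\<^sub>R pd i) = nu ps \<Phi> (i - 1) z" "eta ps \<Phi> (i - 1) (z + t *\<^sub>R pd i) = eta ps \<Phi> (i - 1) z"
    "lam ps \<Phi> (i - 1) (z + t *\<^sub>R pd i) = lam ps \<Phi> (i - 1) z" "mu ps \<Phi> (i - 1) (z + t *\<^sub>R pd i) = mu ps \<Phi> (i - 1) z"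
    "crd i (z + t *\<^sub>R pd i) = crd i z + t"
proof -
  have k: "3 \<le> i - 1" "i - 1 \<le> CARD('n)" using i by auto
  have l: "low (i - 1) (z + t *\<^sub>R pd i) = low (i - 1) z"
  proof (rule low_eqI[OF k(2)])
    fix j assume j: "j \<in> {1..i - 1}"
    then have "j \<noteq> i" "j \<in> {1..CARD('n)}" "i \<in> {1..CARD('n)}" using i by auto
    then show "crd j (z + t *\<^sub>R pd i) = crd j z" using crd_pd[where 'n='n, of j i] by simp
  qed
  show "nu ps \<Phi> (i - 1) (z + t *\<^sub>R pd i) = nu ps \<Phi> (i - 1) z" "eta ps \<Phi> (i - 1) (z + t *\<^sub>R pd i) = eta ps \<Phi> (i - 1) z"
    "lam ps \<Phi> (i - 1) (z + t *\<^sub>R pd i) = lam ps \<Phi> (i - 1) z" "mu ps \<Phi> (i - 1) (z + t *\<^sub>R pd i) = mu ps \<Phi> (i - 1) z"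
    using depends_nu[OF R k] depends_eta[OF R k] depends_lam[OF R k] depends_mu[OF R k] z w l
    unfolding depends_on_first_def by metis+
  show "crd i (z + t *\<^sub>R pd i) = crd i z + t" using i crd_pd[where 'n='n, of i i] by simp
qed

lemma nu_4:
  assumes R: "cube R \<subseteq> W" and z: "z \<in> cube R" and n: "4 \<le> CARD('n)"
  shows "nu ps \<Phi> 4 z = (mu ps \<Phi> 3 z * nu ps \<Phi> 3 z - lam ps \<Phi> 3 z * eta ps \<Phi> 3 z) / (mu ps \<Phi> 3 z + crd 4 z * lam ps \<Phi> 3 z)\<^sup>2"
proof (rule nu_eqI[OF R z])
  let ?x = "crd 4 z" and ?\<nu> = "nu ps \<Phi> 3 z" and ?\<eta> = "eta ps \<Phi> 3 z" and ?\<mu> = "mu ps \<Phi> 3 z" and ?l = "lam ps \<Phi> 3 z"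
  have zW: "z \<in> W" using R z by blast
  have nz: "?\<mu> + ?x * ?l \<noteq> 0" using relation_4[OF zW n] by simp
  show "((\<lambda>t. (?\<eta> + (?x + t) * ?\<nu>) / (?\<mu> + (?x + t) * ?l)) has_real_derivative
      (?\<mu> * ?\<nu> - ?l * ?\<eta>) / (?\<mu> + ?x * ?l)\<^sup>2) (at 0)"
    using nz by (auto intro!: derivative_eq_intros simp: power2_eq_square algebra_simps)
  fix t assume w: "z + t *\<^sub>R pd 4 \<in> cube R"
  then have "z + t *\<^sub>R pd 4 \<in> W" using R by blast
  from relation_4[OF this n] constant_along[OF R z order_refl n w]
  show "crd 4 (\<Phi> (z + t *\<^sub>R pd 4)) = (?\<eta> + (?x + t) * ?\<nu>) / (?\<mu> + (?x + t) * ?l)"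
    by (simp del: crd_simps)
qed simp

lemma nu_regular:
  assumes R: "cube R \<subseteq> W" and z: "z \<in> cube R" and i: "5 \<le> i" "i \<le> CARD('n)"
    and c: "ps ! (i - 4) = Reg c" "qs ! (i - 4) = Reg c'"
  shows "nu ps \<Phi> i z = nu ps \<Phi> (i - 1) z / mu ps \<Phi> (i - 1) z"
proof (rule nu_eqI[OF R z])
  let ?x = "crd i z" and ?\<nu> = "nu ps \<Phi> (i - 1) z" and ?\<eta> = "eta ps \<Phi> (i - 1) z" and ?\<mu> = "mu ps \<Phi> (i - 1) z"
  have i4: "4 \<le> i" using i by simp
  have "?\<mu> \<noteq> 0" using relation_regular(2)[OF _ i c] R z by blast
  then show "((\<lambda>t. 1 / ?\<mu> * ((?x + t + c) * ?\<nu> + ?\<eta>) - c') has_real_derivative ?\<nu> / ?\<mu>) (at 0)"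
    by (auto intro!: derivative_eq_intros)
  fix t assume w: "z + t *\<^sub>R pd i \<in> cube R"
  then have "z + t *\<^sub>R pd i \<in> W" using R by blast
  from relation_regular(3)[OF this i c] constant_along[OF R z i4 i(2) w]
  show "crd i (\<Phi> (z + t *\<^sub>R pd i)) = 1 / ?\<mu> * ((?x + t + c) * ?\<nu> + ?\<eta>) - c'" by (simp del: crd_simps)
qed (use i in simp)

lemma nu_singular:
  assumes R: "cube R \<subseteq> W" and z: "z \<in> cube R" and i: "5 \<le> i" "i \<le> CARD('n)" and c: "ps ! (i - 4) = Sing"
  shows "nu ps \<Phi> i z = mu ps \<Phi> (i - 1) z * nu ps \<Phi> (i - 1) z / (nu ps \<Phi> (i - 1) z + crd i z * eta ps \<Phi> (i - 1) z)\<^sup>2"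
proof (rule nu_eqI[OF R z])
  let ?x = "crd i z" and ?\<nu> = "nu ps \<Phi> (i - 1) z" and ?\<eta> = "eta ps \<Phi> (i - 1) z" and ?\<mu> = "mu ps \<Phi> (i - 1) z"
  have i4: "4 \<le> i" using i by simp
  have zW: "z \<in> W" using R z by blast
  have nz: "?\<nu> + ?x * ?\<eta> \<noteq> 0" using relation_singular[OF zW i c] by simp
  show "((\<lambda>t. (?x + t) * ?\<mu> / (?\<nu> + (?x + t) * ?\<eta>)) has_real_derivative ?\<mu> * ?\<nu> / (?\<nu> + ?x * ?\<eta>)\<^sup>2) (at 0)"
    using nz by (auto intro!: derivative_eq_intros simp: power2_eq_square algebra_simps)
  fix t assume w: "z + t *\<^sub>R pd i \<in> cube R"
  then have "z + t *\<^sub>R pd i \<in> W" using R by blast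
  from relation_singular[OF this i c] constant_along[OF R z i4 i(2) w]
  show "crd i (\<Phi> (z + t *\<^sub>R pd i)) = (?x + t) * ?\<mu> / (?\<nu> + (?x + t) * ?\<eta>)" by (simp del: crd_simps)
qed (use i in simp)

section \<open>The truncations\<close>

lemma has_derivative_trunc:
  assumes "low i z \<in> W"
  shows "(trunc \<Phi> i has_derivative (\<lambda>v. low i (D\<Phi> (low i z) (low i v)))) (at z)"
  unfolding trunc_def[abs_def]
  by (rule bounded_linear.has_derivative[OF linear_low])
     (rule has_derivative_compose[OF bounded_linear_imp_has_derivative[OF linear_low] has_derivative_\<Phi>[OF assms]])

text \<open>The derivative of a truncation needs no truncation of its argument, since the difference lies in
  the preserved space \<open>vert (i + 1)\<close>.\<close>
lemma low_D\<Phi>_low: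
  assumes z: "z \<in> W" and i: "3 \<le> i" "i \<le> CARD('n)"
  shows "low i (D\<Phi> z (low i v)) = low i (D\<Phi> z v)"
proof -
  have "v - low i v \<in> vert (Suc i)" by (rule low_minus_vert[OF i(2)])
  then have "D\<Phi> z (v - low i v) \<in> vert (Suc i)" using D\<Phi>_vert[OF z, of "Suc i"] i by auto
  then have "low i (D\<Phi> z (v - low i v)) = 0" by (rule low_vert[OF i(2)])
  then show ?thesis
    by (simp add: linear_diff[OF linear_D\<Phi>[OF z]] linear_diff[OF bounded_linear.linear[OF linear_low]])
qed

lemma derivative_trunc:
  assumes R: "cube R \<subseteq> W" and z: "z \<in> cube R \<inter> Rsub i" and i: "3 \<le> i" "i \<le> CARD('n)"
  shows "frechet_derivative (trunc \<Phi> i) (at z) v = low i (D\<Phi> z v)"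
proof -
  have l: "low i z = z" using z Rsub_low[OF i(2)] by blast
  have zW: "z \<in> W" using R z by blast
  have "(trunc \<Phi> i has_derivative (\<lambda>v. low i (D\<Phi> (low i z) (low i v)))) (at z)"
    by (rule has_derivative_trunc) (simp add: l zW)
  from frechet_derivativeI[OF this] show ?thesis by (simp add: l low_D\<Phi>_low[OF zW i])
qed

lemma push_frame:
  assumes z: "z \<in> W" and i: "3 \<le> i" "i \<le> CARD('n)"
  shows "low i (D\<Phi> z (kappa1 ps i z)) = nu ps \<Phi> i z *\<^sub>R pd i + lam ps \<Phi> i z *\<^sub>R kappa2 qs i (\<Phi> z)"
    and "low i (D\<Phi> z (kappa2 ps i z)) = eta ps \<Phi> i z *\<^sub>R pd i + mu ps \<Phi> i z *\<^sub>R kappa2 qs i (\<Phi> z)"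
proof -
  note lin = bounded_linear.linear[OF linear_low]
  have p: "low i (pd i :: (real, 'n) vec) = pd i" using i by (intro low_pd) auto
  have k: "low i (kappa2 qs i (\<Phi> z)) = kappa2 qs i (\<Phi> z)" by (rule low_kappa2[OF i(1) order_refl i(2)])
  show "low i (D\<Phi> z (kappa1 ps i z)) = nu ps \<Phi> i z *\<^sub>R pd i + lam ps \<Phi> i z *\<^sub>R kappa2 qs i (\<Phi> z)"
    using low_vert[OF i(2) frame(1)[OF z i]]
    by (simp only: linear_diff[OF lin] linear_scale[OF lin] p k kappa1_eq[OF i(1)]) (simp add: algebra_simps)
  show "low i (D\<Phi> z (kappa2 ps i z)) = eta ps \<Phi> i z *\<^sub>R pd i + mu ps \<Phi> i z *\<^sub>R kappa2 qs i (\<Phi> z)"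
    using low_vert[OF i(2) frame(2)[OF z i]]
    by (simp only: linear_diff[OF lin] linear_scale[OF lin] p k) (simp add: algebra_simps)
qed

lemma push_vf_trunc:
  assumes R: "cube R \<subseteq> W" and i: "3 \<le> i" "i \<le> CARD('n)"
    and inj: "inj_on (trunc \<Phi> i) (cube R \<inter> Rsub i)" and z: "z \<in> cube R \<inter> Rsub i"
  shows "inv_into (cube R \<inter> Rsub i) (trunc \<Phi> i) (trunc \<Phi> i z) = z"
    and "push_vf (trunc \<Phi> i) (cube R \<inter> Rsub i) (kappa1 ps i) (trunc \<Phi> i z) =
      nu ps \<Phi> i z *\<^sub>R kappa1 qs i (trunc \<Phi> i z) + lam ps \<Phi> i z *\<^sub>R kappa2 qs i (trunc \<Phi> i z)"
    and "push_vf (trunc \<Phi> i) (cube R \<inter> Rsub i) (kappa2 ps i) (trunc \<Phi> i z) =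
      eta ps \<Phi> i z *\<^sub>R kappa1 qs i (trunc \<Phi> i z) + mu ps \<Phi> i z *\<^sub>R kappa2 qs i (trunc \<Phi> i z)"
proof -
  show inv: "inv_into (cube R \<inter> Rsub i) (trunc \<Phi> i) (trunc \<Phi> i z) = z" by (rule inv_into_f_f[OF inj z])
  have l: "low i z = z" using z Rsub_low[OF i(2)] by blast
  have zW: "z \<in> W" using R z by blast
  have k: "kappa2 qs i (trunc \<Phi> i z) = kappa2 qs i (\<Phi> z)"
    unfolding trunc_def l by (rule kappa2_low[OF i(1) order_refl i(2)])
  show "push_vf (trunc \<Phi> i) (cube R \<inter> Rsub i) (kappa1 ps i) (trunc \<Phi> i z) =
      nu ps \<Phi> i z *\<^sub>R kappa1 qs i (trunc \<Phi> i z) + lam ps \<Phi> i z *\<^sub>R kappa2 qs i (trunc \<Phi> i z)"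
    unfolding push_vf_def inv derivative_trunc[OF R z i] k push_frame[OF zW i] kappa1_eq[OF i(1), of qs] ..
  show "push_vf (trunc \<Phi> i) (cube R \<inter> Rsub i) (kappa2 ps i) (trunc \<Phi> i z) =
      eta ps \<Phi> i z *\<^sub>R kappa1 qs i (trunc \<Phi> i z) + mu ps \<Phi> i z *\<^sub>R kappa2 qs i (trunc \<Phi> i z)"
    unfolding push_vf_def inv derivative_trunc[OF R z i] k push_frame[OF zW i] kappa1_eq[OF i(1), of qs] ..
qed

lemma frame_independent:
  assumes i: "3 \<le> i" "i \<le> CARD('n)"
    and eq: "a *\<^sub>R kappa1 qs i y + b *\<^sub>R kappa2 qs i y = a' *\<^sub>R kappa1 qs i y + b' *\<^sub>R kappa2 qs i (y :: (real, 'n) vec)"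
  shows "a = a'" "b = b'"
proof -
  have "(a - a') *\<^sub>R pd i + (b - b') *\<^sub>R kappa2 qs i y \<in> vert (Suc i)"
    using eq by (simp add: kappa1_eq[OF i(1)] algebra_simps subspace_0[OF subspace_vert])
  from kappa2_pd_independent[OF i this] show "a = a'" "b = b'" by auto
qed

lemma push_coeffs_solution_unique:
  assumes R: "cube R \<subseteq> W" and i: "4 \<le> i" "i \<le> CARD('n)" and inj: "inj_on (trunc \<Phi> i) (cube R \<inter> Rsub i)"
  shows "push_coeffs ps qs \<Phi> R i (nu ps \<Phi> i) (eta ps \<Phi> i) (mu ps \<Phi> i)"
    and "push_coeffs ps qs \<Phi> R i \<nu>' \<eta>' \<mu>' \<Longrightarrow> z \<in> cube R \<Longrightarrow> \<nu>' z = nu ps \<Phi> i z \<and> \<eta>' z = eta ps \<Phi> i z \<and> \<mu>' z = mu ps \<Phi> i z"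
proof -
  have i3: "3 \<le> i" using i by simp
  note dep = depends_nu[OF R i3 i(2)] depends_eta[OF R i3 i(2)] depends_mu[OF R i3 i(2)]
  note pv = push_vf_trunc[OF R i3 i(2) inj]
  have lam0: "lam ps \<Phi> i z = 0" for z using i by (simp add: lam_def)
  show "push_coeffs ps qs \<Phi> R i (nu ps \<Phi> i) (eta ps \<Phi> i) (mu ps \<Phi> i)"
    unfolding push_coeffs_def Let_def using dep pv by (auto simp: lam0)
  assume c: "push_coeffs ps qs \<Phi> R i \<nu>' \<eta>' \<mu>'" and z: "z \<in> cube R"
  let ?w = "low i z"
  have w: "?w \<in> cube R \<inter> Rsub i" using low_cube[OF i(2) z] Rsub_low[OF i(2)] low_low[where 'n='n, OF i(2,2), of z] by auto
  have dep': "depends_on_first i R \<nu>'" "depends_on_first i R \<eta>'" "depends_on_first i R \<mu>'" using c by (auto simp: push_coeffs_def)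
  have "push_vf (trunc \<Phi> i) (cube R \<inter> Rsub i) (kappa1 ps i) (trunc \<Phi> i ?w) = \<nu>' ?w *\<^sub>R kappa1 qs i (trunc \<Phi> i ?w) + 0 *\<^sub>R kappa2 qs i (trunc \<Phi> i ?w)"
    "push_vf (trunc \<Phi> i) (cube R \<inter> Rsub i) (kappa2 ps i) (trunc \<Phi> i ?w) = \<eta>' ?w *\<^sub>R kappa1 qs i (trunc \<Phi> i ?w) + \<mu>' ?w *\<^sub>R kappa2 qs i (trunc \<Phi> i ?w)"
    using c w pv(1)[OF w] unfolding push_coeffs_def Let_def by auto
  note * = this[unfolded pv(2)[OF w] pv(3)[OF w]]
  have "\<nu>' ?w = nu ps \<Phi> i ?w" "\<eta>' ?w = eta ps \<Phi> i ?w" "\<mu>' ?w = mu ps \<Phi> i ?w"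
    using frame_independent[OF i3 i(2) *(1)] frame_independent[OF i3 i(2) *(2)] by auto
  then show "\<nu>' z = nu ps \<Phi> i z \<and> \<eta>' z = eta ps \<Phi> i z \<and> \<mu>' z = mu ps \<Phi> i z"
    using dep dep' z unfolding depends_on_first_def by auto
qed

lemma push_coeffs3_solution_unique:
  assumes R: "cube R \<subseteq> W" and inj: "inj_on (trunc \<Phi> 3) (cube R \<inter> Rsub 3)"
  shows "push_coeffs3 ps qs \<Phi> R (nu ps \<Phi> 3) (eta ps \<Phi> 3) (mu ps \<Phi> 3) (lam ps \<Phi> 3)"
    and "push_coeffs3 ps qs \<Phi> R \<nu>' \<eta>' \<mu>' l' \<Longrightarrow> z \<in> cube R \<Longrightarrow>
      \<nu>' z = nu ps \<Phi> 3 z \<and> \<eta>' z = eta ps \<Phi> 3 z \<and> \<mu>' z = mu ps \<Phi> 3 z \<and> l' z = lam ps \<Phi> 3 z"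
proof -
  note dep = depends_nu[OF R order_refl n3] depends_eta[OF R order_refl n3] depends_mu[OF R order_refl n3] depends_lam[OF R order_refl n3]
  note pv = push_vf_trunc[OF R order_refl n3 inj]
  show "push_coeffs3 ps qs \<Phi> R (nu ps \<Phi> 3) (eta ps \<Phi> 3) (mu ps \<Phi> 3) (lam ps \<Phi> 3)"
    unfolding push_coeffs3_def Let_def using dep pv by auto
  assume c: "push_coeffs3 ps qs \<Phi> R \<nu>' \<eta>' \<mu>' l'" and z: "z \<in> cube R"
  let ?w = "low 3 z"
  have w: "?w \<in> cube R \<inter> Rsub 3" using low_cube[OF n3 z] Rsub_low[OF n3] low_low[where 'n='n, OF n3 n3, of z] by auto
  have dep': "depends_on_first 3 R \<nu>'" "depends_on_first 3 R \<eta>'" "depends_on_first 3 R \<mu>'" "depends_on_first 3 R l'"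
    using c by (auto simp: push_coeffs3_def)
  have "push_vf (trunc \<Phi> 3) (cube R \<inter> Rsub 3) (kappa1 ps 3) (trunc \<Phi> 3 ?w) = \<nu>' ?w *\<^sub>R kappa1 qs 3 (trunc \<Phi> 3 ?w) + l' ?w *\<^sub>R kappa2 qs 3 (trunc \<Phi> 3 ?w)"
    "push_vf (trunc \<Phi> 3) (cube R \<inter> Rsub 3) (kappa2 ps 3) (trunc \<Phi> 3 ?w) = \<eta>' ?w *\<^sub>R kappa1 qs 3 (trunc \<Phi> 3 ?w) + \<mu>' ?w *\<^sub>R kappa2 qs 3 (trunc \<Phi> 3 ?w)"
    using c w pv(1)[OF w] unfolding push_coeffs3_def Let_def by auto
  note * = this[unfolded pv(2)[OF w] pv(3)[OF w]]
  have "\<nu>' ?w = nu ps \<Phi> 3 ?w" "l' ?w = lam ps \<Phi> 3 ?w" "\<eta>' ?w = eta ps \<Phi> 3 ?w" "\<mu>' ?w = mu ps \<Phi> 3 ?w"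
    using frame_independent[OF order_refl n3 *(1)] frame_independent[OF order_refl n3 *(2)] by auto
  then show "\<nu>' z = nu ps \<Phi> 3 z \<and> \<eta>' z = eta ps \<Phi> 3 z \<and> \<mu>' z = mu ps \<Phi> 3 z \<and> l' z = lam ps \<Phi> 3 z"
    using dep dep' z unfolding depends_on_first_def by auto
qed

lemma low_kr_space:
  fixes w :: "(real, 'n) vec"
  shows "low 3 ` kr_space q 3 w = span {kappa1 q 3 w, kappa2 q 3 w}"
proof -
  note lin = bounded_linear.linear[OF linear_low]
  have p: "low 3 (pd 3 :: (real, 'n) vec) = pd 3" using n3 by (intro low_pd) auto
  have k: "low 3 (kappa2 q 3 w) = kappa2 q 3 w" by (rule low_kappa2[OF order_refl order_refl n3])
  have p3: "(pd 3 :: (real, 'n) vec) \<in> vert 3" using n3 by (intro pd_vert) auto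
  show ?thesis
  proof (intro equalityI subsetI)
    fix v assume "v \<in> low 3 ` kr_space q 3 w"
    then obtain u f where u: "v = low 3 u" "u - f *\<^sub>R kappa2 q 3 w \<in> vert 3" (is "?r \<in> _") by (auto simp: kr_space_def)
    have "?r - crd 3 ?r *\<^sub>R pd 3 \<in> vert (Suc 3)" by (rule vert_split) (use u n3 in auto)
    from low_vert[OF n3 this] have "v = crd 3 ?r *\<^sub>R pd 3 + f *\<^sub>R kappa2 q 3 w"
      unfolding u(1) by (simp only: linear_diff[OF lin] linear_scale[OF lin] p k) (simp add: algebra_simps)
    then show "v \<in> span {kappa1 q 3 w, kappa2 q 3 w}"
      unfolding kappa1_eq[OF order_refl] by (auto intro: span_add span_scale span_base)
  next
    fix v assume "v \<in> span {kappa1 q 3 w, kappa2 q 3 w}"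
    then obtain f where "v - f *\<^sub>R pd 3 \<in> span {kappa2 q 3 w}"
      unfolding kappa1_eq[OF order_refl] span_insert[of "pd 3"] by blast
    then obtain g where g: "v - f *\<^sub>R pd 3 = g *\<^sub>R kappa2 q 3 w" by (auto simp: span_singleton)
    let ?u = "f *\<^sub>R pd 3 + g *\<^sub>R kappa2 q 3 w"
    have "?u \<in> kr_space q 3 w"
      using p3 vert_kr_space[of 3 q w] kappa2_kr_space[of q 3 w]
      by (intro subspace_add subspace_scale subspace_kr_space) auto
    moreover have "v = low 3 ?u" using g by (simp add: linear_add[OF lin] linear_scale[OF lin] p k diff_eq_eq)
    ultimately show "v \<in> low 3 ` kr_space q 3 w" by blast
  qed
qed

lemma first_order_contact:
  assumes R: "cube R \<subseteq> W" and z: "z \<in> cube R \<inter> Rsub 3"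
  shows "frechet_derivative (trunc \<Phi> 3) (at z) ` span {kappa1 ps 3 z, kappa2 ps 3 z} =
    span {kappa1 qs 3 (trunc \<Phi> 3 z), kappa2 qs 3 (trunc \<Phi> 3 z)}"
proof -
  have l: "low 3 z = z" using z Rsub_low[OF n3] by blast
  have zW: "z \<in> W" using R z by blast
  have k: "kappa2 qs 3 (trunc \<Phi> 3 z) = kappa2 qs 3 (\<Phi> z)" "kappa1 qs 3 (trunc \<Phi> 3 z) = kappa1 qs 3 (\<Phi> z)"
    unfolding trunc_def l by (rule kappa2_low[OF order_refl order_refl n3]) (simp add: kappa1_eq)
  have "frechet_derivative (trunc \<Phi> 3) (at z) ` span {kappa1 ps 3 z, kappa2 ps 3 z} = low 3 ` D\<Phi> z ` kr_space ps 3 z"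
    unfolding low_kr_space[symmetric] image_image derivative_trunc[OF R z order_refl n3] low_D\<Phi>_low[OF zW order_refl n3] ..
  also have "\<dots> = span {kappa1 qs 3 (\<Phi> z), kappa2 qs 3 (\<Phi> z)}"
    unfolding D\<Phi>_kr_space[OF zW order_refl n3] low_kr_space ..
  finally show ?thesis unfolding k .
qed

lemma smooth_trunc_low:
  assumes S: "open S" "\<And>x. x \<in> S \<Longrightarrow> low i x \<in> W" and i: "i \<le> CARD('n)"
  shows "smooth_on S (trunc \<Phi> i)"
  unfolding trunc_def[abs_def]
proof (intro smooth_on_linear_compose[OF linear_low] S(1))
  show "smooth_on S (\<lambda>x. \<Phi> (low i x))"
    by (rule smooth_on_compose[OF S(1) _ smooth_on_linear[OF linear_low] smooth_\<Phi>]) (use S(2) in blast)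
qed

text \<open>The inverse \<open>\<Psi>\<close> is triangular as well, so the truncation of \<open>\<Psi>\<close> inverts that of \<open>\<Phi>\<close>. Three cubes
  are needed: \<open>\<Phi>\<close> maps the smallest one into the cube on which \<open>\<Psi>\<close> is triangular, and \<open>\<Psi>\<close> maps the
  latter into the cube on which \<open>\<Phi>\<close> is triangular. The image is then cut out of \<open>\<real>\<^sup>i\<close> by an open
  condition.\<close>
lemma diffeo_sub_trunc:
  assumes R: "cube R \<subseteq> W" and R': "cube R' \<subseteq> W'" "\<Psi> ` cube R' \<subseteq> cube R" and r: "r \<le> R" "\<Phi> ` cube r \<subseteq> cube R'"
    and i: "3 \<le> i" "i \<le> CARD('n)"
  shows "diffeo_sub i (cube r \<inter> Rsub i) (trunc \<Phi> i)"
proof -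
  let ?Z = "cube r \<inter> Rsub i :: (real, 'n) vec set" and ?F = "trunc \<Phi> i" and ?G = "trunc \<Psi> i"
  have rR: "cube r \<subseteq> cube R" by (rule cube_mono[OF r(1)])
  then have rW: "cube r \<subseteq> W" using R by blast
  have ll: "low i (low i x) = low i x" for x :: "(real, 'n) vec" using low_low[where 'n='n, OF i(2,2)] by simp
  have Rs: "low i x \<in> Rsub i" for x :: "(real, 'n) vec" using Rsub_low[OF i(2)] ll by blast
  have lz: "low i z = z" if "z \<in> Rsub i" for z :: "(real, 'n) vec" using that Rsub_low[OF i(2)] by blast
  have F: "?F z = low i (\<Phi> z)" if "z \<in> cube R" for z unfolding trunc_def by (rule low_\<Phi>_low[OF R i that])
  have G: "?G y = low i (\<Psi> y)" if "y \<in> cube R'" for y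
    unfolding trunc_def by (rule kr_contact.low_\<Phi>_low[OF inverse_contact R'(1) i that])
  have GF: "?G (?F z) = z" "?F z \<in> cube R'" "?F z \<in> Rsub i" if z: "z \<in> ?Z" for z
  proof -
    have z': "z \<in> cube r" "z \<in> cube R" "z \<in> W" "z \<in> Rsub i" using z rR rW by auto
    have fz: "\<Phi> z \<in> cube R'" using r z' by blast
    show "?F z \<in> cube R'" "?F z \<in> Rsub i" unfolding F[OF z'(2)] by (rule low_cube[OF i(2) fz]) (rule Rs)
    have "?G (?F z) = low i (\<Psi> (low i (\<Phi> z)))" unfolding F[OF z'(2)] trunc_def[of \<Psi>] ll ..
    also have "\<dots> = low i (\<Psi> (\<Phi> z))" by (rule kr_contact.low_\<Phi>_low[OF inverse_contact R'(1) i fz])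
    also have "\<dots> = z" using diffeo_pair.\<psi>\<phi>[OF pair z'(3)] lz[OF z'(4)] by simp
    finally show "?G (?F z) = z" .
  qed
  have FG: "?F (?G y) = y" if y: "y \<in> cube R'" "y \<in> Rsub i" for y
  proof -
    have py: "\<Psi> y \<in> cube R" "y \<in> W'" using R' y by auto
    have "?F (?G y) = low i (\<Phi> (low i (\<Psi> y)))" unfolding G[OF y(1)] trunc_def[of \<Phi>] ll ..
    also have "\<dots> = low i (\<Phi> (\<Psi> y))" by (rule low_\<Phi>_low[OF R i py(1)])
    also have "\<dots> = y" using diffeo_pair.\<phi>\<psi>[OF pair py(2)] lz[OF y(2)] by simp
    finally show ?thesis .
  qed
  define N where "N = cube R' \<inter> ?G -` cube r"
  have smG: "smooth_on (cube R') ?G"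
    by (rule kr_contact.smooth_trunc_low[OF inverse_contact open_cube _ i(2)]) (use R'(1) low_cube[OF i(2)] in blast)
  have oN: "open N" unfolding N_def by (rule continuous_open_preimage[OF smooth_on_continuous[OF smG] open_cube open_cube])
  have FZ: "?F ` ?Z = Rsub i \<inter> N"
  proof (intro equalityI subsetI)
    fix y assume "y \<in> ?F ` ?Z"
    then obtain z where z: "z \<in> ?Z" "y = ?F z" by blast
    show "y \<in> Rsub i \<inter> N" unfolding z(2) N_def using GF[OF z(1)] z(1) by simp
  next
    fix y assume y: "y \<in> Rsub i \<inter> N"
    have "?G y \<in> ?Z" using y Rs by (simp add: N_def trunc_def)
    moreover have "y = ?F (?G y)" using FG[of y] y by (simp add: N_def)
    ultimately show "y \<in> ?F ` ?Z" by blast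
  qed
  have inj: "inj_on ?F ?Z" by (rule inj_on_inverseI[of _ ?G]) (rule GF(1))
  have clow: "continuous_on UNIV (low i :: (real, 'n) vec \<Rightarrow> (real, 'n) vec)" by (rule linear_continuous_on[OF linear_low])
  have preZ: "low i -` ?Z = low i -` cube r" and preF: "low i -` (?F ` ?Z) = low i -` N" unfolding FZ using Rs by auto
  have o1: "open (low i -` cube r :: (real, 'n) vec set)" by (rule open_vimage[OF open_cube clow])
  have o2: "open (low i -` N)" by (rule open_vimage[OF oN clow])
  have Flow: "?F \<circ> low i = ?F" "?G \<circ> low i = ?G" by (auto simp: trunc_def ll fun_eq_iff)
  have s1: "smooth_on (low i -` ?Z) (?F \<circ> low i)"
    unfolding preZ Flow by (rule smooth_trunc_low[OF o1 _ i(2)]) (use rW in blast)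
  have "smooth_on (low i -` N) ?G"
    by (rule kr_contact.smooth_trunc_low[OF inverse_contact o2 _ i(2)]) (use R'(1) in \<open>auto simp: N_def\<close>)
  then have s2: "smooth_on (low i -` (?F ` ?Z)) (inv_into ?Z ?F \<circ> low i)" unfolding preF
  proof (rule smooth_on_cong[OF o2, rotated])
    fix x assume "x \<in> low i -` N"
    then have "low i x \<in> ?F ` ?Z" unfolding FZ using Rs by auto
    then obtain z where z: "z \<in> ?Z" "low i x = ?F z" by blast
    have "inv_into ?Z ?F (low i x) = z" unfolding z(2) by (rule inv_into_f_f[OF inj z(1)])
    moreover have "?G x = z" using GF(1)[OF z(1)] z(2) fun_cong[OF Flow(2), of x] by simp
    ultimately show "?G x = (inv_into ?Z ?F \<circ> low i) x" by simp
  qed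
  show ?thesis unfolding diffeo_sub_def
    using inj s1 s2 openin_open_Int[OF open_cube, of "Rsub i" r] openin_open_Int[OF oN, of "Rsub i"]
    unfolding FZ by (simp add: Int_commute)
qed

text \<open>The open set \<open>S\<close> allows for further smallness conditions.\<close>
lemma exists_cube_diffeo_sub:
  fixes S :: "(real, 'n) vec set"
  assumes "open S" "0 \<in> S"
  shows "\<exists>r>0. cube r \<subseteq> S \<and> cube r \<subseteq> W \<and> (\<forall>i\<in>{3..CARD('n)}. diffeo_sub i (cube r \<inter> Rsub i) (trunc \<Phi> i))"
proof -
  interpret inv: kr_contact qs ps \<Psi> \<Phi> W' W by (rule inverse_contact)
  obtain R where R: "R > 0" "cube R \<subseteq> W" using cube_subset_open[OF openW zero(1)] by blast
  have "open (W' \<inter> \<Psi> -` cube R)"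
    by (rule continuous_open_preimage[OF smooth_on_continuous[OF inv.smooth_\<Phi>] inv.openW open_cube])
  moreover have "0 \<in> W' \<inter> \<Psi> -` cube R" using inv.zero zero_cube[OF R(1)] by simp
  ultimately obtain R' where R': "R' > 0" "cube R' \<subseteq> W' \<inter> \<Psi> -` cube R" using cube_subset_open by blast
  have "open (W \<inter> \<Phi> -` cube R')"
    by (rule continuous_open_preimage[OF smooth_on_continuous[OF smooth_\<Phi>] openW open_cube])
  then have "open (W \<inter> \<Phi> -` cube R' \<inter> S)" using assms by blast
  moreover have "0 \<in> W \<inter> \<Phi> -` cube R' \<inter> S" using zero zero_cube[OF R'(1)] assms by simp
  ultimately obtain s where s: "s > 0" "cube s \<subseteq> W \<inter> \<Phi> -` cube R' \<inter> S" using cube_subset_open by blast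
  let ?r = "min s R"
  have rs: "cube ?r \<subseteq> (cube s :: (real, 'n) vec set)" by (rule cube_mono) simp
  have "diffeo_sub i (cube ?r \<inter> Rsub i) (trunc \<Phi> i)" if "i \<in> {3..CARD('n)}" for i
    by (rule diffeo_sub_trunc[OF R(2)]) (use R' rs s that in auto)
  then show ?thesis using s R rs by (intro exI[of _ ?r]) auto
qed

end

lemma diffeo_sub_inj: "diffeo_sub i Z F \<Longrightarrow> inj_on F Z" by (simp add: diffeo_sub_def)

section \<open>Uniqueness\<close>

lemma lie_deriv_cong:
  assumes "open S" "z \<in> S" "\<And>z. z \<in> S \<Longrightarrow> f z = g z" "f differentiable (at z)"
  shows "lie_deriv X f z = lie_deriv X g z"
  unfolding lie_deriv_def using frechet_derivative_transform_within_open[OF assms(4,1,2,3)] by simp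

text \<open>All coefficients with index at most \<open>i\<close> are derivatives of the components with index at most
  \<open>i\<close>.\<close>
lemma coefficients_cong:
  fixes \<Phi> \<Phi>' :: "real ^ 'n::{finite,linorder} \<Rightarrow> (real, 'n) vec"
  assumes S: "open S" "z \<in> S" and eq: "\<And>z k. z \<in> S \<Longrightarrow> k \<in> {1..i} \<Longrightarrow> crd k (\<Phi> z) = crd k (\<Phi>' z)"
    and d: "\<Phi> differentiable (at z)" and i: "3 \<le> i"
  shows "nu ps \<Phi> i z = nu ps \<Phi>' i z" "eta ps \<Phi> i z = eta ps \<Phi>' i z" "lam ps \<Phi> i z = lam ps \<Phi>' i z" "mu ps \<Phi> i z = mu ps \<Phi>' i z"
proof -
  have L: "lie_deriv X (\<lambda>z. crd k (\<Phi> z)) z = lie_deriv X (\<lambda>z. crd k (\<Phi>' z)) z" if "k \<in> {1..i}" for X k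
  proof (rule lie_deriv_cong[OF S])
    show "(\<lambda>z. crd k (\<Phi> z)) differentiable at z"
      using d bounded_linear.has_derivative[OF bounded_linear_crd] unfolding differentiable_def by blast
  qed (use eq that in blast)
  have nu: "nu ps \<Phi> k z = nu ps \<Phi>' k z" and eta: "eta ps \<Phi> k z = eta ps \<Phi>' k z" if "k \<in> {1..i}" for k
    unfolding nu_def eta_def using L[OF that] by auto
  have lam: "lam ps \<Phi> k z = lam ps \<Phi>' k z" for k unfolding lam_def using L[of 1] i by simp
  have "m \<le> i \<longrightarrow> mu ps \<Phi> m z = mu ps \<Phi>' m z" if "3 \<le> m" for m
    using that
  proof (induction m rule: nat_induct_at_least)
    case base show ?case unfolding mu_3 using L[of 1] i by simp
  next
    case (Suc m)
    show ?case using Suc nu[of m] eta[of m] lam[of m] by (simp add: mu_step split: prolongation.split)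
  qed
  then show "nu ps \<Phi> i z = nu ps \<Phi>' i z" "eta ps \<Phi> i z = eta ps \<Phi>' i z" "lam ps \<Phi> i z = lam ps \<Phi>' i z" "mu ps \<Phi> i z = mu ps \<Phi>' i z"
    using nu[of i] eta[of i] lam[of i] i by auto
qed

text \<open>Going up by one index, the coefficients of both maps agree by \<open>coefficients_cong\<close>. They determine
  the next constant, by evaluation at \<open>0\<close>, and then the next component, by the relations. Whether the
  prolongation is regular or singular is decided by \<open>ps\<close> on both sides.\<close>
lemma kr_contact_unique:
  fixes \<Phi> \<Phi>' :: "real ^ 'n::{finite,linorder} \<Rightarrow> (real, 'n) vec"
  assumes c: "kr_contact ps qs \<Phi> \<Psi> W W'" and c': "kr_contact ps qs' \<Phi>' \<Psi>' V V'"
    and len: "length qs = CARD('n) - 3" "length qs' = CARD('n) - 3"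
    and ev: "\<forall>\<^sub>F z in nhds 0. trunc \<Phi>' 3 z = trunc \<Phi> 3 z"
  shows "qs' = qs" "\<forall>\<^sub>F z in nhds 0. \<Phi>' z = \<Phi> z"
proof -
  interpret f: kr_contact ps qs \<Phi> \<Psi> W W' by fact
  interpret g: kr_contact ps qs' \<Phi>' \<Psi>' V V' by fact
  obtain N where N: "open N" "0 \<in> N" "\<And>z. z \<in> N \<Longrightarrow> trunc \<Phi>' 3 z = trunc \<Phi> 3 z" using ev by (auto simp: eventually_nhds)
  have "open (N \<inter> W \<inter> V)" "0 \<in> N \<inter> W \<inter> V" using N f.openW g.openW f.zero g.zero by auto
  then obtain s where s: "s > 0" "cube s \<subseteq> N \<inter> W \<inter> V" using cube_subset_open by blast
  have sW: "cube s \<subseteq> W" and sV: "cube s \<subseteq> V" using s by auto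
  have "i \<le> CARD('n) \<longrightarrow> (\<forall>z\<in>cube s. \<forall>k\<in>{1..i}. crd k (\<Phi> z) = crd k (\<Phi>' z)) \<and> (\<forall>j\<in>{4..i}. qs ! (j - 4) = qs' ! (j - 4))"
    if "3 \<le> i" for i
    using that
  proof (induction i rule: nat_induct_at_least)
    case base
    have "crd k (\<Phi> z) = crd k (\<Phi>' z)" if z: "z \<in> cube s" and k: "k \<in> {1..3}" for z k
    proof -
      have k': "k \<in> {1..CARD('n)}" "k \<le> 3" using k f.n3 by auto
      have "crd k (\<Phi> z) = crd k (trunc \<Phi> 3 z)"
        unfolding trunc_def using f.crd_\<Phi>_low[OF sW, of k 3 z] k k' f.n3 z by (simp add: crd_low[where 'n='n, OF k'(1) f.n3])
      moreover have "crd k (\<Phi>' z) = crd k (trunc \<Phi>' 3 z)"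
        unfolding trunc_def using g.crd_\<Phi>_low[OF sV, of k 3 z] k k' f.n3 z by (simp add: crd_low[where 'n='n, OF k'(1) f.n3])
      ultimately show ?thesis using N(3)[of z] s z by auto
    qed
    then show ?case by auto
  next
    case (Suc i)
    let ?m = "Suc i"
    show ?case
    proof
      assume m: "?m \<le> CARD('n)"
      have IH1: "\<And>z k. z \<in> cube s \<Longrightarrow> k \<in> {1..i} \<Longrightarrow> crd k (\<Phi> z) = crd k (\<Phi>' z)"
        and IH2: "\<And>j. j \<in> {4..i} \<Longrightarrow> qs ! (j - 4) = qs' ! (j - 4)" using Suc m by auto
      have co: "nu ps \<Phi> i z = nu ps \<Phi>' i z" "eta ps \<Phi> i z = eta ps \<Phi>' i z" "lam ps \<Phi> i z = lam ps \<Phi>' i z" "mu ps \<Phi> i z = mu ps \<Phi>' i z"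
        if z: "z \<in> cube s" for z
      proof -
        have d: "\<Phi> differentiable (at z)" using smooth_on_differentiable[OF f.smooth_\<Phi>] sW z by blast
        show "nu ps \<Phi> i z = nu ps \<Phi>' i z" "eta ps \<Phi> i z = eta ps \<Phi>' i z" "lam ps \<Phi> i z = lam ps \<Phi>' i z" "mu ps \<Phi> i z = mu ps \<Phi>' i z"
          by (rule coefficients_cong[OF open_cube z IH1 d Suc.hyps]; assumption)+
      qed
      have com: "mu ps \<Phi> ?m z = mu ps \<Phi>' ?m z" if "z \<in> cube s" for z
        using co[OF that] Suc.hyps by (simp add: mu_step split: prolongation.split)
      have zz: "(0 :: (real, 'n) vec) \<in> cube s" by (rule zero_cube[OF s(1)])
      have new: "(\<forall>z\<in>cube s. crd ?m (\<Phi> z) = crd ?m (\<Phi>' z)) \<and> qs ! (?m - 4) = qs' ! (?m - 4)"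
      proof (cases "?m = 4")
        case True
        then have i: "i = 3" and n: "4 \<le> CARD('n)" using m by auto
        have "crd 4 (\<Phi> z) = crd 4 (\<Phi>' z)" if z: "z \<in> cube s" for z
        proof -
          have "z \<in> W" "z \<in> V" using z sW sV by auto
          then show ?thesis using f.relation_4(3)[OF _ n] g.relation_4(3)[OF _ n] co[OF z] com[OF z] by (simp add: i)
        qed
        then show ?thesis using True f.first(2)[OF n] g.first(2)[OF n] by simp
      next
        case False
        then have m5: "5 \<le> ?m" using Suc.hyps by simp
        show ?thesis
        proof (cases "ps ! (?m - 4)")
          case Sing
          have "crd ?m (\<Phi> z) = crd ?m (\<Phi>' z)" if z: "z \<in> cube s" for z
          proof -
            have "z \<in> W" "z \<in> V" using z sW sV by auto
            then show ?thesis using f.relation_singular(3)[OF _ m5 m Sing] g.relation_singular(3)[OF _ m5 m Sing] co[OF z] com[OF z] by simp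
          qed
          then show ?thesis using f.same_singularities[OF m5 m] g.same_singularities[OF m5 m] Sing by simp
        next
          case (Reg c)
          obtain d where d: "qs ! (?m - 4) = Reg d" using f.same_singularities[OF m5 m] Reg by (cases "qs ! (?m - 4)") auto
          obtain e where e: "qs' ! (?m - 4) = Reg e" using g.same_singularities[OF m5 m] Reg by (cases "qs' ! (?m - 4)") auto
          have de: "d = e" using f.regular_constants[OF m5 m Reg d] g.regular_constants[OF m5 m Reg e] co[OF zz] by simp
          have "crd ?m (\<Phi> z) = crd ?m (\<Phi>' z)" if z: "z \<in> cube s" for z
          proof -
            have "z \<in> W" "z \<in> V" using z sW sV by auto
            then show ?thesis using f.relation_regular(3)[OF _ m5 m Reg d] g.relation_regular(3)[OF _ m5 m Reg e] co[OF z] de by simp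
          qed
          then show ?thesis using d e de by simp
        qed
      qed
      show "(\<forall>z\<in>cube s. \<forall>k\<in>{1..?m}. crd k (\<Phi> z) = crd k (\<Phi>' z)) \<and> (\<forall>j\<in>{4..?m}. qs ! (j - 4) = qs' ! (j - 4))"
        using new IH1 IH2 by (auto simp: le_Suc_eq)
    qed
  qed
  from this[OF f.n3] have all: "\<And>z k. z \<in> cube s \<Longrightarrow> k \<in> {1..CARD('n)} \<Longrightarrow> crd k (\<Phi> z) = crd k (\<Phi>' z)"
    "\<And>j. j \<in> {4..CARD('n)} \<Longrightarrow> qs ! (j - 4) = qs' ! (j - 4)" by auto
  show "qs' = qs"
  proof (rule nth_equalityI)
    show "length qs' = length qs" using len by simp
    fix j assume "j < length qs'"
    then show "qs' ! j = qs ! j" using all(2)[of "j + 4"] len by simp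
  qed
  have "\<Phi>' z = \<Phi> z" if "z \<in> cube s" for z by (rule crd_eqI) (use all(1)[OF that] in simp)
  then show "\<forall>\<^sub>F z in nhds 0. \<Phi>' z = \<Phi> z"
    unfolding eventually_nhds using open_cube zero_cube[OF s(1)] by blast
qed

section \<open>Contact transformations between Goursat structures\<close>

lemma kr_contact_of_coordinates:
  fixes A :: "('a::topological_space, real ^ 'n::{finite,linorder}) atlas" and B :: "('b::topological_space, (real, 'n) vec) atlas"
  assumes "smooth_atlas A" "smooth_atlas B" and D: "goursat A D"
    and ct: "contact_transformation A D B E U \<phi>" and p: "p \<in> U" "\<phi> p = p'"
    and x: "kr_coordinates A D p Ux x ps" and y: "kr_coordinates B E p' Uy y qs"
  shows "\<exists>\<Psi> W'. kr_contact ps qs (y \<circ> \<phi> \<circ> inv_into Ux x) \<Psi> (x ` (U \<inter> Ux \<inter> \<phi> -` Uy)) W'"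
proof -
  obtain W' \<Psi> where c: "diffeo_pair euclid euclid (x ` (U \<inter> Ux \<inter> \<phi> -` Uy)) W' (y \<circ> \<phi> \<circ> inv_into Ux x) \<Psi>"
     "diffeo_pair.transports (x ` (U \<inter> Ux \<inter> \<phi> -` Uy)) (y \<circ> \<phi> \<circ> inv_into Ux x) (kr_distribution ps) (kr_distribution qs)"
    using contact_transformation_in_coordinates[OF assms(1,2) D ct x y] by blast
  have n: "3 \<le> CARD('n)" using D by (simp add: goursat_def)
  have inj: "inj_on x Ux" using x by (simp add: kr_coordinates_def diffeo_on_def)
  have px: "p \<in> Ux" "x p = 0" and py: "p' \<in> Uy" "y p' = 0" using x y by (auto simp: kr_coordinates_def)
  have "inv_into Ux x 0 = p" using inv_into_f_f[OF inj px(1)] px(2) by simp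
  then have "(y \<circ> \<phi> \<circ> inv_into Ux x) 0 = 0" using p py by simp
  moreover have "0 \<in> x ` (U \<inter> Ux \<inter> \<phi> -` Uy)" using px py p by (intro image_eqI[of _ _ p]) auto
  ultimately have "kr_contact ps qs (y \<circ> \<phi> \<circ> inv_into Ux x) \<Psi> (x ` (U \<inter> Ux \<inter> \<phi> -` Uy)) W'"
    by (intro kr_contact.intro c n) (use x y in \<open>auto simp: kr_coordinates_def\<close>)
  then show ?thesis by blast
qed

theorem theorem7p3:
  fixes A :: "('a::{t2_space,second_countable_topology}, real ^ 'n::{finite,linorder}) atlas"
    and B :: "('b::{t2_space,second_countable_topology}, (real, 'n) vec) atlas"
    and D :: "'a \<Rightarrow> 'a tvec set" and E :: "'b \<Rightarrow> 'b tvec set"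
    and p :: 'a and p' :: 'b and U Ux :: "'a set" and Uy :: "'b set" and \<phi> :: "'a \<Rightarrow> 'b"
    and x :: "'a \<Rightarrow> (real, 'n) vec" and y :: "'b \<Rightarrow> (real, 'n) vec"
    and ps qs :: "prolongation list" and w :: "nat list" and n :: nat
    and \<Phi> :: "(real, 'n) vec \<Rightarrow> (real, 'n) vec"
  assumes "smooth_atlas A" and "smooth_atlas B"
    and "n = CARD('n)"
    and "goursat A D" and "goursat B E"
    and "contact_transformation A D B E U \<phi>" and "p \<in> U" and "\<phi> p = p'"
    and "kr_coordinates A D p Ux x ps" and "kr_coordinates B E p' Uy y qs"
    and "w = sing_type A D p"
    and "\<Phi> = y \<circ> \<phi> \<circ> inv_into Ux x"
  shows "w = sing_type B E p' \<and>
    (\<exists>r>0. cube r \<subseteq> x ` (U \<inter> Ux \<inter> \<phi> -` Uy) \<and>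
      (\<forall>i\<in>{1..n}. depends_on_first (max 3 i) r (\<lambda>z. crd i (\<Phi> z))) \<and>
      (\<forall>i\<in>{3..n}. diffeo_sub i (cube r \<inter> Rsub i) (trunc \<Phi> i)) \<and>
      (\<exists>\<nu> \<eta> \<mu> l.
        smooth_on (cube r) l \<and>
        (\<forall>i\<in>{3..n}. smooth_on (cube r) (\<nu> i) \<and> smooth_on (cube r) (\<eta> i) \<and> smooth_on (cube r) (\<mu> i)) \<and>
        (\<forall>i\<in>{4..n}. push_coeffs ps qs \<Phi> r i (\<nu> i) (\<eta> i) (\<mu> i) \<and>
           (\<forall>\<nu>' \<eta>' \<mu>'. push_coeffs ps qs \<Phi> r i \<nu>' \<eta>' \<mu>' \<longrightarrow>
              (\<forall>z\<in>cube r. \<nu>' z = \<nu> i z \<and> \<eta>' z = \<eta> i z \<and> \<mu>' z = \<mu> i z))) \<and>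
        \<comment> \<open>(i)\<close>
        (\<forall>z \<in> cube r \<inter> Rsub 3.
           frechet_derivative (trunc \<Phi> 3) (at z) ` span {kappa1 ps 3 z, kappa2 ps 3 z} =
           span {kappa1 qs 3 (trunc \<Phi> 3 z), kappa2 qs 3 (trunc \<Phi> 3 z)}) \<and>
        push_coeffs3 ps qs \<Phi> r (\<nu> 3) (\<eta> 3) (\<mu> 3) l \<and>
        (\<forall>\<nu>' \<eta>' \<mu>' l'. push_coeffs3 ps qs \<Phi> r \<nu>' \<eta>' \<mu>' l' \<longrightarrow>
           (\<forall>z\<in>cube r. \<nu>' z = \<nu> 3 z \<and> \<eta>' z = \<eta> 3 z \<and> \<mu>' z = \<mu> 3 z \<and> l' z = l z)) \<and>
        \<comment> \<open>(ii)\<close>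
        (4 \<le> n \<longrightarrow> (\<forall>z\<in>cube r.
           \<mu> 3 z + crd 4 z * l z \<noteq> 0 \<and>
           crd 4 (\<Phi> z) = (\<eta> 3 z + crd 4 z * \<nu> 3 z) / (\<mu> 3 z + crd 4 z * l z) \<and>
           \<mu> 4 z = \<mu> 3 z + crd 4 z * l z \<and>
           \<nu> 4 z = lie_deriv (kappa1 ps 4) (\<lambda>z. crd 4 (\<Phi> z)) z \<and>
           \<nu> 4 z = (\<mu> 3 z * \<nu> 3 z - l z * \<eta> 3 z) / (\<mu> 3 z + crd 4 z * l z)\<^sup>2 \<and>
           \<eta> 4 z = lie_deriv (kappa2 ps 4) (\<lambda>z. crd 4 (\<Phi> z)) z)) \<and>
        \<comment> \<open>(iii)\<close>
        (\<forall>i\<in>{5..n}. w ! (i - 4) \<noteq> 1 \<longrightarrow>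
           (\<exists>c c'. ps ! (i - 4) = Reg c \<and> qs ! (i - 4) = Reg c' \<and>
              c' = c * (\<nu> (i - 1) 0 / \<mu> (i - 1) 0) + \<eta> (i - 1) 0 / \<mu> (i - 1) 0 \<and>
              (\<forall>z\<in>cube r.
                 \<mu> (i - 1) z \<noteq> 0 \<and>
                 crd i (\<Phi> z) =
                   1 / \<mu> (i - 1) z * ((crd i z + c) * \<nu> (i - 1) z + \<eta> (i - 1) z) - c' \<and>
                 \<mu> i z = \<mu> (i - 1) z \<and>
                 \<nu> i z = lie_deriv (kappa1 ps i) (\<lambda>z. crd i (\<Phi> z)) z \<and>
                 \<nu> i z = \<nu> (i - 1) z / \<mu> (i - 1) z \<and>
                 \<eta> i z = lie_deriv (kappa2 ps i) (\<lambda>z. crd i (\<Phi> z)) z))) \<and>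
        \<comment> \<open>(iv)\<close>
        (\<forall>i\<in>{5..n}. w ! (i - 4) = 1 \<longrightarrow>
           ps ! (i - 4) = Sing \<and> qs ! (i - 4) = Sing \<and>
           (\<forall>z\<in>cube r.
              \<nu> (i - 1) z + crd i z * \<eta> (i - 1) z \<noteq> 0 \<and>
              crd i (\<Phi> z) = crd i z * \<mu> (i - 1) z / (\<nu> (i - 1) z + crd i z * \<eta> (i - 1) z) \<and>
              \<mu> i z = \<nu> (i - 1) z + crd i z * \<eta> (i - 1) z \<and>
              \<nu> i z = lie_deriv (kappa1 ps i) (\<lambda>z. crd i (\<Phi> z)) z \<and>
              \<nu> i z = \<mu> (i - 1) z * \<nu> (i - 1) z / (\<nu> (i - 1) z + crd i z * \<eta> (i - 1) z)\<^sup>2 \<and>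
              \<eta> i z = lie_deriv (kappa2 ps i) (\<lambda>z. crd i (\<Phi> z)) z)))) \<and>
    \<comment> \<open>uniqueness\<close>
    (\<forall>E' q U' \<phi>' V y' qs' \<Phi>'.
       goursat B E' \<and> contact_transformation A D B E' U' \<phi>' \<and> p \<in> U' \<and> \<phi>' p = q \<and>
       kr_coordinates B E' q V y' qs' \<and> \<Phi>' = y' \<circ> \<phi>' \<circ> inv_into Ux x \<and>
       (\<forall>\<^sub>F z in nhds 0. trunc \<Phi>' 3 z = trunc \<Phi> 3 z) \<longrightarrow>
       qs' = qs \<and> (\<forall>\<^sub>F z in nhds 0. \<Phi>' z = \<Phi> z))"
proof -
  have n_ge: "3 \<le> n" using assms(3,4) by (simp add: goursat_def)
  obtain \<Psi> W' where K: "kr_contact ps qs \<Phi> \<Psi> (x ` (U \<inter> Ux \<inter> \<phi> -` Uy)) W'"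
    using kr_contact_of_coordinates[OF assms(1,2,4,6,7,8,9,10)] unfolding assms(12) by blast
  interpret kr_contact ps qs \<Phi> \<Psi> "x ` (U \<inter> Ux \<inter> \<phi> -` Uy)" W' by (rule K)
  let ?W = "x ` (U \<inter> Ux \<inter> \<phi> -` Uy)"
  have wps: "w = sing_type euclid (kr_distribution ps) (0 :: (real, 'n) vec)"
    unfolding assms(11) using sing_type_kr_coordinates[OF assms(1) _ assms(9)] n_ge assms(3) by simp
  have sing: "w = sing_type B E p'"
    unfolding wps sing_type_kr_push[OF pair tr zero(1)] zero(2)
    using sing_type_kr_coordinates[OF assms(2) _ assms(10)] n_ge assms(3) by simp
  have letter: "w ! (i - 4) = 1 \<longleftrightarrow> ps ! (i - 4) = Sing" if "i \<in> {5..n}" for i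
    unfolding wps using that assms(3) by (intro sing_type_kr) auto
  obtain r where r: "r > 0" "cube r \<subseteq> ?W" and dif: "\<forall>i\<in>{3..n}. diffeo_sub i (cube r \<inter> Rsub i) (trunc \<Phi> i)"
    using exists_cube_diffeo_sub[OF open_UNIV UNIV_I] unfolding assms(3)[symmetric] by blast
  have sub: "z \<in> cube r \<Longrightarrow> z \<in> ?W" for z using r(2) by blast
  have inj: "inj_on (trunc \<Phi> i) (cube r \<inter> Rsub i)" if "i \<in> {3..n}" for i
    using dif that diffeo_sub_inj by blast
  have dep: "\<forall>i\<in>{1..n}. depends_on_first (max 3 i) r (\<lambda>z. crd i (\<Phi> z))"
    using depends_component[OF r(2)] assms(3) by auto
  have smooth: "smooth_on (cube r) (lam ps \<Phi> 3)"
    "\<forall>i\<in>{3..n}. smooth_on (cube r) (nu ps \<Phi> i) \<and> smooth_on (cube r) (eta ps \<Phi> i) \<and> smooth_on (cube r) (mu ps \<Phi> i)"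
    by (auto intro!: smooth_on_subset[OF smooth_lam r(2)] smooth_on_subset[OF smooth_nu r(2)]
        smooth_on_subset[OF smooth_eta r(2)] smooth_on_subset[OF smooth_mu r(2)])
  have push: "\<forall>i\<in>{4..n}. push_coeffs ps qs \<Phi> r i (nu ps \<Phi> i) (eta ps \<Phi> i) (mu ps \<Phi> i) \<and>
           (\<forall>\<nu>' \<eta>' \<mu>'. push_coeffs ps qs \<Phi> r i \<nu>' \<eta>' \<mu>' \<longrightarrow>
              (\<forall>z\<in>cube r. \<nu>' z = nu ps \<Phi> i z \<and> \<eta>' z = eta ps \<Phi> i z \<and> \<mu>' z = mu ps \<Phi> i z))"
    (is "\<forall>i\<in>_. ?push i")
  proof
    fix i assume "i \<in> {4..n}"
    then have i: "4 \<le> i" "i \<le> CARD('n)" and i3: "i \<in> {3..n}" using assms(3) by auto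
    show "?push i"
      using push_coeffs_solution_unique[OF r(2) i inj[OF i3]] by blast
  qed
  have contact3: "\<forall>z \<in> cube r \<inter> Rsub 3.
           frechet_derivative (trunc \<Phi> 3) (at z) ` span {kappa1 ps 3 z, kappa2 ps 3 z} =
           span {kappa1 qs 3 (trunc \<Phi> 3 z), kappa2 qs 3 (trunc \<Phi> 3 z)}"
    using first_order_contact[OF r(2)] by blast
  have inj3: "inj_on (trunc \<Phi> 3) (cube r \<inter> Rsub 3)" using inj[of 3] n_ge by simp
  have push3: "push_coeffs3 ps qs \<Phi> r (nu ps \<Phi> 3) (eta ps \<Phi> 3) (mu ps \<Phi> 3) (lam ps \<Phi> 3)"
    "\<forall>\<nu>' \<eta>' \<mu>' l'. push_coeffs3 ps qs \<Phi> r \<nu>' \<eta>' \<mu>' l' \<longrightarrow>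
           (\<forall>z\<in>cube r. \<nu>' z = nu ps \<Phi> 3 z \<and> \<eta>' z = eta ps \<Phi> 3 z \<and> \<mu>' z = mu ps \<Phi> 3 z \<and> l' z = lam ps \<Phi> 3 z)"
    using push_coeffs3_solution_unique[OF r(2) inj3] by blast+
  have rel4: "4 \<le> n \<longrightarrow> (\<forall>z\<in>cube r.
           mu ps \<Phi> 3 z + crd 4 z * lam ps \<Phi> 3 z \<noteq> 0 \<and>
           crd 4 (\<Phi> z) = (eta ps \<Phi> 3 z + crd 4 z * nu ps \<Phi> 3 z) / (mu ps \<Phi> 3 z + crd 4 z * lam ps \<Phi> 3 z) \<and>
           mu ps \<Phi> 4 z = mu ps \<Phi> 3 z + crd 4 z * lam ps \<Phi> 3 z \<and>
           nu ps \<Phi> 4 z = lie_deriv (kappa1 ps 4) (\<lambda>z. crd 4 (\<Phi> z)) z \<and>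
           nu ps \<Phi> 4 z = (mu ps \<Phi> 3 z * nu ps \<Phi> 3 z - lam ps \<Phi> 3 z * eta ps \<Phi> 3 z) / (mu ps \<Phi> 3 z + crd 4 z * lam ps \<Phi> 3 z)\<^sup>2 \<and>
           eta ps \<Phi> 4 z = lie_deriv (kappa2 ps 4) (\<lambda>z. crd 4 (\<Phi> z)) z)"
    (is "_ \<longrightarrow> (\<forall>z\<in>_. ?rel z)")
  proof (intro impI ballI)
    fix z :: "(real, 'n) vec" assume n4: "4 \<le> n" and z: "z \<in> cube r"
    have n4': "4 \<le> CARD('n)" using n4 assms(3) by simp
    note rel = relation_4[OF sub[OF z] n4'] nu_4[OF r(2) z n4']
    have "nu ps \<Phi> 4 z = lie_deriv (kappa1 ps 4) (\<lambda>z. crd 4 (\<Phi> z)) z"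
      "eta ps \<Phi> 4 z = lie_deriv (kappa2 ps 4) (\<lambda>z. crd 4 (\<Phi> z)) z" by (simp_all add: nu_def eta_def)
    then show "?rel z" using rel(1) rel(2,3)[unfolded rel(1)] rel(4) by (intro conjI)
  qed
  have regular: "\<forall>i\<in>{5..n}. w ! (i - 4) \<noteq> 1 \<longrightarrow>
           (\<exists>c c'. ps ! (i - 4) = Reg c \<and> qs ! (i - 4) = Reg c' \<and>
              c' = c * (nu ps \<Phi> (i - 1) 0 / mu ps \<Phi> (i - 1) 0) + eta ps \<Phi> (i - 1) 0 / mu ps \<Phi> (i - 1) 0 \<and>
              (\<forall>z\<in>cube r.
                 mu ps \<Phi> (i - 1) z \<noteq> 0 \<and>
                 crd i (\<Phi> z) =
                   1 / mu ps \<Phi> (i - 1) z * ((crd i z + c) * nu ps \<Phi> (i - 1) z + eta ps \<Phi> (i - 1) z) - c' \<and>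
                 mu ps \<Phi> i z = mu ps \<Phi> (i - 1) z \<and>
                 nu ps \<Phi> i z = lie_deriv (kappa1 ps i) (\<lambda>z. crd i (\<Phi> z)) z \<and>
                 nu ps \<Phi> i z = nu ps \<Phi> (i - 1) z / mu ps \<Phi> (i - 1) z \<and>
                 eta ps \<Phi> i z = lie_deriv (kappa2 ps i) (\<lambda>z. crd i (\<Phi> z)) z))"
    (is "\<forall>i\<in>_. _ \<longrightarrow> ?reg i")
  proof (intro ballI impI)
    fix i assume i: "i \<in> {5..n}" and w1: "w ! (i - 4) \<noteq> 1"
    have i': "5 \<le> i" "i \<le> CARD('n)" using i assms(3) by auto
    obtain c where c: "ps ! (i - 4) = Reg c" using w1 letter[OF i] by (cases "ps ! (i - 4)") auto
    obtain c' where c': "qs ! (i - 4) = Reg c'" using c same_singularities[OF i'] by (cases "qs ! (i - 4)") auto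
    show "?reg i"
    proof (rule exI[of _ c], rule exI[of _ c'], intro conjI c c' regular_constants[OF i' c c'] ballI)
      fix z :: "(real, 'n) vec" assume z: "z \<in> cube r"
      note rel = relation_regular[OF sub[OF z] i' c c']
      show "mu ps \<Phi> (i - 1) z \<noteq> 0" by (rule rel(2))
      show "crd i (\<Phi> z) = 1 / mu ps \<Phi> (i - 1) z * ((crd i z + c) * nu ps \<Phi> (i - 1) z + eta ps \<Phi> (i - 1) z) - c'" by (rule rel(3))
      show "mu ps \<Phi> i z = mu ps \<Phi> (i - 1) z" by (rule rel(1))
      show "nu ps \<Phi> i z = nu ps \<Phi> (i - 1) z / mu ps \<Phi> (i - 1) z" by (rule nu_regular[OF r(2) z i' c c'])
    qed (simp_all add: nu_def eta_def)
  qed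
  have singular: "\<forall>i\<in>{5..n}. w ! (i - 4) = 1 \<longrightarrow>
           ps ! (i - 4) = Sing \<and> qs ! (i - 4) = Sing \<and>
           (\<forall>z\<in>cube r.
              nu ps \<Phi> (i - 1) z + crd i z * eta ps \<Phi> (i - 1) z \<noteq> 0 \<and>
              crd i (\<Phi> z) = crd i z * mu ps \<Phi> (i - 1) z / (nu ps \<Phi> (i - 1) z + crd i z * eta ps \<Phi> (i - 1) z) \<and>
              mu ps \<Phi> i z = nu ps \<Phi> (i - 1) z + crd i z * eta ps \<Phi> (i - 1) z \<and>
              nu ps \<Phi> i z = lie_deriv (kappa1 ps i) (\<lambda>z. crd i (\<Phi> z)) z \<and>
              nu ps \<Phi> i z = mu ps \<Phi> (i - 1) z * nu ps \<Phi> (i - 1) z / (nu ps \<Phi> (i - 1) z + crd i z * eta ps \<Phi> (i - 1) z)\<^sup>2 \<and>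
              eta ps \<Phi> i z = lie_deriv (kappa2 ps i) (\<lambda>z. crd i (\<Phi> z)) z)"
  proof (intro ballI impI conjI)
    fix i assume i: "i \<in> {5..n}" and w1: "w ! (i - 4) = 1"
    have i': "5 \<le> i" "i \<le> CARD('n)" using i assms(3) by auto
    show c: "ps ! (i - 4) = Sing" using w1 letter[OF i] by blast
    then show "qs ! (i - 4) = Sing" using same_singularities[OF i'] by blast
    fix z :: "(real, 'n) vec" assume z: "z \<in> cube r"
    note rel = relation_singular[OF sub[OF z] i' c]
    show "nu ps \<Phi> (i - 1) z + crd i z * eta ps \<Phi> (i - 1) z \<noteq> 0" using rel(2) unfolding rel(1) .
    show "crd i (\<Phi> z) = crd i z * mu ps \<Phi> (i - 1) z / (nu ps \<Phi> (i - 1) z + crd i z * eta ps \<Phi> (i - 1) z)"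
      using rel(3) unfolding rel(1) .
    show "mu ps \<Phi> i z = nu ps \<Phi> (i - 1) z + crd i z * eta ps \<Phi> (i - 1) z" by (rule rel(1))
    show "nu ps \<Phi> i z = mu ps \<Phi> (i - 1) z * nu ps \<Phi> (i - 1) z / (nu ps \<Phi> (i - 1) z + crd i z * eta ps \<Phi> (i - 1) z)\<^sup>2"
      by (rule nu_singular[OF r(2) z i' c])
  qed (simp_all add: nu_def eta_def)
  have unique: "\<forall>E' q U' \<phi>' V y' qs' \<Phi>'.
       goursat B E' \<and> contact_transformation A D B E' U' \<phi>' \<and> p \<in> U' \<and> \<phi>' p = q \<and>
       kr_coordinates B E' q V y' qs' \<and> \<Phi>' = y' \<circ> \<phi>' \<circ> inv_into Ux x \<and>
       (\<forall>\<^sub>F z in nhds 0. trunc \<Phi>' 3 z = trunc \<Phi> 3 z) \<longrightarrow>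
       qs' = qs \<and> (\<forall>\<^sub>F z in nhds 0. \<Phi>' z = \<Phi> z)"
  proof (intro allI impI)
    fix E' q U' \<phi>' V y' qs' \<Phi>'
    assume a: "goursat B E' \<and> contact_transformation A D B E' U' \<phi>' \<and> p \<in> U' \<and> \<phi>' p = q \<and>
       kr_coordinates B E' q V y' qs' \<and> \<Phi>' = y' \<circ> \<phi>' \<circ> inv_into Ux x \<and>
       (\<forall>\<^sub>F z in nhds 0. trunc \<Phi>' 3 z = trunc \<Phi> 3 z)"
    then have ct: "contact_transformation A D B E' U' \<phi>'" and pU: "p \<in> U'" and q: "\<phi>' p = q"
      and y': "kr_coordinates B E' q V y' qs'" and \<Phi>': "\<Phi>' = y' \<circ> \<phi>' \<circ> inv_into Ux x"
      and ev: "\<forall>\<^sub>F z in nhds 0. trunc \<Phi>' 3 z = trunc \<Phi> 3 z" by blast+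
    obtain \<Psi>' W2 where K': "kr_contact ps qs' \<Phi>' \<Psi>' (x ` (U' \<inter> Ux \<inter> \<phi>' -` V)) W2"
      using kr_contact_of_coordinates[OF assms(1,2,4) ct pU q assms(9) y'] unfolding \<Phi>' by blast
    have len: "length qs = CARD('n) - 3" "length qs' = CARD('n) - 3"
      using assms(10) y' by (auto simp: kr_coordinates_def)
    show "qs' = qs \<and> (\<forall>\<^sub>F z in nhds 0. \<Phi>' z = \<Phi> z)"
      using kr_contact_unique[OF K K' len ev] by blast
  qed
  show ?thesis
    apply (rule conjI[OF sing], rule conjI[OF exI[of _ r] unique])
    apply (intro conjI r dep dif)
    apply (rule exI[of _ "nu ps \<Phi>"], rule exI[of _ "eta ps \<Phi>"], rule exI[of _ "mu ps \<Phi>"], rule exI[of _ "lam ps \<Phi> 3"])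
    apply (intro conjI smooth push contact3 push3 rel4 regular singular)
    done
qed

end
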